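(* Let $\ell\in\{2,3,5,7\}$, let $p\neq\ell$ be a prime, let $k$ be a positive even integer, and let $d_k=\dim S_k(1)$. Then $$T_{p,k}(x)\equiv\prod_{j=1}^{d_k}(x-a_j)\pmod\ell,$$ where $(a_j)_{j\ge1}$ is a periodic sequence depending only on $p\bmod\ell$ and $k\bmod(\ell-1)$. In particular, if $p,q\ne\ell$ are primes with $p\equiv q\pmod\ell$, then $T_{p,k}(x)\equiv T_{q,k}(x)\pmod\ell$. Explicitly: For $\ell=3$: $T_{p,k}(x)\equiv(x-2)^{d_k}\pmod 3$ if $p\equiv1\pmod3$, and $T_{p,k}(x)\equiv x^{d_k}\pmod3$ if $p\equiv2\pmod3$. For $\ell=5$, one period of $(a_j)$, starting with $a_1$, is: - $p\equiv 1 \pmod 5$: $(2)$ if $k\equiv0\pmod4$; $(2)$ if $k\equiv2\pmod4$. - $p\equiv2\pmod5$: $(1,4)$ if $k\equiv0\pmod4$; $(2,3)$ if $k\equiv2\pmod4$. - $p\equiv3\pmod5$: $(2,3)$ if $k\equiv0\pmod4$; $(1,4)$ if $k\equiv2\pmod4$. - $p\equiv4\pmod5$: $(0)$ if $k\equiv0\pmod4$; $(0)$ if $k\equiv2\pmod4$. For $\ell=7$, one period of $(a_j)$, starting with $a_1$, for $k\equiv0$, $k\equiv2$, $k\equiv4\pmod6$ respectively, is: - $p\equiv1\pmod7$: $(2)$; $(2)$; $(2)$. - $p\equiv2\pmod7$: $(4,5)$; $(1,3)$; $(6,2)$. - $p\equiv3\pmod7$: $(0,1,0,6)$; $(0,3,0,4)$;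 $(5,0,2,0)$. - $p\equiv4\pmod7$: $(1,3)$; $(4,5)$; $(6,2)$. - $p\equiv5\pmod7$: $(0,3,0,4)$; $(0,1,0,6)$; $(2,0,5,0)$. - $p\equiv6\pmod7$: $(0)$; $(0)$; $(0)$.
   Context: $S_k(1)$ denotes the complex vector space of holomorphic cusp forms of weight $k$ for $SL_2(\mathbb{Z})$. For a positive integer $n$, the Hecke operator $T_n$ acts on $S_k(1)$ by $(T_nf)(z)=\frac1n\sum_{ad=n}a^k\sum_{0\le b<d}f\left(\frac{az+b}{d}\right)$, and $T_{n,k}(x)$ is the characteristic polynomial of $T_n$ acting on $S_k(1)$; it is monic with integer coefficients and degree $d_k=\dim S_k(1)$. Congruences of polynomials are coefficientwise. A listed tuple $(c_1,\dots,c_r)$ as one period means $a_j\equiv c_i\pmod\ell$ whenever $j\equiv i\pmod r$. *)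

theory Defs
  imports
    "HOL-Complex_Analysis.Complex_Analysis"
    "HOL-Number_Theory.Cong"
    "HOL-Library.Function_Algebras"
    "Jordan_Normal_Form.Char_Poly"
begin

definition upper_half_plane :: "complex set" where
  "upper_half_plane = {z. Im z > 0}"

text \<open>
  Functions on the upper half-plane are represented by functions on all of \<open>complex\<close> that
  are zero elsewhere, so that equality and linear independence only see values on the half-plane.
  The \<open>q\<close>-expansion starts at exponent 1, which expresses both holomorphy and vanishing
  at the cusp.
\<close>
definition cusp_forms :: "nat \<Rightarrow> (complex \<Rightarrow> complex) set" where
  "cusp_forms k = {f.
     (\<forall>z. z \<notin> upper_half_plane \<longrightarrow> f z = 0) \<and>
     f holomorphic_on upper_half_plane \<and>
     (\<forall>a b c d :: int. a * d - b * c = 1 \<longrightarrow>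
        (\<forall>z\<in>upper_half_plane.
           f ((of_int a * z + of_int b) / (of_int c * z + of_int d)) =
             (of_int c * z + of_int d) ^ k * f z)) \<and>
     (\<exists>u :: nat \<Rightarrow> complex. u 0 = 0 \<and>
        (\<forall>z\<in>upper_half_plane.
           (\<lambda>n. u n * exp (2 * of_real pi * \<i> * z) ^ n) sums f z))}"

definition hecke_op :: "nat \<Rightarrow> nat \<Rightarrow> (complex \<Rightarrow> complex) \<Rightarrow> complex \<Rightarrow> complex" where
  "hecke_op k n f z =
     1 / of_nat n *
       (\<Sum>(a, d) \<in> {(a, d). a * d = n}.
          of_nat a ^ k * (\<Sum>b<d. f ((of_nat a * z + of_nat b) / of_nat d)))"

interpretation cfun: vector_space "\<lambda>(c::complex) (f :: complex \<Rightarrow> complex) z. c * f z"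
  by unfold_locales (auto simp: fun_eq_iff algebra_simps)

definition basis_list :: "(complex \<Rightarrow> complex) set \<Rightarrow> (complex \<Rightarrow> complex) list \<Rightarrow> bool" where
  "basis_list V bs \<longleftrightarrow> distinct bs \<and> cfun.independent (set bs) \<and> cfun.span (set bs) = V"

text \<open>Column \<open>j\<close> holds the coordinates of the image of the \<open>j\<close>-th basis vector.\<close>
definition matrix_wrt ::
    "(complex \<Rightarrow> complex) list \<Rightarrow> ((complex \<Rightarrow> complex) \<Rightarrow> complex \<Rightarrow> complex) \<Rightarrow> complex Matrix.mat" where
  "matrix_wrt bs T =
     Matrix.mat (length bs) (length bs)
       (\<lambda>(i, j). cfun.representation (set bs) (T (bs ! j)) (bs ! i))"

text \<open>
  Meaningful for finite-dimensional \<open>V\<close> invariant under the linear map \<open>T\<close>; the result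
  then does not depend on the chosen basis.
\<close>
definition charpoly_on ::
    "(complex \<Rightarrow> complex) set \<Rightarrow> ((complex \<Rightarrow> complex) \<Rightarrow> complex \<Rightarrow> complex) \<Rightarrow> complex poly" where
  "charpoly_on V T = char_poly (matrix_wrt (SOME bs. basis_list V bs) T)"

definition cusp_dim :: "nat \<Rightarrow> nat" where
  "cusp_dim k = cfun.dim (cusp_forms k)"

definition hecke_poly :: "nat \<Rightarrow> nat \<Rightarrow> complex poly" where
  "hecke_poly n k = charpoly_on (cusp_forms k) (hecke_op k n)"

text \<open>Coefficientwise congruence; integrality of all coefficients is part of the claim.\<close>
definition poly_cong :: "nat \<Rightarrow> complex poly \<Rightarrow> complex poly \<Rightarrow> bool" where
  "poly_cong m P Q \<longleftrightarrow>
     (\<forall>i. coeff P i \<in> \<int> \<and> coeff Q i \<in> \<int> \<and>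
        (\<exists>c::int. coeff P i - coeff Q i = of_nat m * of_int c))"

text \<open>Sequences are indexed from 1 and their value at 0 is ignored, while list indices start at 0.\<close>
definition has_period_mod :: "nat \<Rightarrow> (nat \<Rightarrow> int) \<Rightarrow> int list \<Rightarrow> bool" where
  "has_period_mod m a cs \<longleftrightarrow>
     (\<forall>i\<in>{1..length cs}. \<forall>j\<ge>1. [j = i] (mod length cs) \<longrightarrow> [a j = cs ! (i - 1)] (mod int m))"

end

theory Submission
  imports Defs
begin

text \<open>
  A form of weight \<open>k\<close> is an integral combination of the basis
  \<open>E\<^sub>4\<^bsup>\<alpha>\<^esup> E\<^sub>6\<^bsup>\<beta>\<^esup> \<Delta>\<^sup>j\<close>, and it suffices to show that \<open>T\<^sub>p\<close> is triangular on it modulo \<open>l\<close> and to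
  find the diagonal.

  For \<open>l = 5, 7\<close> one of \<open>E\<^sub>4\<close>, \<open>E\<^sub>6\<close> is \<open>1\<close> modulo \<open>l\<close>; call the other one \<open>y\<close>. The diagonal entries of
  \<open>T\<^sub>p\<close> on the powers of \<open>y\<close> satisfy two recursions: \<open>\<theta> = q d/dq\<close> raises the degree in \<open>y\<close> by a fixed
  amount and satisfies \<open>T\<^sub>p \<theta> = p \<theta> T\<^sub>p\<close>, which multiplies an entry by \<open>p\<close> unless \<open>\<theta>\<close> kills the top
  term, and in that remaining case Frobenius \<open>f \<mapsto> f(q\<^sup>l)\<close>, which is \<open>f\<^sup>l\<close> modulo \<open>l\<close>, commutes with \<open>T\<^sub>p\<close>.

  For \<open>l = 2, 3\<close> both are \<open>1\<close> and only \<open>\<Delta>\<^sup>j\<close> in weight \<open>12 j\<close> matters. At the elliptic point \<open>\<i>\<close> or \<open>\<rho>\<close>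
  all basis elements but \<open>\<Delta>\<^sup>j\<close> vanish, so \<open>p\<close> times the diagonal entry is a sum of \<open>j\<close>-th powers of
  normalised values of \<open>\<Delta>\<close> at the lattices of index \<open>p\<close>. The units of \<open>\<int>[\<i>]\<close> or \<open>\<int>[\<rho>]\<close> permute these
  lattices in orbits of length \<open>l\<close> with equal values, except for at most two ideals of norm \<open>p\<close>, whose
  values are \<open>12 j\<close>-th powers of algebraic integers of norm \<open>p\<close>.
\<close>

section \<open>\<open>q\<close>-expansions of modular forms\<close>

text \<open>For l = 2, 3 the recursions used for 5 and 7 give too little: E_2 is 1 modulo 24, so
  theta Delta = Delta modulo l and theta no longer moves the degree. Hence the passage to complex
  values. There p times the diagonal entry is l times a sum over orbit representatives plus an
  integer known modulo l, and the obstacle is that this orbit sum has to be an integer. No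
  integrality of the single values is available; but the same formula for all exponents j shows that
  l times every power sum is an integer, and Newton's identities upgrade this to integrality of the
  sums themselves.

  A form is represented by a power series convergent in the unit disc, so that congruences
  (coefficients) and transformation laws (values) concern one object. Two analytic facts carry the
  structure theory: there is no nonzero cusp form of even weight at most 10, and Delta has no zero.
  Division by Delta yields the dimension and a basis whose j-th member starts with q^j; this
  unitriangular shape makes the Hecke matrix integral and lets it be reduced modulo l.\<close>

definition nome :: "complex \<Rightarrow> complex" where
  "nome z = exp (2 * of_real pi * \<i> * z)"

abbreviation uhp :: "complex set" where "uhp \<equiv> upper_half_plane"

lemma in_uhp_iff [simp]: "z \<in> uhp \<longleftrightarrow> Im z > 0"
  by (simp add: upper_half_plane_def)

lemma open_uhp: "open uhp"
  unfolding upper_half_plane_def by (rule open_halfspace_Im_gt)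

lemma norm_nome: "norm (nome z) = exp (- 2 * pi * Im z)"
  by (simp add: nome_def)

lemma norm_nome_less_1: "Im z > 0 \<Longrightarrow> norm (nome z) < 1"
  by (simp add: norm_nome)

lemma nome_nonzero [simp]: "nome z \<noteq> 0"
  by (simp add: nome_def)

lemma nome_add: "nome (z + w) = nome z * nome w"
  by (simp add: nome_def ring_distribs exp_add)

lemma nome_of_int [simp]: "nome (of_int n) = 1"
  unfolding nome_def by (subst exp_eq_1) (auto intro!: exI[of _ n])

lemma nome_plus_of_int [simp]: "nome (z + of_int n) = nome z"
  by (simp add: nome_add)

lemma nome_power: "nome z ^ n = nome (of_nat n * z)"
  by (simp add: nome_def flip: exp_of_nat_mult) (simp add: mult_ac)

lemma has_field_derivative_nome [derivative_intros]:
  "(f has_field_derivative f') (at z within S) \<Longrightarrow>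
   ((\<lambda>z. nome (f z)) has_field_derivative (2 * of_real pi * \<i> * nome (f z) * f')) (at z within S)"
  unfolding nome_def by (auto intro!: derivative_eq_intros)

lemma nome_surj:
  assumes "w \<noteq> 0" "norm w < 1"
  obtains z where "Im z > 0" "nome z = w"
proof
  let ?z = "Ln w / (2 * of_real pi * \<i>)"
  have "Im ?z = - ln (norm w) / (2 * pi)"
    using assms by (simp add: Im_divide power2_eq_square)
  then show "Im ?z > 0"
    using assms by (simp add: divide_neg_pos)
  show "nome ?z = w"
    using assms by (simp add: nome_def)
qed

text \<open>Radius 1 is what the half-plane asks for: the nome maps it onto the punctured unit
  disc.\<close>

definition conv_disc :: "complex fps \<Rightarrow> bool" where
  "conv_disc A \<longleftrightarrow> fps_conv_radius A \<ge> 1"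

lemma conv_disc_const [simp]: "conv_disc (fps_const c)" "conv_disc 0" "conv_disc 1"
  by (simp_all add: conv_disc_def)

lemma conv_disc_X [simp]: "conv_disc fps_X"
  by (simp add: conv_disc_def)

lemma conv_disc_add [simp]: "conv_disc A \<Longrightarrow> conv_disc B \<Longrightarrow> conv_disc (A + B)"
  unfolding conv_disc_def by (rule order.trans[OF _ fps_conv_radius_add]) simp

lemma conv_disc_diff [simp]: "conv_disc A \<Longrightarrow> conv_disc B \<Longrightarrow> conv_disc (A - B)"
  unfolding conv_disc_def by (rule order.trans[OF _ fps_conv_radius_diff]) simp

lemma conv_disc_mult [simp]: "conv_disc A \<Longrightarrow> conv_disc B \<Longrightarrow> conv_disc (A * B)"
  unfolding conv_disc_def by (rule order.trans[OF _ fps_conv_radius_mult]) simp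

lemma conv_disc_power [simp]: "conv_disc A \<Longrightarrow> conv_disc (A ^ n)"
  by (induction n) simp_all

lemma conv_disc_deriv [simp]: "conv_disc A \<Longrightarrow> conv_disc (fps_deriv A)"
  unfolding conv_disc_def by (rule order.trans[OF _ fps_conv_radius_deriv])

lemma conv_disc_radius: "conv_disc A \<Longrightarrow> norm w < 1 \<Longrightarrow> ereal (norm w) < fps_conv_radius A"
  unfolding conv_disc_def by (rule less_le_trans[of _ "1::ereal"]) simp_all

lemma conv_discI:
  assumes "\<And>w. norm w < 1 \<Longrightarrow> summable (\<lambda>n. fps_nth A n * w ^ n)"
  shows "conv_disc A"
  unfolding conv_disc_def fps_conv_radius_def
proof (rule conv_radius_geI_ex')
  fix r :: real
  assume "0 < r" "ereal r < 1"
  then show "summable (\<lambda>n. fps_nth A n * of_real r ^ n)"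
    using assms[of "of_real r"] by simp
qed

definition qfun :: "complex fps \<Rightarrow> complex \<Rightarrow> complex" where
  "qfun A z = eval_fps A (nome z)"

lemma qfun_add: "conv_disc A \<Longrightarrow> conv_disc B \<Longrightarrow> Im z > 0 \<Longrightarrow> qfun (A + B) z = qfun A z + qfun B z"
  by (simp add: qfun_def eval_fps_add conv_disc_radius norm_nome_less_1)

lemma qfun_diff: "conv_disc A \<Longrightarrow> conv_disc B \<Longrightarrow> Im z > 0 \<Longrightarrow> qfun (A - B) z = qfun A z - qfun B z"
  by (simp add: qfun_def eval_fps_diff conv_disc_radius norm_nome_less_1)

lemma qfun_mult: "conv_disc A \<Longrightarrow> conv_disc B \<Longrightarrow> Im z > 0 \<Longrightarrow> qfun (A * B) z = qfun A z * qfun B z"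
  by (simp add: qfun_def eval_fps_mult conv_disc_radius norm_nome_less_1)

lemma qfun_const [simp]: "qfun (fps_const c) z = c" "qfun 0 z = 0" "qfun 1 z = 1"
  by (simp_all add: qfun_def)

lemma qfun_X [simp]: "qfun fps_X z = nome z"
  by (simp add: qfun_def)

lemma qfun_power: "conv_disc A \<Longrightarrow> Im z > 0 \<Longrightarrow> qfun (A ^ n) z = qfun A z ^ n"
  by (induction n) (simp_all add: qfun_mult)

lemma qfun_plus_of_int [simp]: "qfun A (z + of_int n) = qfun A z"
  by (simp add: qfun_def)

lemma qfun_sums:
  assumes "conv_disc A" "Im z > 0"
  shows "(\<lambda>n. fps_nth A n * nome z ^ n) sums qfun A z"
  unfolding qfun_def
  by (rule sums_eval_fps) (simp add: conv_disc_radius assms norm_nome_less_1)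

lemma qfun_has_field_derivative:
  assumes "conv_disc A" "Im z > 0"
  shows "(qfun A has_field_derivative (2 * of_real pi * \<i> * qfun (fps_X * fps_deriv A) z)) (at z)"
proof -
  have r: "ereal (norm (nome z)) < fps_conv_radius A"
    by (simp add: conv_disc_radius assms norm_nome_less_1)
  have "((\<lambda>z. eval_fps A (nome z)) has_field_derivative
      (eval_fps (fps_deriv A) (nome z) * (2 * of_real pi * \<i> * nome z * 1))) (at z)"
    by (rule DERIV_chain2[where f = "eval_fps A" and g = nome])
       (use has_field_derivative_eval_fps[OF r] has_field_derivative_nome[OF DERIV_ident] in auto)
  moreover have "qfun (fps_X * fps_deriv A) z = nome z * eval_fps (fps_deriv A) (nome z)"
    using assms by (subst qfun_mult) (simp_all add: qfun_def)
  ultimately show ?thesis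
    unfolding qfun_def by (simp add: mult_ac)
qed

lemma qfun_holomorphic: "conv_disc A \<Longrightarrow> qfun A holomorphic_on uhp"
  unfolding holomorphic_on_open[OF open_uhp] using qfun_has_field_derivative in_uhp_iff by blast

text \<open>The nome misses 0, so agreement of the two sums at 0 comes from continuity; after that
  the identity theorem for power series applies near 0.\<close>

lemma qfun_eqD:
  assumes "conv_disc A" "conv_disc B" "\<And>z. Im z > 0 \<Longrightarrow> qfun A z = qfun B z"
  shows "A = B"
proof (rule eval_fps_eqD)
  show "fps_conv_radius A > 0" "fps_conv_radius B > 0"
    using conv_disc_radius[OF assms(1), of 0] conv_disc_radius[OF assms(2), of 0]
    by (simp_all flip: zero_ereal_def)
  have eq: "eval_fps A w = eval_fps B w" if "norm w < 1" "w \<noteq> 0" for w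
    using assms(3) nome_surj[OF that(2,1)] unfolding qfun_def by metis
  have cont: "isCont (eval_fps C) 0" if "conv_disc C" for C
    using that conv_disc_radius[OF that, of 0]
    by (intro continuous_eval_fps) auto
  have "eventually (\<lambda>w. w \<in> ball 0 1 - {0}) (at (0::complex))"
    by (intro eventually_at_in_open) auto
  then have ev: "eventually (\<lambda>w. eval_fps A w = eval_fps B w) (at 0)"
    by eventually_elim (use eq in auto)
  have "eval_fps A 0 = eval_fps B 0"
  proof (rule tendsto_unique[of "at (0::complex)"])
    show "(eval_fps A \<longlongrightarrow> eval_fps A 0) (at 0)"
      using cont[OF assms(1)] by (simp add: isCont_def)
    show "(eval_fps A \<longlongrightarrow> eval_fps B 0) (at 0)"
      using cont[OF assms(2)] unfolding isCont_def
      by (rule Lim_transform_eventually) (use ev in \<open>eventually_elim, simp\<close>)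
  qed simp
  then have "eventually (\<lambda>w. eval_fps A w = eval_fps B w) (nhds 0)"
    using ev by (simp add: eventually_nhds_conv_at)
  then show "eventually (\<lambda>w. eval_fps A w = eval_fps B w) (nhds 0)" .
qed

text \<open>Periodicity is built into the q-expansion, so the law for z -> -1/z is the only one
  required; \<open>mod_forms_mobius\<close> recovers all of SL_2(Z) for even weight.\<close>

definition mod_forms :: "nat \<Rightarrow> complex fps set" where
  "mod_forms k = {A. conv_disc A \<and> (\<forall>z. Im z > 0 \<longrightarrow> qfun A (- (1 / z)) = z ^ k * qfun A z)}"

lemma mod_forms_conv [dest]: "A \<in> mod_forms k \<Longrightarrow> conv_disc A"
  by (simp add: mod_forms_def)

lemma mod_forms_S: "A \<in> mod_forms k \<Longrightarrow> Im z > 0 \<Longrightarrow> qfun A (- (1 / z)) = z ^ k * qfun A z"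
  by (simp add: mod_forms_def)

lemma Im_S: "Im z > 0 \<Longrightarrow> Im (- (1 / z)) > 0"
proof -
  assume "Im z > 0"
  moreover have "Im (- (1 / z)) = Im z / (norm z)\<^sup>2"
    by (simp add: Im_divide cmod_power2)
  ultimately show ?thesis
    by (auto intro!: divide_pos_pos)
qed

lemma mod_forms_0 [simp]: "0 \<in> mod_forms k"
  by (simp add: mod_forms_def)

lemma mod_forms_1 [simp]: "1 \<in> mod_forms 0"
  by (simp add: mod_forms_def)

lemma mod_forms_const [simp]: "fps_const c \<in> mod_forms 0"
  by (simp add: mod_forms_def)

lemma mod_forms_add: "A \<in> mod_forms k \<Longrightarrow> B \<in> mod_forms k \<Longrightarrow> A + B \<in> mod_forms k"
  by (auto simp: mod_forms_def qfun_add qfun_add[OF _ _ Im_S] ring_distribs)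

lemma mod_forms_diff: "A \<in> mod_forms k \<Longrightarrow> B \<in> mod_forms k \<Longrightarrow> A - B \<in> mod_forms k"
  by (auto simp: mod_forms_def qfun_diff qfun_diff[OF _ _ Im_S] ring_distribs)

lemma mod_forms_mult: "A \<in> mod_forms k \<Longrightarrow> B \<in> mod_forms l \<Longrightarrow> A * B \<in> mod_forms (k + l)"
  by (auto simp: mod_forms_def qfun_mult qfun_mult[OF _ _ Im_S] power_add)

lemma mod_forms_scale: "A \<in> mod_forms k \<Longrightarrow> fps_const c * A \<in> mod_forms k"
  using mod_forms_mult[OF mod_forms_const, of A k c] by simp

lemma mod_forms_power: "A \<in> mod_forms k \<Longrightarrow> A ^ n \<in> mod_forms (n * k)"
  by (induction n) (auto intro: mod_forms_mult)

lemma mod_forms_sum: "(\<And>i. i \<in> I \<Longrightarrow> A i \<in> mod_forms k) \<Longrightarrow> sum A I \<in> mod_forms k"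
  by (induction I rule: infinite_finite_induct) (auto intro: mod_forms_add)

section \<open>The action of SL_2(Z) and its fundamental domain\<close>

lemma Im_mobius:
  fixes a b c d :: int
  assumes "a * d - b * c = 1" "Im z > 0"
  shows "of_int c * z + of_int d \<noteq> (0 :: complex)"
    and "Im ((of_int a * z + of_int b) / (of_int c * z + of_int d)) =
         Im z / (norm (of_int c * z + of_int d))\<^sup>2"
    and "Im ((of_int a * z + of_int b) / (of_int c * z + of_int d)) > 0"
proof -
  show nz: "of_int c * z + of_int d \<noteq> (0 :: complex)"
  proof
    assume eq: "of_int c * z + of_int d = (0 :: complex)"
    then have "Im (of_int c * z + of_int d) = 0" by simp
    then have "c = 0" using assms by simp
    with eq assms show False by simp
  qed
  have "Im ((of_int a * z + of_int b) * cnj (of_int c * z + of_int d)) = of_int (a * d - b * c) * Im z"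
    by (simp add: algebra_simps)
  then have *: "Im ((of_int a * z + of_int b) * cnj (of_int c * z + of_int d)) = Im z"
    using assms by simp
  show eq: "Im ((of_int a * z + of_int b) / (of_int c * z + of_int d)) =
         Im z / (norm (of_int c * z + of_int d))\<^sup>2"
    by (subst complex_div_cnj) (use * in \<open>simp flip: of_real_power\<close>)
  show "Im ((of_int a * z + of_int b) / (of_int c * z + of_int d)) > 0"
    unfolding eq using nz assms by simp
qed

text \<open>Euclid's algorithm on the bottom row: with d = t c + r, a translation by t and an
  inversion replace (c, d) by (-r, c), so |c| decreases. At c = 0 the matrix is a translation up to
  sign, and evenness of k settles the sign.\<close>

lemma mod_forms_mobius:
  assumes A: "A \<in> mod_forms k" and k: "even k"
  assumes "a * d - b * c = (1 :: int)" "Im z > 0"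
  shows "qfun A ((of_int a * z + of_int b) / (of_int c * z + of_int d)) =
         (of_int c * z + of_int d) ^ k * qfun A z"
  using assms(3,4)
proof (induction "nat \<bar>c\<bar>" arbitrary: a b c d z rule: less_induct)
  case less
  show ?case
  proof (cases "c = 0")
    case True
    with less.prems have "a * d = 1" by simp
    then have "(a = 1 \<and> d = 1) \<or> (a = -1 \<and> d = -1)"
      using zmult_eq_1_iff by blast
    then show ?thesis
    proof
      assume "a = 1 \<and> d = 1"
      with True show ?thesis by simp
    next
      assume *: "a = -1 \<and> d = -1"
      have "qfun A (z + of_int (-b)) = qfun A z" by (rule qfun_plus_of_int)
      with * True k show ?thesis by simp
    qed
  next
    case False
    define t r where "t = d div c" and "r = d mod c"
    define w where "w = z + of_int t"
    have d: "d = t * c + r" by (simp add: t_def r_def)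
    have w: "Im w > 0" using less.prems by (simp add: w_def)
    have lt: "nat \<bar>-r\<bar> < nat \<bar>c\<bar>"
      using False by (simp add: r_def abs_mod_less)
    have det: "(a * t - b) * c - a * (- r) = 1"
      using less.prems unfolding d by (simp add: algebra_simps)
    have nz: "w \<noteq> 0" using w by auto
    have IH: "qfun A ((of_int (a * t - b) * (- (1 / w)) + of_int a) / (of_int (-r) * (- (1 / w)) + of_int c)) =
         (of_int (-r) * (- (1 / w)) + of_int c) ^ k * qfun A (- (1 / w))"
      by (rule less.hyps[OF lt det Im_S[OF w]])
    have expand: "w * (x * (- (1 / w)) + y) = y * w - x" for x y :: complex
      using nz by (simp add: algebra_simps)
    have n: "of_int a * z + of_int b = w * (of_int (a * t - b) * (- (1 / w)) + of_int a)"
      unfolding expand by (simp add: w_def algebra_simps)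
    have m: "of_int c * z + of_int d = w * (of_int (-r) * (- (1 / w)) + of_int c)"
      unfolding expand by (simp add: w_def d algebra_simps)
    have "qfun A ((of_int a * z + of_int b) / (of_int c * z + of_int d)) =
          (of_int (-r) * (- (1 / w)) + of_int c) ^ k * qfun A (- (1 / w))"
      unfolding n m mult_divide_mult_cancel_left[OF nz] by (rule IH)
    also have "qfun A (- (1 / w)) = w ^ k * qfun A z"
      using mod_forms_S[OF A w] by (simp add: w_def)
    finally show ?thesis
      unfolding m by (simp only: power_mult_distrib mult_ac)
  qed
qed

text \<open>The vector (0, 1) has length 1, and a length of at most 1 bounds c by 1 / Im z and then
  d; so the minimum may be sought in a finite box.\<close>

lemma minimal_lattice_vector:
  fixes z :: complex
  assumes "Im z > 0"
  obtains c d :: int where "(c, d) \<noteq> (0, 0)"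
    "\<And>c' d' :: int. (c', d') \<noteq> (0, 0) \<Longrightarrow> norm (of_int c * z + of_int d) \<le> norm (of_int c' * z + of_int d')"
proof -
  define f where "f = (\<lambda>(c::int, d::int). norm (of_int c * z + of_int d))"
  define M where "M = \<lceil>1 / Im z\<rceil>"
  define N where "N = \<lceil>1 + M * norm z\<rceil>"
  define B where "B = {x \<in> {-M..M} \<times> {-N..N}. x \<noteq> (0,0)}"
  have inB: "x \<in> B" if "f x \<le> 1" "x \<noteq> (0,0)" for x
  proof -
    obtain c d where x: "x = (c, d)" by force
    have 1: "norm (of_int c * z + of_int d) \<le> 1" using that x by (simp add: f_def)
    have "\<bar>of_int c * Im z\<bar> \<le> 1"
      using abs_Im_le_cmod[of "of_int c * z + of_int d"] 1 by simp
    then have c: "\<bar>real_of_int c\<bar> \<le> 1 / Im z" using assms by (simp add: abs_mult field_simps)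
    then have c': "\<bar>c\<bar> \<le> M" unfolding M_def by linarith
    have "norm (of_int d :: complex) \<le> norm (of_int c * z + of_int d) + norm (of_int c * z)"
      using norm_triangle_ineq4[of "of_int c * z + of_int d" "of_int c * z"] by simp
    also have "\<dots> \<le> 1 + \<bar>of_int c\<bar> * norm z" using 1 by (simp add: norm_mult)
    also have "\<dots> \<le> 1 + M * norm z" using c' by (intro add_left_mono mult_right_mono) auto
    finally have "\<bar>real_of_int d\<bar> \<le> 1 + M * norm z" by simp
    then have "\<bar>d\<bar> \<le> N" unfolding N_def by linarith
    with c' that x show ?thesis by (auto simp: B_def)
  qed
  have fin: "finite B" by (auto simp: B_def)
  have one: "(0, 1) \<in> B" by (rule inB) (auto simp: f_def)
  define x where "x = arg_min_on f B"
  have ne: "B \<noteq> {}" using one by auto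
  have x: "x \<in> B" "\<And>y. y \<in> B \<Longrightarrow> f x \<le> f y"
    unfolding x_def by (rule arg_min_if_finite(1)[OF fin ne]) (rule arg_min_least[OF fin ne])
  have "f x \<le> f y" if "y \<noteq> (0,0)" for y
  proof (cases "f y \<le> 1")
    case True then show ?thesis using x(2) inB that by blast
  next
    case False
    have "f x \<le> f (0,1)" by (rule x(2)[OF one])
    also have "\<dots> = 1" by (simp add: f_def)
    finally show ?thesis using False by simp
  qed
  with x(1) show ?thesis
    by (intro that[of "fst x" "snd x"]) (auto simp: B_def f_def split: prod.splits)
qed

text \<open>A shortest vector (c, d) as bottom row maximises the imaginary part. The top row is
  again a nonzero lattice vector, whence |w| >= 1; adding multiples of the bottom row to it brings
  Re w within 1/2 of 0.\<close>

lemma fundamental_domain_rep: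
  assumes "Im z > 0"
  obtains a b c d :: int and w :: complex where
    "a * d - b * c = 1" "w = (of_int a * z + of_int b) / (of_int c * z + of_int d)"
    "norm w \<ge> 1" "\<bar>Re w\<bar> \<le> 1 / 2" "Im w \<ge> sqrt 3 / 2"
proof -
  obtain c d :: int where nz: "(c, d) \<noteq> (0, 0)" and
    min: "\<And>c' d' :: int. (c', d') \<noteq> (0, 0) \<Longrightarrow> norm (of_int c * z + of_int d) \<le> norm (of_int c' * z + of_int d')"
    using minimal_lattice_vector[OF assms] by metis
  have cop: "gcd c d = 1"
  proof -
    define g where "g = gcd c d"
    obtain c' d' where cd: "c = g * c'" "d = g * d'" unfolding g_def by (meson gcd_dvd1 gcd_dvd2 dvdE)
    have nz': "(c', d') \<noteq> (0,0)" using nz cd by auto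
    have pos: "norm (of_int c' * z + of_int d') > 0"
    proof -
      have "of_int c' * z + of_int d' \<noteq> 0"
      proof
        assume eq: "of_int c' * z + of_int d' = 0"
        then have "Im (of_int c' * z + of_int d') = 0" by simp
        then have "c' = 0" using assms by simp
        with eq nz' show False by simp
      qed
      then show ?thesis by simp
    qed
    have "of_int c * z + of_int d = of_int g * (of_int c' * z + of_int d')"
      by (simp add: cd algebra_simps)
    then have "\<bar>of_int g\<bar> * norm (of_int c' * z + of_int d') \<le> 1 * norm (of_int c' * z + of_int d')"
      using min[OF nz'] by (simp add: norm_mult)
    then have "\<bar>real_of_int g\<bar> \<le> 1" using pos by (simp add: mult_le_cancel_right_pos del: mult_1)
    moreover have "g > 0" using nz by (auto simp: g_def)
    ultimately have "g = 1" by linarith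
    then show ?thesis by (simp add: g_def)
  qed
  then obtain u v where uv: "u * c + v * d = 1" by (metis bezout_int)
  define a0 b0 where "a0 = v" and "b0 = - u"
  have det0: "a0 * d - b0 * c = 1" using uv by (simp add: a0_def b0_def)
  define w0 where "w0 = (of_int a0 * z + of_int b0) / (of_int c * z + of_int d)"
  define n where "n = - round (Re w0)"
  define a b where "a = a0 + n * c" and "b = b0 + n * d"
  define w where "w = (of_int a * z + of_int b) / (of_int c * z + of_int d)"
  have det: "a * d - b * c = 1" using det0 by (simp add: a_def b_def algebra_simps)
  note nz1 = Im_mobius(1)[OF det assms]
  have w: "w = w0 + of_int n"
    unfolding w_def w0_def a_def b_def using nz1 by (simp add: field_simps)
  have Re: "\<bar>Re w\<bar> \<le> 1 / 2"
    using of_int_round_abs_le[of "Re w0"] by (simp add: w n_def abs_minus_commute)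
  have "(a, b) \<noteq> (0, 0)" using det by auto
  from min[OF this] have nw: "norm w \<ge> 1"
    using nz1 by (simp add: w_def norm_divide)
  have pos: "Im w > 0" using Im_mobius(3)[OF det assms] by (simp add: w_def)
  have "(Re w)\<^sup>2 \<le> (1/2)\<^sup>2" using Re by (simp add: abs_le_square_iff[symmetric])
  moreover have "(Re w)\<^sup>2 + (Im w)\<^sup>2 \<ge> 1"
    using nw power_mono[of 1 "norm w" 2] by (simp add: cmod_power2)
  ultimately have "3 / 4 \<le> (Im w)\<^sup>2" by (simp add: power2_eq_square)
  then have "sqrt (3 / 4) \<le> Im w" using pos by (intro real_le_lsqrt) auto
  then have "Im w \<ge> sqrt 3 / 2" by (simp add: real_sqrt_divide)
  with that[OF det w_def nw Re] show ?thesis .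
qed

section \<open>Cusp forms of small weight\<close>

text \<open>The function \<open>exp (- 4 * pi * y) * y ^ k\<close> peaks at y = k / (4 pi). The
  number 4/5 lies between 10 / (4 pi) and \<open>sqrt 3 / 2\<close>, the least height in the
  fundamental domain; this is where the bound 10 on the weight enters. The estimate rests on 1 + x
  <= e^x and 10 / (4/5) = 25/2 < 4 pi.\<close>

lemma exp_power_mono_strict:
  fixes k :: nat and y :: real
  assumes "k \<le> 10" "y > 4 / 5"
  shows "exp (- 4 * pi * y) * y ^ k < exp (- 4 * pi * (4/5)) * (4/5) ^ k"
proof -
  have "(y / (4/5)) ^ k \<le> exp (y / (4/5) - 1) ^ k"
    using assms exp_ge_add_one_self[of "y / (4/5) - 1"] by (intro power_mono) auto
  also have "\<dots> = exp (real k * (y / (4/5) - 1))"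
    by (simp add: exp_of_nat_mult)
  also have "real k * (y / (4/5) - 1) \<le> 10 * (y / (4/5) - 1)"
    using assms by (intro mult_right_mono) auto
  also have "10 * (y / (4/5) - 1) = (25/2) * (y - 4/5)"
    by simp
  also have "\<dots> < 4 * pi * (y - 4/5)"
    using assms pi_approx by (intro mult_strict_right_mono) auto
  finally have "(y / (4/5)) ^ k < exp (4 * pi * (y - 4/5))" by simp
  then have "y ^ k < exp (4 * pi * (y - 4/5)) * (4/5) ^ k"
    by (simp add: power_divide field_simps)
  then have "exp (- 4 * pi * y) * y ^ k < exp (- 4 * pi * y) * (exp (4 * pi * (y - 4/5)) * (4/5) ^ k)"
    by simp
  also have "\<dots> = exp (- 4 * pi * (4/5)) * (4/5) ^ k"
    by (simp add: exp_add[symmetric] algebra_simps)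
  finally show ?thesis .
qed

text \<open>
  Maximum principle: \<open>|f|\<^sup>2 y\<^sup>k\<close> is invariant, so its values on the line \<open>y = 4/5\<close> are attained
  at larger \<open>y\<close>; but \<open>|f/q|\<close> is largest on that line and \<open>e\<^bsup>-4\<pi>y\<^esup> y\<^sup>k\<close> is strictly decreasing
  from there on.
\<close>
lemma cusp_form_small_weight:
  assumes A: "A \<in> mod_forms k" "even k" "k \<le> 10" "fps_nth A 0 = 0"
  shows "A = 0"
proof -
  define G where "G = fps_shift 1 A"
  have AG: "A = fps_X * G"
    using A(4) by (simp add: G_def fps_eq_iff)
  have cA: "conv_disc A" using A(1) by blast
  have cG: "conv_disc G" using cA by (simp add: G_def conv_disc_def)
  define r0 where "r0 = exp (- 2 * pi * (4/5))"
  have r0: "0 < r0" "r0 < 1" by (auto simp: r0_def)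
  have holo: "eval_fps G holomorphic_on ball 0 1"
    by (rule holomorphic_on_eval_fps) (use conv_disc_radius[OF cG] in auto)
  have cont: "continuous_on (cball 0 r0) (eval_fps G)"
    by (rule continuous_on_subset[OF holomorphic_on_imp_continuous_on[OF holo]]) (use r0 in auto)
  have "continuous_on (sphere 0 r0) (\<lambda>q. norm (eval_fps G q))"
    by (intro continuous_on_norm continuous_on_subset[OF cont]) auto
  moreover have "sphere (0::complex) r0 \<noteq> {}" using r0 by simp
  ultimately obtain q0 where q0: "q0 \<in> sphere 0 r0"
    "\<And>q. q \<in> sphere 0 r0 \<Longrightarrow> norm (eval_fps G q) \<le> norm (eval_fps G q0)"
    using continuous_attains_sup[of "sphere 0 r0" "\<lambda>q. norm (eval_fps G q)"] compact_sphere by blast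
  define M where "M = norm (eval_fps G q0)"
  have max: "norm (eval_fps G q) \<le> M" if "norm q \<le> r0" for q
  proof (rule maximum_modulus_frontier[where S = "cball 0 r0" and f = "eval_fps G"])
    show "eval_fps G holomorphic_on interior (cball 0 r0)"
      by (rule holomorphic_on_subset[OF holo]) (use r0 in auto)
    show "continuous_on (closure (cball 0 r0)) (eval_fps G)" using cont by simp
    show "norm (eval_fps G z) \<le> M" if "z \<in> frontier (cball 0 r0)" for z
      using that q0(2)[of z] r0 by (simp add: M_def frontier_cball)
    show "q \<in> cball 0 r0" using that by simp
  qed simp
  have q0nz: "q0 \<noteq> 0" "norm q0 < 1" using q0(1) r0 by auto
  obtain z where z: "Im z > 0" "nome z = q0" using nome_surj[OF q0nz] by metis
  have Imz: "Im z = 4 / 5"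
  proof -
    have "exp (- 2 * pi * Im z) = exp (- 2 * pi * (4/5))"
      using norm_nome[of z] z(2) q0(1) by (simp add: r0_def)
    then show ?thesis by simp
  qed
  obtain a b c d :: int and w where w: "a * d - b * c = 1"
     "w = (of_int a * z + of_int b) / (of_int c * z + of_int d)" "Im w \<ge> sqrt 3 / 2"
    using fundamental_domain_rep[OF z(1)] by metis
  define j where "j = of_int c * z + of_int d"
  have j: "j \<noteq> 0" "Im w = Im z / (norm j)\<^sup>2"
    using Im_mobius[OF w(1) z(1)] by (auto simp: j_def w(2))
  have "sqrt 3 > 8 / 5" by (rule real_less_rsqrt) (simp add: power2_eq_square)
  with w(3) have Imw: "Im w > 4 / 5" by simp
  have inv: "(norm (qfun A z))\<^sup>2 * Im z ^ k = (norm (qfun A w))\<^sup>2 * Im w ^ k"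
  proof -
    have "qfun A w = j ^ k * qfun A z"
      unfolding w(2) j_def by (rule mod_forms_mobius[OF A(1,2) w(1) z(1)])
    then show ?thesis using j(1) unfolding j(2)
      by (simp add: norm_mult norm_power power_mult_distrib power_divide flip: power_mult)
         (simp add: mult.commute)
  qed
  have form: "(norm (qfun A v))\<^sup>2 * Im v ^ k = (norm (eval_fps G (nome v)))\<^sup>2 * (exp (- 4 * pi * Im v) * Im v ^ k)"
    if "Im v > 0" for v
  proof -
    have "qfun A v = nome v * eval_fps G (nome v)"
      unfolding AG using that cG by (simp add: qfun_mult) (simp add: qfun_def)
    moreover have "(norm (nome v))\<^sup>2 = exp (- 4 * pi * Im v)"
      by (simp add: norm_nome flip: exp_of_nat_mult)
    ultimately show ?thesis by (simp add: norm_mult power_mult_distrib)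
  qed
  have "M\<^sup>2 * (exp (- 4 * pi * (4/5)) * (4/5) ^ k) = (norm (eval_fps G (nome w)))\<^sup>2 * (exp (- 4 * pi * Im w) * Im w ^ k)"
    using inv form[of z] form[of w] z Imz Imw by (simp add: M_def)
  also have "\<dots> \<le> M\<^sup>2 * (exp (- 4 * pi * Im w) * Im w ^ k)"
  proof (intro mult_right_mono power_mono max)
    show "norm (nome w) \<le> r0" using Imw by (simp add: norm_nome r0_def)
  qed (use Imw in auto)
  finally have "M\<^sup>2 \<le> 0"
    using exp_power_mono_strict[OF A(3) Imw] by (smt (verit) mult_less_cancel_left_pos)
  then have "M = 0" by simp
  have "A = 0"
  proof (rule qfun_eqD)
    show "qfun A v = qfun 0 v" if "Im v > 0" for v
    proof -
      have zero: "eval_fps G q = 0" if "q \<in> ball 0 1" for q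
      proof (rule analytic_continuation[OF holo, of "cball 0 r0" 0])
        show "(0::complex) islimpt cball 0 r0" using r0 by (intro interior_limit_point) simp
        show "\<And>z. z \<in> cball 0 r0 \<Longrightarrow> eval_fps G z = 0" using max \<open>M = 0\<close> by auto
      qed (use r0 that in auto)
      show ?thesis unfolding AG using that cG zero[of "nome v"]
        by (simp add: qfun_mult norm_nome_less_1) (simp add: qfun_def)
    qed
  qed (use cA in auto)
  then show ?thesis .
qed

text \<open>The first Rankin--Cohen bracket.\<close>
lemma mod_forms_bracket:
  assumes A: "A \<in> mod_forms k" and B: "B \<in> mod_forms l"
  shows "of_nat k * (A * (fps_X * fps_deriv B)) - of_nat l * (B * (fps_X * fps_deriv A)) \<in> mod_forms (k + l + 2)"
proof -
  define \<theta> :: "complex fps \<Rightarrow> complex fps" where "\<theta> = (\<lambda>A. fps_X * fps_deriv A)"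
  define P where "P = 2 * of_real pi * \<i>"
  have P: "P \<noteq> 0" by (simp add: P_def)
  have c: "conv_disc A" "conv_disc B" using A B by auto
  have c\<theta>: "conv_disc (\<theta> A)" "conv_disc (\<theta> B)" using c by (auto simp: \<theta>_def)
  \<comment> \<open>Differentiating the inversion law of a form of weight m leaves an extra term, m
    times the form itself. In the bracket these extra terms cancel.\<close>
  have D: "P * qfun (\<theta> C) (- (1 / z)) = z ^ (m + 2) * (P * qfun (\<theta> C) z) + of_nat m * z ^ (m + 1) * qfun C z"
    if C: "C \<in> mod_forms m" and z: "Im z > 0" for C m z
  proof -
    have cC: "conv_disc C" using C by auto
    have nz: "z \<noteq> 0" using z by auto
    have ng: "((\<lambda>z. - (1 / z)) has_field_derivative (1 / z\<^sup>2)) (at z)"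
      using nz by (auto intro!: derivative_eq_intros simp: power2_eq_square)
    have "((\<lambda>z. qfun C (- (1 / z))) has_field_derivative (P * qfun (\<theta> C) (- (1 / z)) * (1 / z\<^sup>2))) (at z)"
      by (rule DERIV_chain2[where f = "qfun C"])
         (use qfun_has_field_derivative[OF cC Im_S[OF z]] ng in \<open>simp_all add: P_def \<theta>_def\<close>)
    moreover have "((\<lambda>z. qfun C (- (1 / z))) has_field_derivative
        (of_nat m * z ^ (m - 1) * qfun C z + z ^ m * (P * qfun (\<theta> C) z))) (at z)"
    proof (rule has_field_derivative_transform_within_open[OF _ open_uhp])
      show "((\<lambda>z. z ^ m * qfun C z) has_field_derivative
        (of_nat m * z ^ (m - 1) * qfun C z + z ^ m * (P * qfun (\<theta> C) z))) (at z)"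
        using qfun_has_field_derivative[OF cC z]
        by (auto intro!: derivative_eq_intros simp: P_def \<theta>_def)
      show "\<And>x. x \<in> uhp \<Longrightarrow> x ^ m * qfun C x = qfun C (- (1 / x))"
        using mod_forms_S[OF C] by simp
    qed (use z in simp)
    ultimately have "P * qfun (\<theta> C) (- (1 / z)) * (1 / z\<^sup>2) =
      of_nat m * z ^ (m - 1) * qfun C z + z ^ m * (P * qfun (\<theta> C) z)"
      by (rule DERIV_unique)
    then have "P * qfun (\<theta> C) (- (1 / z)) = z\<^sup>2 * (of_nat m * z ^ (m - 1) * qfun C z + z ^ m * (P * qfun (\<theta> C) z))"
      using nz by (simp add: field_simps)
    also have "\<dots> = (of_nat m * (z\<^sup>2 * z ^ (m - 1))) * qfun C z + z ^ (m + 2) * (P * qfun (\<theta> C) z)"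
      by (simp add: algebra_simps power_add power2_eq_square)
    also have "of_nat m * (z\<^sup>2 * z ^ (m - 1)) = of_nat m * z ^ (m + 1)"
      by (cases m) (simp_all add: power2_eq_square)
    also have "of_nat m * z ^ (m + 1) * qfun C z + z ^ (m + 2) * (P * qfun (\<theta> C) z) =
       z ^ (m + 2) * (P * qfun (\<theta> C) z) + of_nat m * z ^ (m + 1) * qfun C z"
      by (rule add.commute)
    finally show ?thesis .
  qed
  define R where "R = fps_const (of_nat k) * (A * \<theta> B) - fps_const (of_nat l) * (B * \<theta> A)"
  have qR: "qfun R z = of_nat k * (qfun A z * qfun (\<theta> B) z) - of_nat l * (qfun B z * qfun (\<theta> A) z)"
    if "Im z > 0" for z
    using that c c\<theta> by (simp add: R_def qfun_diff qfun_mult)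
  have "R \<in> mod_forms (k + l + 2)"
    unfolding mod_forms_def
  proof (intro CollectI conjI allI impI)
    show "conv_disc R" using c c\<theta> by (simp add: R_def)
    fix z :: complex assume z: "Im z > 0"
    have "P * qfun R (- (1 / z)) =
       of_nat k * (qfun A (- (1 / z)) * (P * qfun (\<theta> B) (- (1 / z)))) -
       of_nat l * (qfun B (- (1 / z)) * (P * qfun (\<theta> A) (- (1 / z))))"
      by (simp add: qR[OF Im_S[OF z]] algebra_simps)
    also have "\<dots> = P * (z ^ (k + l + 2) * qfun R z)"
      unfolding D[OF A z] D[OF B z] mod_forms_S[OF A z] mod_forms_S[OF B z] qR[OF z]
      by (simp add: algebra_simps power_add)
    finally show "qfun R (- (1 / z)) = z ^ (k + l + 2) * qfun R z" using P by simp
  qed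
  then show ?thesis by (simp add: R_def \<theta>_def fps_of_nat)
qed

text \<open>The result of applying q d/dq m times to q / (1 - q). The coefficient at 0 is set by
  hand because \<open>0 ^ 0 = 1\<close> would spoil the case m = 0.\<close>

definition npow_fps :: "nat \<Rightarrow> complex fps" where
  "npow_fps m = Abs_fps (\<lambda>r. if r = 0 then 0 else of_nat r ^ m)"

lemma npow_fps_Suc: "fps_X * fps_deriv (npow_fps m) = npow_fps (Suc m)"
  by (auto simp: fps_eq_iff npow_fps_def)

lemma npow_fps_0: "(1 - fps_X) * npow_fps 0 = fps_X"
proof -
  have "(1 - fps_X) * npow_fps 0 = npow_fps 0 - fps_X * npow_fps 0" by (simp add: algebra_simps)
  also have "\<dots> = fps_X" by (auto simp: fps_eq_iff npow_fps_def)
  finally show ?thesis .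
qed

lemma conv_disc_npow_fps [simp]: "conv_disc (npow_fps m)"
proof (induction m)
  case 0
  show ?case
  proof (rule conv_discI)
    fix w :: complex assume w: "norm w < 1"
    have "summable (\<lambda>n. w ^ n)" using w by (rule summable_geometric)
    then have "summable (\<lambda>n. if n = 0 then 0 else w ^ n)"
      by (rule iffD1[OF summable_cong, rotated]) (auto intro!: eventually_sequentiallyI[of 1])
    then show "summable (\<lambda>n. fps_nth (npow_fps 0) n * w ^ n)"
      by (rule back_subst[of summable]) (auto simp: npow_fps_def)
  qed
qed (simp flip: npow_fps_Suc)

lemma uhp_not_nonpos_Ints: "Im z > 0 \<Longrightarrow> z \<notin> \<int>\<^sub>\<le>\<^sub>0" "Im z > 0 \<Longrightarrow> 1 - z \<notin> \<int>\<^sub>\<le>\<^sub>0"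
  by (auto elim!: nonpos_Ints_cases simp: complex_eq_iff)

text \<open>Differentiating the reflection formula of \<open>rGamma\<close> gives pi cot (pi z),
  which is rational in the nome q: it equals - pi i - 2 pi i q / (1 - q).\<close>

lemma Digamma_reflection_uhp:
  assumes z: "Im z > 0"
  shows "Digamma (1 - z) - Digamma z = - of_real pi * \<i> - 2 * of_real pi * \<i> * qfun (npow_fps 0) z"
proof -
  note [simp] = uhp_not_nonpos_Ints[OF z]
  have "((\<lambda>z. rGamma z * rGamma (1 - z)) has_field_derivative
     (- rGamma z * Digamma z * rGamma (1 - z) + rGamma z * (rGamma (1 - z) * Digamma (1 - z)))) (at z)"
    by (auto intro!: derivative_eq_intros has_field_derivative_rGamma_no_nonpos_int)
  moreover have "((\<lambda>z. rGamma z * rGamma (1 - z)) has_field_derivative cos (of_real pi * z)) (at z)"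
    unfolding rGamma_reflection_complex by (auto intro!: derivative_eq_intros)
  ultimately have "- rGamma z * Digamma z * rGamma (1 - z) + rGamma z * (rGamma (1 - z) * Digamma (1 - z)) = cos (of_real pi * z)"
    by (rule DERIV_unique)
  then have "rGamma z * rGamma (1 - z) * (Digamma (1 - z) - Digamma z) = cos (of_real pi * z)"
    by (simp add: algebra_simps)
  then have eq: "sin (of_real pi * z) * (Digamma (1 - z) - Digamma z) = of_real pi * cos (of_real pi * z)"
    unfolding rGamma_reflection_complex by (simp add: field_simps)
  define e where "e = exp (\<i> * (of_real pi * z))"
  have e: "e \<noteq> 0" "nome z = e\<^sup>2" "exp (- (\<i> * (of_real pi * z))) = 1 / e"
    by (simp_all add: e_def nome_def exp_minus inverse_eq_divide mult_ac flip: exp_double)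
  have ne1: "e\<^sup>2 \<noteq> 1" using norm_nome_less_1[OF z] e(2) by auto
  have "qfun ((1 - fps_X) * npow_fps 0) z = qfun fps_X z" by (simp only: npow_fps_0)
  then have q: "(1 - e\<^sup>2) * qfun (npow_fps 0) z = e\<^sup>2"
    using z by (simp add: qfun_mult qfun_diff e(2))
  have "sin (of_real pi * z) = (e - 1 / e) / (2 * \<i>)" "cos (of_real pi * z) = (e + 1 / e) / 2"
    by (simp_all add: sin_exp_eq cos_exp_eq e(3)) (simp_all add: e_def)
  with eq have "(e - 1 / e) / (2 * \<i>) * (Digamma (1 - z) - Digamma z) = of_real pi * ((e + 1 / e) / 2)"
    by simp
  then have "2 * \<i> * e * ((e - 1 / e) / (2 * \<i>) * (Digamma (1 - z) - Digamma z)) = 2 * \<i> * e * (of_real pi * ((e + 1 / e) / 2))"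
    by (rule arg_cong)
  also have "2 * \<i> * e * ((e - 1 / e) / (2 * \<i>) * (Digamma (1 - z) - Digamma z)) = (e\<^sup>2 - 1) * (Digamma (1 - z) - Digamma z)"
    using e(1) by (simp add: field_simps power2_eq_square)
  also have "2 * \<i> * e * (of_real pi * ((e + 1 / e) / 2)) = \<i> * of_real pi * (e\<^sup>2 + 1)"
    using e(1) by (simp add: field_simps power2_eq_square)
  also have "\<dots> = \<i> * of_real pi * (1 - e\<^sup>2) + 2 * \<i> * of_real pi * ((1 - e\<^sup>2) * qfun (npow_fps 0) z)"
    unfolding q by (simp add: algebra_simps)
  also have "\<dots> = (e\<^sup>2 - 1) * (- of_real pi * \<i> - 2 * of_real pi * \<i> * qfun (npow_fps 0) z)"
    by (simp add: algebra_simps)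
  finally show ?thesis using ne1 by simp
qed

text \<open>Repeated differentiation in z: on the left the term in 1 - z changes sign each time; on
  the right each step brings a factor 2 pi i and one more power of r, and the constant is lost after
  the first.\<close>

lemma Polygamma_reflection_uhp:
  assumes "Im z > 0"
  shows "(-1) ^ m * Polygamma m (1 - z) - Polygamma m z =
     (if m = 0 then - of_real pi * \<i> else 0) - (2 * of_real pi * \<i>) ^ Suc m * qfun (npow_fps m) z"
  using assms
proof (induction m arbitrary: z)
  case 0
  then show ?case using Digamma_reflection_uhp[of z] by simp
next
  case (Suc m)
  note [simp] = uhp_not_nonpos_Ints[OF Suc.prems]
  let ?c = "if m = 0 then - of_real pi * \<i> else (0 :: complex)"
  let ?P = "2 * of_real pi * \<i> :: complex"
  have 1: "((\<lambda>z. (-1) ^ m * Polygamma m (1 - z) - Polygamma m z) has_field_derivative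
      ((-1) ^ m * (- Polygamma (Suc m) (1 - z)) - Polygamma (Suc m) z)) (at z)"
    by (auto intro!: derivative_eq_intros)
  have 2: "((\<lambda>z. ?c - ?P ^ Suc m * qfun (npow_fps m) z) has_field_derivative
      (- (?P ^ Suc m * (?P * qfun (npow_fps (Suc m)) z)))) (at z)"
    using qfun_has_field_derivative[OF conv_disc_npow_fps Suc.prems, of m]
    by (auto intro!: derivative_eq_intros simp: npow_fps_Suc)
  have "((\<lambda>z. (-1) ^ m * Polygamma m (1 - z) - Polygamma m z) has_field_derivative
      (- (?P ^ Suc m * (?P * qfun (npow_fps (Suc m)) z)))) (at z)"
    by (rule has_field_derivative_transform_within_open[OF 2 open_uhp])
       (use Suc in auto)
  from DERIV_unique[OF 1 this] show ?case by simp
qed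

section \<open>Eisenstein series\<close>

abbreviation lattice0 :: "(int \<times> int) set" where "lattice0 \<equiv> UNIV - {(0, 0)}"

definition eis_term :: "nat \<Rightarrow> complex \<Rightarrow> int \<times> int \<Rightarrow> complex" where
  "eis_term k z = (\<lambda>(m, n). inverse ((of_int m * z + of_int n) ^ k))"

lemma summable_inverse_1_square_nat: "summable (\<lambda>n. 1 / (1 + (real n)\<^sup>2))"
proof (rule summable_comparison_test_ev)
  show "eventually (\<lambda>n. norm (1 / (1 + (real n)\<^sup>2)) \<le> inverse (real n ^ 2)) sequentially"
  proof (rule eventually_sequentiallyI[of 1])
    fix n :: nat assume "1 \<le> n"
    then have "1 / (1 + (real n)\<^sup>2) \<le> 1 / (real n)\<^sup>2" by (intro divide_left_mono) (auto intro!: mult_pos_pos add_pos_nonneg)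
    moreover have "norm (1 / (1 + (real n)\<^sup>2)) = 1 / (1 + (real n)\<^sup>2)"
      unfolding real_norm_def by (rule abs_of_nonneg) simp
    ultimately show "norm (1 / (1 + (real n)\<^sup>2)) \<le> inverse (real n ^ 2)"
      by (simp add: inverse_eq_divide)
  qed
  show "summable (\<lambda>n. inverse (real n ^ 2))"
    by (rule inverse_power_summable) simp
qed

lemma summable_on_inverse_1_square: "(\<lambda>n::int. 1 / (1 + (of_int n)\<^sup>2) :: real) summable_on UNIV"
proof -
  have n: "(\<lambda>n::nat. 1 / (1 + (real n)\<^sup>2)) summable_on UNIV"
    using summable_inverse_1_square_nat by (subst summable_on_UNIV_nonneg_real_iff) auto
  have 1: "(\<lambda>n::int. 1 / (1 + (of_int n)\<^sup>2) :: real) summable_on (range int)"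
    using n by (subst summable_on_reindex) (auto simp: o_def inj_on_def)
  have 2: "(\<lambda>n::int. 1 / (1 + (of_int n)\<^sup>2) :: real) summable_on (range (\<lambda>n. - int n))"
    using n by (subst summable_on_reindex) (auto simp: o_def inj_on_def)
  have "UNIV = range int \<union> range (\<lambda>n. - int n)"
    by (auto simp: image_iff) (metis int_cases2)
  then show ?thesis using summable_on_union[OF 1 2] by simp
qed

text \<open>The term is dominated by a product of two convergent series. With M = m^2 and N = n^2
  one has M + N <= C |m z + n|^2 and (1 + M) (1 + N) <= 2 (M + N)^2; the square is available since k
  / 2 >= 2.\<close>

lemma eis_term_abs_summable:
  assumes z: "Im z > 0" and k: "even k" "k \<ge> 4"
  shows "(\<lambda>x. norm (eis_term k z x)) summable_on lattice0"
proof -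
  obtain h where h: "k = 2 * h" "h \<ge> 2" using k by (auto elim!: evenE)
  \<comment> \<open>From n^2 <= 2 (m Re z + n)^2 + 2 m^2 (Re z)^2, where multiples of m^2 are
    absorbed through m^2 (Im z)^2 <= |m z + n|^2.\<close>
  define C where "C = 2 + (1 + 2 * (Re z)\<^sup>2) / (Im z)\<^sup>2"
  have C: "C > 0" unfolding C_def by (intro add_pos_nonneg divide_nonneg_nonneg) auto
  define H where "H = (\<lambda>n::int. 1 / (1 + (of_int n)\<^sup>2) :: real)"
  have H: "H summable_on UNIV" unfolding H_def by (rule summable_on_inverse_1_square)
  define g where "g = (\<lambda>(m, n). H m * H n)"
  have g: "g summable_on UNIV \<times> UNIV"
  proof (rule summable_on_SigmaI)
    show "((\<lambda>y. g (x, y)) has_sum (H x * infsum H UNIV)) UNIV" for x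
      unfolding g_def prod.case by (intro has_sum_cmult_right has_sum_infsum H)
    show "(\<lambda>x. H x * infsum H UNIV) summable_on UNIV"
      by (intro summable_on_cmult_left H)
    show "g (x, y) \<ge> 0" for x y by (simp add: g_def H_def)
  qed
  have "(\<lambda>x. 2 * C ^ h * g x) summable_on lattice0"
    by (rule summable_on_subset_banach[of _ UNIV]) (use g in \<open>auto intro!: summable_on_cmult_right\<close>)
  then show ?thesis
  proof (rule Infinite_Sum.abs_summable_on_comparison_test')
    fix x assume "x \<in> lattice0"
    then obtain m n where x: "x = (m, n)" and nz: "m \<noteq> 0 \<or> n \<noteq> 0" by (cases x) auto
    define M N where "M = (real_of_int m)\<^sup>2" and "N = (real_of_int n)\<^sup>2"
    have M0: "M \<ge> 0" "N \<ge> 0" by (auto simp: M_def N_def)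
    have int1: "(real_of_int i)\<^sup>2 \<ge> 1" if "i \<noteq> 0" for i
      using that one_le_power[of "\<bar>real_of_int i\<bar>" 2] by simp
    define v where "v = (norm (of_int m * z + of_int n))\<^sup>2"
    have v: "v = (of_int m * Re z + of_int n)\<^sup>2 + M * (Im z)\<^sup>2"
      by (simp add: v_def cmod_power2 M_def power_mult_distrib)
    have "N \<le> 2 * (of_int m * Re z + of_int n)\<^sup>2 + 2 * M * (Re z)\<^sup>2"
    proof -
      have "0 \<le> (2 * (of_int m * Re z) + of_int n)\<^sup>2" by simp
      then show ?thesis by (simp add: N_def M_def power2_eq_square algebra_simps)
    qed
    moreover have "(M * (Im z)\<^sup>2) * C = 2 * (M * (Im z)\<^sup>2) + M * (1 + 2 * (Re z)\<^sup>2)"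
      using z by (simp add: C_def field_simps)
    moreover have "(of_int m * Re z + of_int n)\<^sup>2 * C \<ge> (of_int m * Re z + of_int n)\<^sup>2 * 2"
      by (intro mult_left_mono) (auto simp: C_def)
    moreover have "M * (Im z)\<^sup>2 \<ge> 0" using M0 by simp
    ultimately have ge: "M + N \<le> v * C"
      unfolding v by (simp add: algebra_simps)
    have "M \<ge> 1 \<or> N \<ge> 1" using nz int1[of m] int1[of n] unfolding M_def N_def by blast
    then have MN1: "M + N \<ge> 1" using M0 by linarith
    have vpos: "v > 0" using ge MN1 C M0
      by (smt (verit) mult_nonpos_nonneg)
    have "(1 + M) * (1 + N) \<le> 2 * (M + N)\<^sup>2"
    proof -
      have MNle: "1 + M + N \<le> (M + N) + (M + N)\<^sup>2" using MN1 power_increasing[of 0 2 "M + N"] by simp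
      have "M * N \<le> (M + N)\<^sup>2" "M + N \<le> (M + N)\<^sup>2"
      proof -
        show "M * N \<le> (M + N)\<^sup>2" using M0 by (simp add: power2_eq_square algebra_simps)
        show "M + N \<le> (M + N)\<^sup>2" using MN1 power_increasing[of 1 2 "M + N"] by simp
      qed
      moreover consider "M = 0" | "N = 0" | "M \<ge> 1" "N \<ge> 1"
        using int1[of m] int1[of n] by (auto simp: M_def N_def)
      then show ?thesis
      proof cases
        case 3
        then have "(M - 1) * (N - 1) \<ge> 0" "M * N \<ge> 1" by (auto simp: mult_ge1_I)
        moreover have "M\<^sup>2 + N\<^sup>2 \<ge> 2 * (M * N)" using sum_squares_bound[of M N] by simp
        ultimately show ?thesis using MN1 3 \<open>M + N \<le> (M + N)\<^sup>2\<close>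
          by (simp add: power2_eq_square algebra_simps)
      qed (use MN1 \<open>M + N \<le> (M + N)\<^sup>2\<close> in \<open>auto simp: algebra_simps\<close>)
    qed
    also have "(M + N)\<^sup>2 \<le> (M + N) ^ h" using MN1 h by (intro power_increasing) auto
    also have "(M + N) ^ h \<le> (v * C) ^ h" using ge MN1 by (intro power_mono) auto
    finally have "(1 + M) * (1 + N) \<le> 2 * C ^ h * v ^ h" by (simp add: power_mult_distrib mult_ac)
    then have "1 / v ^ h \<le> 2 * C ^ h / ((1 + M) * (1 + N))"
      using vpos M0 by (simp add: divide_simps mult_ac)
    moreover have "norm (eis_term k z x) = 1 / v ^ h"
      by (simp add: x eis_term_def h v_def norm_inverse norm_divide norm_power inverse_eq_divide power_mult)
    ultimately show "norm (eis_term k z x) \<le> 2 * C ^ h * g x"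
      by (simp add: x g_def H_def M_def N_def)
  qed
qed

lemma eis_term_summable:
  assumes "Im z > 0" "even k" "k \<ge> 4" "A \<subseteq> lattice0"
  shows "eis_term k z summable_on A"
  using summable_on_subset_banach[OF abs_summable_summable[OF eis_term_abs_summable] assms(4)] assms by blast

definition lipschitz_const :: "nat \<Rightarrow> complex" where
  "lipschitz_const k = (2 * of_real pi * \<i>) ^ k / fact (k - 1)"

text \<open>Lipschitz's formula. The sum over j >= 0 is the series of \<open>Polygamma\<close> at w,
  the sum over j <= -1 the one at 1 - w because k is even, and the reflection formula turns the two
  into a q-series.\<close>

lemma lipschitz_has_sum:
  assumes w: "Im w > 0" and k: "even k" "k \<ge> 4"
  shows "((\<lambda>j::int. inverse ((w + of_int j) ^ k)) has_sum (lipschitz_const k * qfun (npow_fps (k - 1)) w)) UNIV"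
proof -
  define f where "f = (\<lambda>j::int. inverse ((w + of_int j) ^ k))"
  obtain m where m: "k = Suc m" "odd m" "m > 0" using k by (cases k) auto
  have "eis_term k w summable_on (Pair 1 ` UNIV)"
    by (rule eis_term_summable[OF w k]) auto
  then have sf: "f summable_on UNIV"
    by (subst (asm) summable_on_reindex) (auto simp: inj_on_def o_def eis_term_def f_def)
  have has: "(f has_sum s) (g ` UNIV)" if g: "inj g" and s: "(\<lambda>n. f (g n)) sums s" for g :: "nat \<Rightarrow> int" and s
  proof -
    have "f summable_on g ` UNIV" by (rule summable_on_subset_banach[OF sf]) auto
    then have "(\<lambda>n. f (g n)) summable_on UNIV"
      using g by (subst (asm) summable_on_reindex) (auto simp: o_def)
    then have h: "((\<lambda>n. f (g n)) has_sum infsum (\<lambda>n. f (g n)) UNIV) UNIV" by simp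
    from has_sum_imp_sums[OF this] s have "infsum (\<lambda>n. f (g n)) UNIV = s" by (rule sums_unique2)
    with h show ?thesis using g by (subst has_sum_reindex) (auto simp: o_def)
  qed
  have nz: "w \<noteq> 0" "1 - w \<noteq> 0" using w by (auto simp: complex_eq_iff)
  have 1: "(f has_sum (Polygamma m w / fact m)) (range int)"
  proof (rule has)
    show "(\<lambda>n. f (int n)) sums (Polygamma m w / fact m)"
      using Polygamma_LIMSEQ[OF nz(1) m(3)] m by (simp add: f_def)
  qed (simp add: inj_on_def)
  have 2: "(f has_sum (Polygamma m (1 - w) / fact m)) (range (\<lambda>n. - 1 - int n))"
  proof (rule has)
    have "f (- 1 - int n) = inverse ((1 - w + of_nat n) ^ Suc m)" for n
    proof -
      have "(w + of_int (- 1 - int n)) ^ k = (- (1 - w + of_nat n)) ^ k"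
        by (rule arg_cong[where f = "\<lambda>x. x ^ k"]) simp
      also have "\<dots> = (1 - w + of_nat n) ^ k" using k by (intro power_minus_even)
      finally show ?thesis by (simp only: f_def m(1))
    qed
    then show "(\<lambda>n. f (- 1 - int n)) sums (Polygamma m (1 - w) / fact m)"
      using Polygamma_LIMSEQ[OF nz(2) m(3)] m by simp
  qed (simp add: inj_on_def)
  have disj: "range int \<inter> range (\<lambda>n. - 1 - int n) = {}" by auto
  have U: "UNIV = range int \<union> range (\<lambda>n. - 1 - int n)"
  proof -
    have "x \<in> range int \<union> range (\<lambda>n. - 1 - int n)" for x
    proof (cases "x \<ge> 0")
      case True then show ?thesis by (intro UnI1 image_eqI[of _ _ "nat x"]) auto
    next
      case False then show ?thesis by (intro UnI2 image_eqI[of _ _ "nat (- 1 - x)"]) auto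
    qed
    then show ?thesis by blast
  qed
  have "(f has_sum (Polygamma m w / fact m + Polygamma m (1 - w) / fact m)) UNIV"
    unfolding U by (rule has_sum_Un_disjoint[OF 1 2 disj])
  also have "Polygamma m w / fact m + Polygamma m (1 - w) / fact m = lipschitz_const k * qfun (npow_fps (k - 1)) w"
    using Polygamma_reflection_uhp[OF w, of m] m
    by (simp add: lipschitz_const_def minus_equation_iff add_divide_distrib[symmetric] add.commute)
       (simp add: equation_minus_iff algebra_simps)
  finally show ?thesis by (simp add: f_def)
qed

definition sigma_pow :: "nat \<Rightarrow> nat \<Rightarrow> nat" where
  "sigma_pow m n = (\<Sum>d | d dvd n. d ^ m)"

lemma sigma_pow_le: "n > 0 \<Longrightarrow> sigma_pow m n \<le> n ^ Suc m"
proof -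
  assume n: "n > 0"
  have "sigma_pow m n \<le> of_nat (card {d. d dvd n}) * n ^ m"
    unfolding sigma_pow_def
    by (rule sum_bounded_above) (use n in \<open>simp add: power_mono dvd_imp_le\<close>)
  also have "card {d. d dvd n} \<le> card {1..n}"
    by (rule card_mono) (use n in \<open>auto intro: dvd_imp_le Suc_leI gr0I\<close>)
  finally show ?thesis by simp
qed

definition sigma_fps :: "nat \<Rightarrow> complex fps" where
  "sigma_fps m = Abs_fps (\<lambda>n. if n = 0 then 0 else of_nat (sigma_pow m n))"

lemma npow_fps_nth_0 [simp]: "fps_nth (npow_fps m) 0 = 0"
  by (simp add: npow_fps_def)

lemma sigma_fps_nth_0 [simp]: "fps_nth (sigma_fps m) 0 = 0"
  by (simp add: sigma_fps_def)

lemma sigma_fps_abs_summable: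
  assumes q: "norm (q :: complex) < 1"
  shows "summable (\<lambda>n. norm (fps_nth (sigma_fps m) n * q ^ n))"
proof -
  have "summable (\<lambda>n. norm (fps_nth (npow_fps (Suc m)) n * q ^ n))"
    by (rule norm_summable_fps) (simp add: conv_disc_radius q)
  then show ?thesis
  proof (rule summable_comparison_test_ev[rotated])
    show "\<forall>\<^sub>F n in sequentially. norm (norm (fps_nth (sigma_fps m) n * q ^ n)) \<le> norm (fps_nth (npow_fps (Suc m)) n * q ^ n)"
    proof (rule eventually_sequentiallyI[of 1])
      fix n :: nat assume "1 \<le> n"
      then have "real (sigma_pow m n) \<le> real (n ^ Suc m)" by (intro of_nat_mono sigma_pow_le) auto
      then show "norm (norm (fps_nth (sigma_fps m) n * q ^ n)) \<le> norm (fps_nth (npow_fps (Suc m)) n * q ^ n)"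
        by (auto simp: sigma_fps_def npow_fps_def norm_mult norm_power intro!: mult_right_mono)
    qed
  qed
qed

lemma conv_disc_sigma_fps [simp]: "conv_disc (sigma_fps m)"
  by (rule conv_discI) (rule summable_norm_cancel[OF sigma_fps_abs_summable])

lemma has_sum_qfun:
  assumes "summable (\<lambda>n. norm (fps_nth A n * nome z ^ n))" "fps_nth A 0 = 0" "conv_disc A" "Im z > 0"
  shows "((\<lambda>n. fps_nth A n * nome z ^ n) has_sum qfun A z) {1..}"
proof -
  have "(\<lambda>n. fps_nth A n * nome z ^ n) summable_on UNIV"
    using assms(1) by (rule norm_summable_imp_summable_on)
  then have h: "((\<lambda>n. fps_nth A n * nome z ^ n) has_sum infsum (\<lambda>n. fps_nth A n * nome z ^ n) UNIV) UNIV"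
    by simp
  from has_sum_imp_sums[OF h] qfun_sums[OF assms(3,4)]
  have "infsum (\<lambda>n. fps_nth A n * nome z ^ n) UNIV = qfun A z" by (rule sums_unique2)
  with h have "((\<lambda>n. fps_nth A n * nome z ^ n) has_sum qfun A z) UNIV" by simp
  then show ?thesis
    by (rule iffD1[OF has_sum_cong_neutral, rotated -1]) (auto simp: assms(2) not_le Suc_le_eq)
qed

text \<open>A Lambert series: in the double sum of r^l q^(m r) the terms with m r = n are collected,
  so that r runs over the divisors of n. Absolute convergence justifies the exchange.\<close>

lemma lambert_has_sum:
  assumes z: "Im z > 0"
  shows "((\<lambda>m. qfun (npow_fps l) (of_nat m * z)) has_sum qfun (sigma_fps l) z) {1..}"
proof -
  define t where "t = (\<lambda>(n::nat, r::nat). of_nat r ^ l * nome z ^ n)"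
  have q: "norm (nome z) < 1" by (rule norm_nome_less_1[OF z])
  define D where "D = (\<lambda>n::nat. {r. r dvd n})"
  have fin: "finite (D n)" if "n \<in> {1..}" for n using that by (simp add: D_def)
  have inner: "((\<lambda>r. t (n, r)) has_sum (fps_nth (sigma_fps l) n * nome z ^ n)) (D n)" if n: "n \<in> {1..}" for n
  proof -
    have "((\<lambda>r. t (n, r)) has_sum (\<Sum>r\<in>D n. t (n, r))) (D n)" by (rule has_sum_finite[OF fin[OF n]])
    also have "(\<Sum>r\<in>D n. t (n, r)) = fps_nth (sigma_fps l) n * nome z ^ n"
      using n by (simp add: t_def D_def sigma_fps_def sigma_pow_def sum_distrib_right)
    finally show ?thesis .
  qed
  have abs: "(\<lambda>x. norm (t x)) summable_on (Sigma {1..} D)"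
    unfolding Infinite_Sum.abs_summable_on_Sigma_iff
  proof (intro conjI ballI)
    show "(\<lambda>y. norm (t (x, y))) summable_on D x" if "x \<in> {1..}" for x
      using fin[OF that] by simp
    have "(\<lambda>n. norm (norm (fps_nth (sigma_fps l) n * nome z ^ n))) summable_on {1..}"
      by (rule summable_on_subset_banach[of _ UNIV])
         (use norm_summable_imp_summable_on[of "\<lambda>n. norm (fps_nth (sigma_fps l) n * nome z ^ n)"]
            sigma_fps_abs_summable[OF q] in auto)
    moreover have "norm (fps_nth (sigma_fps l) n * nome z ^ n) = infsum (\<lambda>y. norm (t (n, y))) (D n)"
      if n: "n \<in> {1..}" for n
    proof -
      have "infsum (\<lambda>y. norm (t (n, y))) (D n) = (\<Sum>r\<in>D n. norm (t (n, r)))"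
        using fin[OF n] by simp
      also have "\<dots> = real (sigma_pow l n) * norm (nome z ^ n)"
        by (simp add: t_def norm_mult norm_power sigma_pow_def D_def sum_distrib_right)
      finally show ?thesis using n by (simp add: sigma_fps_def norm_mult)
    qed
    ultimately show "(\<lambda>x. norm (infsum (\<lambda>y. norm (t (x, y))) (D x))) summable_on {1..}"
      by (subst summable_on_cong[where g = "\<lambda>n. norm (norm (fps_nth (sigma_fps l) n * nome z ^ n))"]) auto
  qed
  have 1: "(t has_sum qfun (sigma_fps l) z) (Sigma {1..} D)"
    by (rule has_sum_SigmaI[OF inner has_sum_qfun[OF sigma_fps_abs_summable[OF q]] abs_summable_summable[OF abs]])
       (use z in auto)
  define u where "u = (\<lambda>(m::nat, r::nat). of_nat r ^ l * nome z ^ (m * r))"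
  have 2: "(u has_sum qfun (sigma_fps l) z) ({1..} \<times> {1..})"
    using 1
    by (rule iffD1[OF has_sum_reindex_bij_witness[where j = "\<lambda>(n, r). (n div r, r)" and i = "\<lambda>(m, r). (m * r, r)"], rotated -1])
       (auto simp: D_def t_def u_def Suc_le_eq mult.commute intro!: gr0I elim!: dvdE)
  show ?thesis
  proof (rule has_sum_SigmaD[OF 2])
    fix m :: nat assume "m \<in> {1..}"
    then have mz: "Im (of_nat m * z) > 0" using z by simp
    have "((\<lambda>n. fps_nth (npow_fps l) n * nome (of_nat m * z) ^ n) has_sum qfun (npow_fps l) (of_nat m * z)) {1..}"
      by (rule has_sum_qfun) (use mz in \<open>auto intro!: norm_summable_fps conv_disc_radius norm_nome_less_1\<close>)
    then show "((\<lambda>y. u (m, y)) has_sum qfun (npow_fps l) (of_nat m * z)) {1..}"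
      by (rule iffD1[OF has_sum_cong, rotated])
         (auto simp: u_def npow_fps_def power_mult simp flip: nome_power)
  qed
qed

text \<open>The lattice sum splits into the row m = 0, which contributes 2 zeta(k) (\<open>Z\<close>
  is zeta(k)), and the rows m > 0 and m < 0, which contribute the same Lambert series by Lipschitz's
  formula. The inversion law comes from the permutation (m, n) -> (-n, m) of the lattice. The
  constant stays unspecified here.\<close>

lemma eisenstein_exists:
  assumes k: "even k" "k \<ge> 4"
  obtains C where "1 + fps_const C * sigma_fps (k - 1) \<in> mod_forms k"
proof -
  define Z where "Z = infsum (\<lambda>n::int. inverse (of_int n ^ k)) (- {0}) / (2::complex)"
  define F where "F = fps_const (2 * Z) + fps_const (2 * lipschitz_const k) * sigma_fps (k - 1)"
  have cF: "conv_disc F" by (simp add: F_def)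
  have kpos: "k > 0" using k by simp
  define A0 A1 A2 :: "(int \<times> int) set" where
    "A0 = {0} \<times> (- {0})" and "A1 = {1..} \<times> UNIV" and "A2 = {..-1} \<times> UNIV"
  have G: "(eis_term k z has_sum qfun F z) lattice0" if z: "Im z > 0" for z
  proof -
    note sm = eis_term_summable[OF z k]
    have 0: "(eis_term k z has_sum (2 * Z)) A0"
    proof -
      have "eis_term k z summable_on A0" by (rule sm) (auto simp: A0_def)
      then have "(\<lambda>n::int. inverse (of_int n ^ k) :: complex) summable_on (- {0})"
        unfolding A0_def
        by (subst (asm) summable_on_reindex_bij_witness[where j = snd and i = "Pair 0" and T = "- {0}"
              and h = "\<lambda>n::int. inverse (of_int n ^ k)"]) (auto simp: eis_term_def)
      then have "((\<lambda>n::int. inverse (of_int n ^ k) :: complex) has_sum (2 * Z)) (- {0})"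
        by (simp add: Z_def)
      then show ?thesis unfolding A0_def
        by (subst has_sum_reindex_bij_witness[where j = snd and i = "Pair 0" and T = "- {0}"
              and h = "\<lambda>n::int. inverse (of_int n ^ k)"]) (auto simp: eis_term_def)
    qed
    have 1: "(eis_term k z has_sum (lipschitz_const k * qfun (sigma_fps (k - 1)) z)) A1"
      unfolding A1_def
    proof (rule has_sum_SigmaI)
      show "((\<lambda>y. eis_term k z (x, y)) has_sum (lipschitz_const k * qfun (npow_fps (k - 1)) (of_int x * z))) UNIV"
        if "x \<in> {1..}" for x
        using lipschitz_has_sum[of "of_int x * z", OF _ k] that z by (simp add: eis_term_def)
      show "eis_term k z summable_on {1..} \<times> UNIV" by (rule sm) auto
      have "((\<lambda>m. lipschitz_const k * qfun (npow_fps (k - 1)) (of_nat m * z)) has_sum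
          (lipschitz_const k * qfun (sigma_fps (k - 1)) z)) {1..}"
        by (intro has_sum_cmult_right lambert_has_sum z)
      then show "((\<lambda>x::int. lipschitz_const k * qfun (npow_fps (k - 1)) (of_int x * z)) has_sum
          (lipschitz_const k * qfun (sigma_fps (k - 1)) z)) {1..}"
        by (rule iffD1[OF has_sum_reindex_bij_witness[where j = int and i = nat], rotated -1]) auto
    qed
    have 2: "(eis_term k z has_sum (lipschitz_const k * qfun (sigma_fps (k - 1)) z)) A2"
      using 1
    proof (rule iffD1[OF has_sum_reindex_bij_witness[where j = "\<lambda>(m,n). (-m,-n)" and i = "\<lambda>(m,n). (-m,-n)"], rotated -1])
      fix a assume "a \<in> A1"
      obtain m n where a: "a = (m, n)" by force
      have "(of_int (-m) * z + of_int (-n)) ^ k = (- (of_int m * z + of_int n)) ^ k"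
        by (rule arg_cong[where f = "\<lambda>x. x ^ k"]) simp
      also have "\<dots> = (of_int m * z + of_int n) ^ k" using k by (intro power_minus_even)
      finally show "eis_term k z (case a of (m, n) \<Rightarrow> (- m, - n)) = eis_term k z a"
        by (simp only: a eis_term_def prod.case)
    qed (auto simp: A1_def A2_def)
    have U: "lattice0 = (A0 \<union> A1) \<union> A2" by (auto simp: A0_def A1_def A2_def)
    have "(eis_term k z has_sum (2 * Z + lipschitz_const k * qfun (sigma_fps (k - 1)) z
        + lipschitz_const k * qfun (sigma_fps (k - 1)) z)) lattice0"
      unfolding U by (intro has_sum_Un_disjoint 0 1 2) (auto simp: A0_def A1_def A2_def)
    also have "2 * Z + lipschitz_const k * qfun (sigma_fps (k - 1)) z
        + lipschitz_const k * qfun (sigma_fps (k - 1)) z = qfun F z"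
      using z by (simp add: F_def qfun_add qfun_mult)
    finally show ?thesis .
  qed
  have "F \<in> mod_forms k"
    unfolding mod_forms_def
  proof (intro CollectI conjI allI impI cF)
    fix z :: complex assume z: "Im z > 0"
    have nz: "z \<noteq> 0" using z by auto
    have "((\<lambda>x. z ^ k * eis_term k z x) has_sum (z ^ k * qfun F z)) lattice0"
      by (intro has_sum_cmult_right G z)
    then have "(eis_term k (- (1 / z)) has_sum (z ^ k * qfun F z)) lattice0"
    proof (rule iffD1[OF has_sum_reindex_bij_witness[where j = "\<lambda>(m,n). (-n,m)" and i = "\<lambda>(m,n). (n,-m)"], rotated -1])
      fix a :: "int \<times> int"
      obtain m n where a: "a = (m, n)" by force
      have "of_int (-n) * (- (1 / z)) + of_int m = (of_int m * z + of_int n) / z"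
        using nz by (simp add: field_simps)
      then show "eis_term k (- (1 / z)) (case a of (m, n) \<Rightarrow> (- n, m)) = z ^ k * eis_term k z a"
        using nz by (simp only: a eis_term_def prod.case) (simp add: power_divide inverse_eq_divide)
    qed auto
    from has_sum_unique[OF G[OF Im_S[OF z]] this]
    show "qfun F (- (1 / z)) = z ^ k * qfun F z" .
  qed
  \<comment> \<open>Needed for dividing by the constant term; for even k the series has positive
    real terms.\<close>
  moreover have "Z \<noteq> 0"
  proof -
    have "(\<lambda>n::int. norm (inverse (of_int n ^ k) :: complex)) summable_on (- {0})"
    proof -
      have "(\<lambda>x. norm (eis_term k \<i> x)) summable_on A0"
        by (rule summable_on_subset_banach[OF eis_term_abs_summable[OF _ k, of \<i>]]) (auto simp: A0_def)
      then show ?thesis unfolding A0_def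
        by (subst (asm) summable_on_reindex_bij_witness[where j = snd and i = "Pair 0" and T = "- {0}"
              and h = "\<lambda>n::int. norm (inverse (of_int n ^ k) :: complex)"]) (auto simp: eis_term_def)
    qed
    moreover have "norm (inverse (of_int n ^ k) :: complex) = inverse (of_int n ^ k)" for n :: int
      using k by (simp add: norm_inverse norm_power power_even_abs)
    ultimately have s: "(\<lambda>n::int. inverse (of_int n ^ k) :: real) summable_on (- {0})" by simp
    have "(\<Sum>n\<in>{1::int}. inverse (of_int n ^ k) :: real) \<le> infsum (\<lambda>n::int. inverse (of_int n ^ k)) (- {0})"
      by (rule finite_sum_le_infsum[OF s]) (use k in \<open>auto simp: zero_le_even_power\<close>)
    then have pos: "infsum (\<lambda>n::int. inverse (of_int n ^ k) :: real) (- {0}) > 0" by simp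
    have "((\<lambda>n::int. of_real (inverse (of_int n ^ k)) :: complex) has_sum of_real (infsum (\<lambda>n::int. inverse (of_int n ^ k)) (- {0}))) (- {0})"
      using s by (intro has_sum_of_real has_sum_infsum)
    then have "infsum (\<lambda>n::int. of_real (inverse (of_int n ^ k)) :: complex) (- {0}) = of_real (infsum (\<lambda>n::int. inverse (of_int n ^ k)) (- {0}))"
      by (rule infsumI)
    then have "infsum (\<lambda>n::int. inverse (of_int n ^ k) :: complex) (- {0}) = of_real (infsum (\<lambda>n::int. inverse (of_int n ^ k)) (- {0}))"
      by simp
    with pos show ?thesis unfolding Z_def by simp
  qed
  ultimately have "fps_const (1 / (2 * Z)) * F \<in> mod_forms k" "Z \<noteq> 0"
    by (auto intro: mod_forms_scale)
  moreover from this have "fps_const (1 / (2 * Z)) * F = 1 + fps_const (lipschitz_const k / Z) * sigma_fps (k - 1)"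
    by (simp add: F_def ring_distribs mult.assoc[symmetric])
  ultimately show ?thesis using that by metis
qed

section \<open>The forms \<open>E\<^sub>4\<close>, \<open>E\<^sub>6\<close> and \<open>\<Delta>\<close>\<close>

definition cfps :: "int fps \<Rightarrow> complex fps" where
  "cfps A = Abs_fps (\<lambda>n. of_int (fps_nth A n))"

lemma cfps_nth [simp]: "fps_nth (cfps A) n = of_int (fps_nth A n)"
  by (simp add: cfps_def)

lemma cfps_hom [simp]:
  "cfps 0 = 0" "cfps 1 = 1" "cfps (A + B) = cfps A + cfps B" "cfps (A - B) = cfps A - cfps B"
  "cfps (- A) = - cfps A"
  "cfps (A * B) = cfps A * cfps B" "cfps (fps_const c) = fps_const (of_int c)" "cfps fps_X = fps_X"
  "cfps (fps_deriv A) = fps_deriv (cfps A)"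
  by (auto simp: fps_eq_iff fps_mult_nth fps_X_nth)

lemma cfps_numeral [simp]: "cfps (numeral n) = numeral n"
  by (simp add: fps_eq_iff fps_numeral_nth)

lemma cfps_power [simp]: "cfps (A ^ n) = cfps A ^ n"
  by (induction n) simp_all

lemma cfps_sum: "cfps (sum f I) = (\<Sum>i\<in>I. cfps (f i))"
  by (induction I rule: infinite_finite_induct) simp_all

lemma cfps_inject [simp]: "cfps A = cfps B \<longleftrightarrow> A = B"
  by (simp add: fps_eq_iff)

definition isigma :: "nat \<Rightarrow> int fps" where
  "isigma m = Abs_fps (\<lambda>n. if n = 0 then 0 else int (sigma_pow m n))"

lemma cfps_isigma [simp]: "cfps (isigma m) = sigma_fps m"
  by (simp add: fps_eq_iff isigma_def sigma_fps_def)

definition eisen4 :: "int fps" where "eisen4 = 1 + 240 * isigma 3"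
definition eisen6 :: "int fps" where "eisen6 = 1 - 504 * isigma 5"

text \<open>(E4^3 - E6^2) / 1728 with the division carried out. After expansion only the divisor sum
  of (5 d^3 + 7 d^5) / 12 carries a denominator, and there \<open>div\<close> is exact by
  \<open>dvd_12\<close>; integrality of Delta is thus built in.\<close>

definition delta :: "int fps" where
  "delta = Abs_fps (\<lambda>n. if n = 0 then 0 else \<Sum>d | d dvd n. (5 * int d ^ 3 + 7 * int d ^ 5) div 12)
     + 100 * isigma 3 ^ 2 + 8000 * isigma 3 ^ 3 - 147 * isigma 5 ^ 2"

lemma dvd_12: "12 dvd (5 * d ^ 3 + 7 * d ^ 5 :: int)"
proof -
  have c: "(5 * d ^ 3 + 7 * d ^ 5) mod m = (5 * (d mod m) ^ 3 + 7 * (d mod m) ^ 5) mod m" for m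
  proof -
    have h: "[d = d mod m] (mod m)" by (simp add: cong_def)
    show ?thesis
      using cong_add[OF cong_mult[OF cong_refl cong_pow[OF h]] cong_mult[OF cong_refl cong_pow[OF h]]]
      by (simp only: cong_def)
  qed
  have "d mod 3 = 0 \<or> d mod 3 = 1 \<or> d mod 3 = 2" by presburger
  then have "(5 * d ^ 3 + 7 * d ^ 5) mod 3 = 0" unfolding c[of 3] by (elim disjE) simp_all
  moreover have "d mod 4 = 0 \<or> d mod 4 = 1 \<or> d mod 4 = 2 \<or> d mod 4 = 3" by presburger
  then have "(5 * d ^ 3 + 7 * d ^ 5) mod 4 = 0" unfolding c[of 4] by (elim disjE) simp_all
  moreover have "coprime 3 (4::int)" by (simp add: coprime_iff_gcd_eq_1 gcd_non_0_int)
  ultimately have "3 * 4 dvd (5 * d ^ 3 + 7 * d ^ 5)"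
    by (intro divides_mult) (simp_all only: dvd_eq_mod_eq_0)
  then show ?thesis by simp
qed

lemma delta_eq_aux:
  "12 * delta = 5 * isigma 3 + 7 * isigma 5 + 1200 * isigma 3 ^ 2 + 96000 * isigma 3 ^ 3 - 1764 * isigma 5 ^ 2"
proof -
  define D where "D = Abs_fps (\<lambda>n. if n = 0 then 0 else \<Sum>d | d dvd n. (5 * int d ^ 3 + 7 * int d ^ 5) div 12)"
  have "fps_nth (12 * D) n = fps_nth (5 * isigma 3 + 7 * isigma 5) n" for n
    by (auto simp: D_def isigma_def sigma_pow_def sum_distrib_left dvd_12 sum.distrib)
  then have "12 * D = 5 * isigma 3 + 7 * isigma 5" by (simp add: fps_eq_iff)
  then show ?thesis unfolding delta_def D_def[symmetric] by (simp add: algebra_simps)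
qed

lemma delta_eq: "1728 * delta = eisen4 ^ 3 - eisen6 ^ 2"
proof -
  have "1728 * delta = 144 * (12 * delta)" by simp
  also have "\<dots> = eisen4 ^ 3 - eisen6 ^ 2"
    unfolding delta_eq_aux eisen4_def eisen6_def
    by (simp add: power2_eq_square power3_eq_cube algebra_simps)
  finally show ?thesis .
qed

lemma sigma_pow_1 [simp]: "sigma_pow m (Suc 0) = 1"
  by (simp add: sigma_pow_def)

lemma sigma_fps_nth_1 [simp]: "fps_nth (sigma_fps m) (Suc 0) = 1"
  by (simp add: sigma_fps_def)

lemma sigma_pow_2: "sigma_pow m 2 = 1 + 2 ^ m"
proof -
  have "{d. d dvd (2::nat)} = {1, 2}"
    by (auto dest: prime_nat_iff[THEN iffD1, OF two_is_prime_nat, THEN conjunct2, rule_format])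
  then show ?thesis by (simp add: sigma_pow_def)
qed

lemma isigma_nth_0 [simp]: "fps_nth (isigma m) 0 = 0"
  and isigma_nth_1 [simp]: "fps_nth (isigma m) (Suc 0) = 1"
  by (simp_all add: isigma_def)

lemma eisen_nth_0 [simp]: "fps_nth eisen4 0 = 1" "fps_nth eisen6 0 = 1"
  by (simp_all add: eisen4_def eisen6_def)

lemma fps_nth_mult_2:
  "fps_nth (A * B) 2 = fps_nth A 0 * fps_nth B 2 + fps_nth A 1 * fps_nth B 1 + fps_nth A 2 * fps_nth B 0"
  by (simp add: fps_mult_nth numeral_2_eq_2)

lemma delta_nth_0 [simp]: "fps_nth delta 0 = 0"
  by (simp add: delta_def power2_eq_square power3_eq_cube)

lemma delta_nth_1 [simp]: "fps_nth delta (Suc 0) = 1"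
  by (simp add: delta_def power2_eq_square power3_eq_cube)

lemma mod_forms_eqI:
  assumes "A \<in> mod_forms k" "B \<in> mod_forms k" "even k" "k \<le> 10" "fps_nth A 0 = fps_nth B 0"
  shows "A = B"
  using cusp_form_small_weight[OF mod_forms_diff[OF assms(1,2)]] assms by simp

text \<open>Excludes the root C = 0 of the quadratic equation for the constant of E4.\<close>

lemma one_not_mod_form: "k > 0 \<Longrightarrow> 1 \<notin> mod_forms k"
proof
  assume k: "k > 0" and "1 \<in> mod_forms k"
  from mod_forms_S[OF this(2), of "2 * \<i>"] have "norm ((2 * \<i>) ^ k) = 1" by simp
  then have "(2::real) ^ k = 1" by (simp add: norm_power norm_mult)
  with k show False using one_less_power[of "2::real" k] by simp
qed

text \<open>
  The normalising constants of the Eisenstein series come from comparing the first two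
  coefficients in \<open>E\<^sub>4\<^sup>2 = E\<^sub>8\<close> and \<open>E\<^sub>4 E\<^sub>6 = E\<^sub>1\<^sub>0\<close>, so no zeta values are needed.
\<close>
lemma eisen4_mod_form: "cfps eisen4 \<in> mod_forms 4"
proof -
  obtain C where C: "1 + fps_const C * sigma_fps 3 \<in> mod_forms 4"
    using eisenstein_exists[of 4] by auto
  obtain C' where C': "1 + fps_const C' * sigma_fps 7 \<in> mod_forms 8"
    using eisenstein_exists[of 8] by auto
  have eq: "(1 + fps_const C * sigma_fps 3) * (1 + fps_const C * sigma_fps 3) = 1 + fps_const C' * sigma_fps 7"
    by (rule mod_forms_eqI[OF _ C']) (use mod_forms_mult[OF C C] in simp_all)
  have 1: "2 * C = C'"
    using arg_cong[OF eq, of "\<lambda>A. fps_nth A 1"] by (simp add: sigma_fps_def)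
  have 2: "18 * C + C\<^sup>2 = 129 * C'"
    using arg_cong[OF eq, of "\<lambda>A. fps_nth A 2"]
    by (simp add: fps_nth_mult_2 sigma_fps_def sigma_pow_2 power2_eq_square)
  have "C * (C - 240) = (18 * C + C\<^sup>2) - 258 * C" by (simp add: algebra_simps power2_eq_square)
  then have "C * (C - 240) = 0" unfolding 2 1[symmetric] by simp
  moreover have "C \<noteq> 0" using C one_not_mod_form[of 4] by auto
  ultimately have "C = 240" by simp
  with C show ?thesis by (simp add: eisen4_def fps_numeral_fps_const)
qed

lemma eisen6_mod_form: "cfps eisen6 \<in> mod_forms 6"
proof -
  obtain C where C: "1 + fps_const C * sigma_fps 5 \<in> mod_forms 6"
    using eisenstein_exists[of 6] by auto
  obtain C' where C': "1 + fps_const C' * sigma_fps 9 \<in> mod_forms 10"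
    using eisenstein_exists[of 10] by auto
  have eq: "cfps eisen4 * (1 + fps_const C * sigma_fps 5) = 1 + fps_const C' * sigma_fps 9"
    by (rule mod_forms_eqI[OF _ C']) (use mod_forms_mult[OF eisen4_mod_form C] in simp_all)
  have 1: "240 + C = C'"
    using arg_cong[OF eq, of "\<lambda>A. fps_nth A 1"] by (simp add: sigma_fps_def eisen4_def add.commute)
  have 2: "2160 + 273 * C = 513 * C'"
    using arg_cong[OF eq, of "\<lambda>A. fps_nth A 2"]
    by (simp add: fps_nth_mult_2 sigma_fps_def sigma_pow_2 eisen4_def isigma_def fps_numeral_nth mult_ac add_ac)
  have "240 * (C + 504) = 513 * (240 + C) - (2160 + 273 * C)" by (simp add: algebra_simps)
  then have "240 * (C + 504) = 0" unfolding 1 2 by simp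
  then have "C + 504 = 0" by (metis mult_eq_0_iff zero_neq_numeral)
  then have "C = -504" by (simp add: eq_neg_iff_add_eq_0)
  with C show ?thesis by (simp add: eisen6_def fps_numeral_fps_const flip: fps_const_neg)
qed

lemma conv_disc_eisen [simp]: "conv_disc (cfps eisen4)" "conv_disc (cfps eisen6)"
  using eisen4_mod_form eisen6_mod_form by auto

lemma delta_mod_form: "cfps delta \<in> mod_forms 12"
proof -
  have "cfps eisen4 ^ 3 - cfps eisen6 ^ 2 \<in> mod_forms 12"
    using mod_forms_diff[of "cfps eisen4 ^ 3" 12 "cfps eisen6 ^ 2"]
      mod_forms_power[OF eisen4_mod_form, of 3] mod_forms_power[OF eisen6_mod_form, of 2] by simp
  then have "fps_const (1 / 1728) * (cfps eisen4 ^ 3 - cfps eisen6 ^ 2) \<in> mod_forms 12"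
    by (rule mod_forms_scale)
  also have "cfps eisen4 ^ 3 - cfps eisen6 ^ 2 = cfps (1728 * delta)"
    by (simp add: delta_eq)
  also have "fps_const (1 / 1728) * cfps (1728 * delta) = cfps delta"
    by (simp add: fps_eq_iff)
  finally show ?thesis .
qed

lemma conv_disc_delta [simp]: "conv_disc (cfps delta)"
  using delta_mod_form by auto

section \<open>Delta has no zero in the upper half-plane\<close>

lemma exp_ge_228: "exp (- 2 * pi * y) \<le> 44 / 10000" if "y \<ge> sqrt 3 / 2"
proof -
  have step: "exp (2 * x) \<ge> b" if "exp x \<ge> a" "a \<ge> 0" "a\<^sup>2 \<ge> b" for a b x :: real
    using power_mono[OF that(1,2), of 2] that(3) by (simp add: exp_double)
  \<comment> \<open>Doubling 17/400 seven times gives 5.44, just below pi sqrt 3; the quadratic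
    Taylor bound is squared at each doubling.\<close>
  have "exp (17/400) \<ge> (10434/10000 :: real)"
    using exp_lower_Taylor_quadratic[of "17/400"] by (simp add: power2_eq_square)
  then have "exp (2 * (17/400)) \<ge> (10886/10000 :: real)" by (rule step) (simp_all add: power2_eq_square)
  then have "exp (2 * (2 * (17/400))) \<ge> (1185/1000 :: real)" by (rule step) (simp_all add: power2_eq_square)
  then have "exp (2 * (2 * (2 * (17/400)))) \<ge> (1404/1000 :: real)" by (rule step) (simp_all add: power2_eq_square)
  then have "exp (2 * (2 * (2 * (2 * (17/400))))) \<ge> (1971/1000 :: real)" by (rule step) (simp_all add: power2_eq_square)
  then have "exp (2 * (2 * (2 * (2 * (2 * (17/400)))))) \<ge> (3884/1000 :: real)" by (rule step) (simp_all add: power2_eq_square)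
  then have "exp (2 * (2 * (2 * (2 * (2 * (2 * (17/400))))))) \<ge> (15085/1000 :: real)" by (rule step) (simp_all add: power2_eq_square)
  then have "exp (2 * (2 * (2 * (2 * (2 * (2 * (2 * (17/400)))))))) \<ge> (2275/10 :: real)" by (rule step) (simp_all add: power2_eq_square)
  then have e: "exp (136/25) \<ge> (2275/10 :: real)" by simp
  have "sqrt 3 \<ge> 1732 / 1000" by (rule real_le_rsqrt) (simp add: power2_eq_square)
  then have "pi * sqrt 3 \<ge> (31415 / 10000) * (1732 / 1000)"
    using pi_approx by (intro mult_mono) auto
  moreover have "2 * pi * y \<ge> 2 * pi * (sqrt 3 / 2)" using that by (intro mult_left_mono) auto
  moreover have "2 * pi * (sqrt 3 / 2) = pi * sqrt 3" by simp
  moreover have "(31415 / 10000) * (1732 / 1000) \<ge> (136 / 25 :: real)" by simp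
  ultimately have "2 * pi * y \<ge> 136 / 25" by linarith
  then have "exp (2 * pi * y) \<ge> 2275/10" using e by (meson exp_le_cancel_iff order_trans)
  then have "inverse (exp (2 * pi * y)) \<le> inverse (2275/10)" by (intro le_imp_inverse_le) auto
  then show ?thesis by (simp add: exp_minus)
qed

lemma qfun_tail_bound:
  assumes A: "conv_disc A" "fps_nth A 0 = 0" "fps_nth A 1 = 1"
    and le: "\<And>n. norm (fps_nth A (n + 2)) \<le> K * c ^ n"
    and z: "Im z > 0" and c: "c \<ge> 0" "c * norm (nome z) < 1"
  shows "norm (qfun A z - nome z) \<le> K * (norm (nome z))\<^sup>2 / (1 - c * norm (nome z))"
proof -
  define r where "r = norm (nome z)"
  have "(\<lambda>n. fps_nth A (n + 2) * nome z ^ (n + 2)) sums (qfun A z - (\<Sum>n<2. fps_nth A n * nome z ^ n))"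
    by (rule sums_split_initial_segment[OF qfun_sums[OF A(1) z]])
  moreover have "(\<Sum>n<2. fps_nth A n * nome z ^ n) = nome z"
    using A by (simp add: numeral_2_eq_2)
  ultimately have 1: "(\<lambda>n. fps_nth A (n + 2) * nome z ^ (n + 2)) sums (qfun A z - nome z)" by simp
  have "(\<lambda>n. (c * r) ^ n) sums (1 / (1 - c * r))"
    by (rule geometric_sums) (use c in \<open>auto simp: r_def abs_mult\<close>)
  then have 2: "(\<lambda>n. K * r\<^sup>2 * (c * r) ^ n) sums (K * r\<^sup>2 * (1 / (1 - c * r)))"
    by (rule sums_mult)
  have "norm (qfun A z - nome z) \<le> K * r\<^sup>2 * (1 / (1 - c * r))"
  proof (rule norm_sums_le[OF 1 2])
    fix n
    have "norm (fps_nth A (n + 2) * nome z ^ (n + 2)) = norm (fps_nth A (n + 2)) * r ^ (n + 2)"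
      by (simp add: norm_mult norm_power r_def)
    also have "\<dots> \<le> (K * c ^ n) * r ^ (n + 2)"
      by (intro mult_right_mono le) (simp add: r_def)
    finally show "norm (fps_nth A (n + 2) * nome z ^ (n + 2)) \<le> K * r\<^sup>2 * (c * r) ^ n"
      by (simp add: power_add power_mult_distrib power2_eq_square mult_ac)
  qed
  then show ?thesis by (simp add: r_def)
qed

text \<open>The ratio of consecutive left sides is ((n + 4) / (n + 3))^m <= (4/3)^m <= a.\<close>

lemma power_le_geometric:
  fixes m a :: nat and K :: nat
  assumes "3 ^ m \<le> K * a" "4 ^ m \<le> a * 3 ^ m"
  shows "(n + 3) ^ m \<le> K * a ^ (n + 1)"
proof (induction n)
  case 0 then show ?case using assms by simp
next
  case (Suc n)
  have "3 * (n + 4) \<le> 4 * (n + 3)" by simp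
  then have "(3 * (n + 4)) ^ m \<le> (4 * (n + 3)) ^ m" by (rule power_mono) simp
  then have "3 ^ m * (n + 4) ^ m \<le> 4 ^ m * (n + 3) ^ m" by (simp only: power_mult_distrib)
  also have "\<dots> \<le> a * 3 ^ m * (K * a ^ (n + 1))" by (intro mult_mono assms Suc.IH) auto
  finally have "3 ^ m * (n + 4) ^ m \<le> 3 ^ m * (K * a ^ (n + 2))" by (simp add: mult_ac)
  then show ?case by (simp add: add.commute)
qed

lemma sigma_pow_geometric:
  assumes "3 ^ Suc m \<le> K * a" "4 ^ Suc m \<le> a * 3 ^ Suc m" "sigma_pow m 2 \<le> K"
  shows "sigma_pow m (n + 2) \<le> K * a ^ n"
proof (cases n)
  case (Suc n')
  have "sigma_pow m (n' + 3) \<le> (n' + 3) ^ Suc m" by (rule sigma_pow_le) simp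
  also have "\<dots> \<le> K * a ^ (n' + 1)" by (rule power_le_geometric[OF assms(1,2)])
  finally show ?thesis by (simp add: Suc numeral_2_eq_2 numeral_3_eq_3)
qed (use assms in \<open>simp add: numeral_2_eq_2\<close>)

lemma sigma_fps_bound:
  assumes "3 ^ Suc m \<le> K * a" "4 ^ Suc m \<le> a * 3 ^ Suc m" "sigma_pow m 2 \<le> K"
    and z: "Im z > 0" "norm (nome z) \<le> 44 / 10000" and a: "a \<le> 100"
  shows "norm (qfun (sigma_fps m) z - nome z) \<le> norm (nome z) * (real K * (44/10000) / (1 - real a * (44/10000)))"
proof -
  have c: "real a * norm (nome z) \<le> real a * (44/10000)" using z by (intro mult_left_mono) auto
  have c1: "real a * (44/10000) < 1" using a by simp
  have "norm (qfun (sigma_fps m) z - nome z) \<le> real K * (norm (nome z))\<^sup>2 / (1 - real a * norm (nome z))"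
  proof (rule qfun_tail_bound)
    fix n
    have "real (sigma_pow m (n + 2)) \<le> real (K * a ^ n)"
      using sigma_pow_geometric[OF assms(1-3)] by (rule of_nat_mono)
    then show "norm (fps_nth (sigma_fps m) (n + 2)) \<le> real K * real a ^ n"
      by (simp add: sigma_fps_def)
  qed (use c c1 z in auto)
  also have "\<dots> \<le> real K * (norm (nome z) * (44/10000)) / (1 - real a * (44/10000))"
    using c c1 z unfolding power2_eq_square by (intro frac_le mult_left_mono) auto
  finally show ?thesis by (simp add: mult_ac)
qed

text \<open>For |q| <= 0.0044 the expansion 12 Delta = 12 q (1 + error) has an error of modulus
  below 0.76, so the leading term cannot be cancelled. With the divisor series written as q (1 + e)
  and q (1 + d), the error consists of a part linear in e and d, a part with one further factor q
  and a part with q^2, each bounded separately.\<close>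

lemma delta_nonzero_fundamental:
  assumes "Im z \<ge> sqrt 3 / 2"
  shows "qfun (cfps delta) z \<noteq> 0"
proof
  assume zero: "qfun (cfps delta) z = 0"
  have z: "Im z > 0" using assms by (rule less_le_trans[rotated]) simp
  define q where "q = nome z"
  have q: "q \<noteq> 0" "norm q \<le> 44 / 10000"
    using exp_ge_228[OF assms] by (auto simp: q_def norm_nome)
  define e d where "e = qfun (sigma_fps 3) z / q - 1" and "d = qfun (sigma_fps 5) z / q - 1"
  have "norm (qfun (sigma_fps 3) z - q) \<le> norm q * (42/1000)"
  proof -
    \<comment> \<open>Here and for \<open>sigma_fps 5\<close> below, K = 9 and K = 33 are the
      divisor sums at 2; the ratios 9 and 23 are the least integers a with 3^4 <= 9 a and 3^6 <= 33
      a, as \<open>sigma_fps_bound\<close> demands.\<close>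
    have "norm (qfun (sigma_fps 3) z - q) \<le> norm q * (real 9 * (44/10000) / (1 - real 9 * (44/10000)))"
      unfolding q_def by (rule sigma_fps_bound) (use z q in \<open>simp_all add: sigma_pow_2 q_def\<close>)
    also have "\<dots> \<le> norm q * (42/1000)" by (intro mult_left_mono) auto
    finally show ?thesis .
  qed
  moreover have "qfun (sigma_fps 3) z - q = q * e" using q by (simp add: e_def field_simps)
  ultimately have e: "norm e \<le> 42/1000" using q by (simp add: norm_mult)
  have "norm (qfun (sigma_fps 5) z - q) \<le> norm q * (162/1000)"
  proof -
    have "norm (qfun (sigma_fps 5) z - q) \<le> norm q * (real 33 * (44/10000) / (1 - real 23 * (44/10000)))"
      unfolding q_def by (rule sigma_fps_bound) (use z q in \<open>simp_all add: sigma_pow_2 q_def\<close>)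
    also have "\<dots> \<le> norm q * (162/1000)" by (intro mult_left_mono) auto
    finally show ?thesis .
  qed
  moreover have "qfun (sigma_fps 5) z - q = q * d" using q by (simp add: d_def field_simps)
  ultimately have d: "norm d \<le> 162/1000" using q by (simp add: norm_mult)
  have ab: "qfun (sigma_fps 3) z = q * (1 + e)" "qfun (sigma_fps 5) z = q * (1 + d)"
    using q by (simp_all add: e_def d_def)
  have "cfps (12 * delta) = cfps (5 * isigma 3 + 7 * isigma 5 + 1200 * isigma 3 ^ 2 + 96000 * isigma 3 ^ 3 - 1764 * isigma 5 ^ 2)"
    by (simp only: delta_eq_aux)
  then have eq: "fps_const 12 * cfps delta = fps_const 5 * sigma_fps 3 + fps_const 7 * sigma_fps 5
     + fps_const 1200 * sigma_fps 3 ^ 2 + fps_const 96000 * sigma_fps 3 ^ 3 - fps_const 1764 * sigma_fps 5 ^ 2"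
    by (simp add: fps_numeral_fps_const)
  have "12 * qfun (cfps delta) z = 5 * (q * (1 + e)) + 7 * (q * (1 + d)) + 1200 * (q * (1 + e)) ^ 2
     + 96000 * (q * (1 + e)) ^ 3 - 1764 * (q * (1 + d)) ^ 2"
    using arg_cong[OF eq, of "\<lambda>A. qfun A z"] z
    by (simp add: qfun_add qfun_diff qfun_mult qfun_power ab)
  also have "\<dots> = q * (12 + (5 * e + 7 * d)) + 12 * (100 * (q * (1 + e)) ^ 2
     + 8000 * (q * (1 + e)) ^ 3 - 147 * (q * (1 + d)) ^ 2)"
    by (simp add: algebra_simps)
  also have "5 * e + 7 * d = 12 * ((5 * e + 7 * d) / 12)" by simp
  also have "q * (12 + 12 * s) + 12 * (100 * (q * (1 + e)) ^ 2
     + 8000 * (q * (1 + e)) ^ 3 - 147 * (q * (1 + d)) ^ 2) = 12 * q * (1 + (s + q * (-47 + 200 * e + 100 * e ^ 2 - 294 * d - 147 * d ^ 2)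
     + 8000 * q ^ 2 * (1 + e) ^ 3))" for s
    by (simp add: power2_eq_square power3_eq_cube algebra_simps)
  finally have "1 + ((5 * e + 7 * d) / 12 + q * (-47 + 200 * e + 100 * e ^ 2 - 294 * d - 147 * d ^ 2)
     + 8000 * q ^ 2 * (1 + e) ^ 3) = 0" using zero q by simp
  then have "1 = norm ((5 * e + 7 * d) / 12 + q * (-47 + 200 * e + 100 * e ^ 2 - 294 * d - 147 * d ^ 2)
     + 8000 * q ^ 2 * (1 + e) ^ 3)"
    by (metis add_eq_0_iff norm_minus_cancel norm_one)
  also have "\<dots> \<le> norm ((5 * e + 7 * d) / 12) + norm (q * (-47 + 200 * e + 100 * e ^ 2 - 294 * d - 147 * d ^ 2))
     + norm (8000 * q ^ 2 * (1 + e) ^ 3)"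
    by (meson norm_triangle_ineq norm_triangle_mono order_refl order_trans)
  also have "norm ((5 * e + 7 * d) / 12) \<le> (5 * (42/1000) + 7 * (162/1000)) / 12"
    using norm_triangle_ineq[of "5 * e" "7 * d"] e d by (simp add: norm_mult norm_divide)
  also have "norm (q * (-47 + 200 * e + 100 * e ^ 2 - 294 * d - 147 * d ^ 2)) \<le>
      (44/10000) * (47 + 200 * (42/1000) + 100 * (42/1000)^2 + 294 * (162/1000) + 147 * (162/1000)^2)"
    unfolding norm_mult
  proof (intro mult_mono q)
    have e2: "(norm e)\<^sup>2 \<le> (42/1000)\<^sup>2" by (rule power_mono[OF e]) simp
    have d2: "(norm d)\<^sup>2 \<le> (162/1000)\<^sup>2" by (rule power_mono[OF d]) simp
    have "norm (-47 + 200 * e + 100 * e ^ 2 - 294 * d - 147 * d ^ 2) \<le>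
       norm (-47 :: complex) + norm (200 * e) + norm (100 * e ^ 2) + norm (294 * d) + norm (147 * d ^ 2)"
      by (intro order_trans[OF norm_triangle_ineq4] add_mono order_trans[OF norm_triangle_ineq] order_refl)
    also have "\<dots> \<le> 47 + 200 * (42/1000) + 100 * (42/1000)^2 + 294 * (162/1000) + 147 * (162/1000)^2"
    proof (intro add_mono)
      show "norm (200 * e) \<le> 200 * (42/1000)" "norm (294 * d) \<le> 294 * (162/1000)"
        using e d by (simp_all add: norm_mult)
      show "norm (100 * e ^ 2) \<le> 100 * (42/1000)^2"
        using mult_left_mono[OF e2, of 100] by (simp only: norm_mult norm_power) simp
      show "norm (147 * d ^ 2) \<le> 147 * (162/1000)^2"
        using mult_left_mono[OF d2, of 147] by (simp only: norm_mult norm_power) simp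
    qed simp
    finally show "norm (-47 + 200 * e + 100 * e ^ 2 - 294 * d - 147 * d ^ 2) \<le>
       47 + 200 * (42/1000) + 100 * (42/1000)^2 + 294 * (162/1000) + 147 * (162/1000)^2" .
  qed auto
  also have "norm (8000 * q ^ 2 * (1 + e) ^ 3) \<le> 8000 * (44/10000) ^ 2 * (1 + 42/1000) ^ 3"
  proof -
    have "norm (1 + e) \<le> 1 + 42/1000" using norm_triangle_ineq[of 1 e] e by simp
    then show ?thesis unfolding norm_mult norm_power
      by (intro mult_mono power_mono q) auto
  qed
  finally show False by (simp add: power2_eq_square power3_eq_cube)
qed

lemma delta_nonzero: "Im z > 0 \<Longrightarrow> qfun (cfps delta) z \<noteq> 0"
proof -
  assume z: "Im z > 0"
  obtain a b c d :: int and w where w: "a * d - b * c = 1"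
     "w = (of_int a * z + of_int b) / (of_int c * z + of_int d)" "Im w \<ge> sqrt 3 / 2"
    using fundamental_domain_rep[OF z] by metis
  have "qfun (cfps delta) w = (of_int c * z + of_int d) ^ 12 * qfun (cfps delta) z"
    unfolding w(2) by (rule mod_forms_mobius[OF delta_mod_form _ w(1) z]) simp
  with delta_nonzero_fundamental[OF w(3)] show ?thesis by auto
qed

text \<open>The quotient is A / q divided by \<open>D\<close> = Delta / q. In the unit disc
  \<open>D\<close> has no zero, at 0 because its constant term is 1 and elsewhere by
  \<open>delta_nonzero\<close>; hence 1 / \<open>D\<close> converges there as well.\<close>

lemma cusp_form_div_delta:
  assumes A: "A \<in> mod_forms (k + 12)" "fps_nth A 0 = 0"
  obtains C where "C \<in> mod_forms k" "A = C * cfps delta"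
proof -
  define D where "D = fps_shift 1 (cfps delta)"
  have D: "cfps delta = fps_X * D"
    by (simp add: D_def fps_eq_iff)
  have D0: "fps_nth D 0 = 1" by (simp add: D_def)
  have cD: "conv_disc D" using conv_disc_delta by (simp add: D_def conv_disc_def)
  have cA: "conv_disc A" using A by auto
  have nz: "eval_fps D w \<noteq> 0" if "ereal (norm w) < 1" for w
  proof (cases "w = 0")
    case False
    from that have "norm w < 1" by simp
    then obtain z where z: "Im z > 0" "nome z = w" using nome_surj[OF False] by metis
    have "qfun (cfps delta) z = w * eval_fps D w"
      unfolding D using cD z by (simp add: qfun_mult) (simp add: qfun_def)
    with delta_nonzero[OF z(1)] show ?thesis by auto
  qed (simp add: eval_fps_at_0 D0)
  have "min 1 (fps_conv_radius D) \<le> fps_conv_radius (inverse D)"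
    by (rule fps_conv_radius_inverse) (rule nz)
  then have cI: "conv_disc (inverse D)" using cD by (simp add: conv_disc_def min_def split: if_splits)
  define C where "C = fps_shift 1 A * inverse D"
  have cC: "conv_disc C" using cI cA by (simp add: C_def conv_disc_def fps_conv_radius_mult conv_disc_mult[unfolded conv_disc_def])
  have AX: "A = fps_X * fps_shift 1 A" using A(2) by (simp add: fps_eq_iff)
  have "C * cfps delta = (fps_X * fps_shift 1 A) * (inverse D * D)"
    by (simp add: C_def D mult_ac)
  also have "inverse D * D = 1" by (rule inverse_mult_eq_1) (simp add: D0)
  finally have CA: "A = C * cfps delta" using AX by simp
  have "C \<in> mod_forms k"
    unfolding mod_forms_def
  proof (intro CollectI conjI allI impI cC)
    fix z :: complex assume z: "Im z > 0"
    have nz': "z \<noteq> 0" using z by auto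
    have "qfun C (- (1 / z)) * qfun (cfps delta) (- (1 / z)) = z ^ (k + 12) * (qfun C z * qfun (cfps delta) z)"
      using mod_forms_S[OF A(1) z] z cC unfolding CA by (simp only: qfun_mult conv_disc_delta Im_S)
    also have "qfun (cfps delta) (- (1 / z)) = z ^ 12 * qfun (cfps delta) z"
      by (rule mod_forms_S[OF delta_mod_form z])
    finally show "qfun C (- (1 / z)) = z ^ k * qfun C z"
      using delta_nonzero[OF z] nz' by (simp add: power_add)
  qed
  with CA that show ?thesis by blast
qed

section \<open>Integral bases and Hecke operators\<close>

text \<open>\<open>4 \<alpha>(k) + 6 \<beta>(k) = k\<close> fixes one monomial \<open>E\<^sub>4\<^bsup>\<alpha>(k)\<^esup> E\<^sub>6\<^bsup>\<beta>(k)\<^esup>\<close> in every even weight \<open>k \<noteq> 2\<close>.\<close>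
definition weight_split :: "(nat \<Rightarrow> nat) \<Rightarrow> (nat \<Rightarrow> nat) \<Rightarrow> bool" where
  "weight_split \<alpha> \<beta> \<longleftrightarrow> (\<forall>k. even k \<longrightarrow> k \<noteq> 2 \<longrightarrow> 4 * \<alpha> k + 6 * \<beta> k = k)"

definition gbasis :: "(nat \<Rightarrow> nat) \<Rightarrow> (nat \<Rightarrow> nat) \<Rightarrow> nat \<Rightarrow> nat \<Rightarrow> int fps" where
  "gbasis \<alpha> \<beta> k j = eisen4 ^ \<alpha> (k - 12 * j) * eisen6 ^ \<beta> (k - 12 * j) * delta ^ j"

text \<open>For even k the dimension of the full space of modular forms, Eisenstein direction
  included, so that the index of a basis element is its power of Delta. Cusp forms get
  \<open>mdim k - 1\<close>, which for k = 2 relies on truncated subtraction.\<close>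

definition mdim :: "nat \<Rightarrow> nat" where
  "mdim k = (if k mod 12 = 2 then k div 12 else Suc (k div 12))"

lemma mdim_less_iff: "even k \<Longrightarrow> j < mdim k \<longleftrightarrow> 12 * j \<le> k \<and> k - 12 * j \<noteq> 2"
proof -
  assume "even k"
  define q r where "q = k div 12" and "r = k mod 12"
  have k: "k = 12 * q + r" "r < 12" by (simp_all add: q_def r_def)
  have m: "mdim k = (if r = 2 then q else Suc q)" by (simp add: mdim_def q_def r_def)
  show ?thesis
  proof (cases "r = 2")
    case True
    have "j < q \<Longrightarrow> k - 12 * j \<noteq> 2" "12 * j \<le> k \<Longrightarrow> k - 12 * j \<noteq> 2 \<Longrightarrow> j < q" "j < q \<Longrightarrow> 12 * j \<le> k"
      unfolding k True by arith+
    with m True show ?thesis by auto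
  next
    case False
    have "j < Suc q \<Longrightarrow> k - 12 * j \<noteq> 2" "12 * j \<le> k \<Longrightarrow> j < Suc q" "j < Suc q \<Longrightarrow> 12 * j \<le> k"
      using False k(2) unfolding k(1) by - arith+
    with m False show ?thesis by auto
  qed
qed

lemma mdim_add_12: "mdim (k + 12) = Suc (mdim k)"
  by (simp add: mdim_def)

lemma gbasis_mod_form:
  assumes "weight_split \<alpha> \<beta>" "even k" "j < mdim k"
  shows "cfps (gbasis \<alpha> \<beta> k j) \<in> mod_forms k"
proof -
  have j: "12 * j \<le> k" "k - 12 * j \<noteq> 2" using assms mdim_less_iff by auto
  define a b where "a = \<alpha> (k - 12 * j)" and "b = \<beta> (k - 12 * j)"
  have "4 * a + 6 * b = k - 12 * j"
    using assms j unfolding weight_split_def a_def b_def by simp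
  then have k: "a * 4 + b * 6 + j * 12 = k" using j by linarith
  have "cfps eisen4 ^ a * cfps eisen6 ^ b * cfps delta ^ j \<in> mod_forms (a * 4 + b * 6 + j * 12)"
    by (intro mod_forms_mult mod_forms_power eisen4_mod_form eisen6_mod_form delta_mod_form)
  then have "cfps eisen4 ^ a * cfps eisen6 ^ b * cfps delta ^ j \<in> mod_forms k"
    unfolding k .
  then show ?thesis by (simp add: gbasis_def a_def b_def)
qed

lemma gbasis_Suc: "gbasis \<alpha> \<beta> (k + 12) (Suc j) = gbasis \<alpha> \<beta> k j * delta"
  by (simp add: gbasis_def mult_ac)

lemma mult_delta_power_nth:
  "n \<le> j \<Longrightarrow> fps_nth (A * delta ^ j) n = (if n = j then fps_nth A 0 else 0)"
proof -
  assume n: "n \<le> j"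
  have "delta = fps_X * fps_shift 1 delta" by (simp add: fps_eq_iff)
  then have "delta ^ j = (fps_X * fps_shift 1 delta) ^ j" by (rule arg_cong)
  then have eq: "A * delta ^ j = fps_X ^ j * (A * fps_shift 1 delta ^ j)"
    by (simp only: power_mult_distrib mult_ac)
  show ?thesis unfolding eq using n by (simp add: fps_X_power_mult_nth fps_nth_power_0)
qed

lemma gbasis_nth: "n \<le> j \<Longrightarrow> fps_nth (gbasis \<alpha> \<beta> k j) n = (if n = j then 1 else 0)"
  unfolding gbasis_def by (simp add: mult_delta_power_nth fps_nth_power_0)

text \<open>Forward substitution: coefficient i of the combination is \<open>c i\<close> plus
  multiples of earlier \<open>c j\<close>. With d = 0 it yields linear independence, with d = l it
  lets expansions be compared modulo l.\<close>

lemma unitriangular_dvd: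
  fixes F :: "nat \<Rightarrow> 'a :: comm_ring_1 fps"
  assumes F: "\<And>j n. j < N \<Longrightarrow> n \<le> j \<Longrightarrow> fps_nth (F j) n = (if n = j then 1 else 0)"
    and dvd: "\<And>n. n < N \<Longrightarrow> d dvd fps_nth (\<Sum>j<N. fps_const (c j) * F j) n"
    and i: "i < N"
  shows "d dvd c i"
  using i
proof (induction i rule: less_induct)
  case (less i)
  have "fps_nth (\<Sum>j<N. fps_const (c j) * F j) i = (\<Sum>j<N. c j * fps_nth (F j) i)"
    by (simp add: fps_sum_nth)
  also have "\<dots> = (\<Sum>j\<in>{..<N} - {i}. c j * fps_nth (F j) i) + c i"
    using less.prems F[of i i] by (simp add: sum.remove[of _ i])
  finally have eq: "c i = fps_nth (\<Sum>j<N. fps_const (c j) * F j) i - (\<Sum>j\<in>{..<N} - {i}. c j * fps_nth (F j) i)"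
    by simp
  have "d dvd c j * fps_nth (F j) i" if "j \<in> {..<N} - {i}" for j
    using that less F[of j i] by (cases "j < i") auto
  then have "d dvd (\<Sum>j\<in>{..<N} - {i}. c j * fps_nth (F j) i)" by (rule dvd_sum)
  with dvd[OF less.prems] show ?case by (subst eq) (rule dvd_diff)
qed

text \<open>With a the constant term, the absence of cusp forms in weights 6 and 4 forces A E4 = a
  E6 and A^2 = a^2 E4. Together they give a^2 (E4^3 - E6^2) = 0, so a = 0 because Delta is not
  0.\<close>

lemma mod_form_weight_2:
  assumes A: "A \<in> mod_forms 2"
  shows "A = 0"
proof -
  define a where "a = fps_nth A 0"
  let ?E = "cfps eisen4" and ?F = "cfps eisen6"
  have 1: "A * ?E = fps_const a * ?F"
    by (rule mod_forms_eqI[of _ 6])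
       (use mod_forms_mult[OF A eisen4_mod_form] mod_forms_scale[OF eisen6_mod_form] in \<open>simp_all add: a_def\<close>)
  have 2: "A * A = fps_const (a\<^sup>2) * ?E"
    by (rule mod_forms_eqI[of _ 4])
       (use mod_forms_mult[OF A A] mod_forms_scale[OF eisen4_mod_form] in \<open>simp_all add: a_def power2_eq_square\<close>)
  have "fps_const (a\<^sup>2) * (?E ^ 3 - ?F ^ 2) = (A * A) * (?E * ?E) - (fps_const a * ?F) * (fps_const a * ?F)"
    unfolding 2 by (simp add: power2_eq_square power3_eq_cube algebra_simps fps_const_mult[symmetric] del: fps_const_mult)
  also have "\<dots> = 0" unfolding 1[symmetric] by (simp add: mult_ac)
  finally have "fps_const (a\<^sup>2) * cfps (1728 * delta) = 0"
    unfolding delta_eq by simp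
  moreover have "fps_nth (cfps delta) 1 \<noteq> 0" by simp
  then have "cfps delta \<noteq> 0" by (metis fps_zero_nth)
  ultimately have "a = 0" by simp
  with 2 show ?thesis by simp
qed

text \<open>Subtracting a multiple of basis element 0 leaves a cusp form. Below weight 12 it is 0;
  otherwise Delta divides it, and the quotient has weight k - 12, its expansion being shifted by one
  index.\<close>

lemma mod_form_expansion:
  assumes "weight_split \<alpha> \<beta>" "even k" "A \<in> mod_forms k"
  shows "\<exists>c. A = (\<Sum>j<mdim k. fps_const (c j) * cfps (gbasis \<alpha> \<beta> k j))"
  using assms(2,3)
proof (induction k arbitrary: A rule: less_induct)
  case (less k)
  show ?case
  proof (cases "k = 2")
    case True
    with less.prems mod_form_weight_2 have "A = 0" by simp
    with True show ?thesis by (simp add: mdim_def)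
  next
    case False
    with less.prems have pos: "0 < mdim k" by (simp add: mdim_less_iff)
    define B where "B = A - fps_const (fps_nth A 0) * cfps (gbasis \<alpha> \<beta> k 0)"
    have B: "B \<in> mod_forms k" "fps_nth B 0 = 0"
      unfolding B_def using gbasis_mod_form[OF assms(1) less.prems(1) pos] less.prems
      by (auto intro: mod_forms_diff mod_forms_scale simp: gbasis_nth)
    show ?thesis
    proof (cases "k < 12")
      case True
      with less.prems have k10: "k \<le> 10" by presburger
      have "B = 0" by (rule cusp_form_small_weight[OF B(1) less.prems(1) k10 B(2)])
      moreover have "mdim k = 1" using True False by (simp add: mdim_def)
      ultimately show ?thesis by (intro exI[of _ "\<lambda>_. fps_nth A 0"]) (simp add: B_def)
    next
      case k12: False
      then obtain k' where k': "k = k' + 12" by (metis le_iff_add add.commute not_less)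
      obtain C where C: "C \<in> mod_forms k'" "B = C * cfps delta"
        using cusp_form_div_delta B unfolding k' by metis
      have "k' < k" "even k'" using k' less.prems by auto
      from less.IH[OF this C(1)] obtain c where
        c: "C = (\<Sum>j<mdim k'. fps_const (c j) * cfps (gbasis \<alpha> \<beta> k' j))" by blast
      have "A = fps_const (fps_nth A 0) * cfps (gbasis \<alpha> \<beta> k 0) + B" by (simp add: B_def)
      also have "B = (\<Sum>j<mdim k'. fps_const (c j) * cfps (gbasis \<alpha> \<beta> k (Suc j)))"
        unfolding C c k' gbasis_Suc by (simp add: sum_distrib_left sum_distrib_right mult_ac)
      finally show ?thesis
        by (intro exI[of _ "case_nat (fps_nth A 0) c"])
           (simp add: k' mdim_add_12 sum.lessThan_Suc_shift del: sum.lessThan_Suc)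
    qed
  qed
qed

text \<open>Basis element j starts with q^j and leading coefficient 1, so the coefficients are found
  one after another without division.\<close>

lemma int_mod_form_expansion:
  assumes "weight_split \<alpha> \<beta>" "even k" "cfps A \<in> mod_forms k"
  obtains c :: "nat \<Rightarrow> int" where "A = (\<Sum>j<mdim k. fps_const (c j) * gbasis \<alpha> \<beta> k j)"
proof -
  obtain c where c: "cfps A = (\<Sum>j<mdim k. fps_const (c j) * cfps (gbasis \<alpha> \<beta> k j))"
    using mod_form_expansion[OF assms] by blast
  have int: "c i \<in> \<int>" if "i < mdim k" for i
    using that
  proof (induction i rule: less_induct)
    case (less i)
    have "of_int (fps_nth A i) = (\<Sum>j<mdim k. c j * of_int (fps_nth (gbasis \<alpha> \<beta> k j) i))"
      using arg_cong[OF c, of "\<lambda>A. fps_nth A i"] by (simp add: fps_sum_nth)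
    also have "\<dots> = (\<Sum>j\<in>{..<mdim k} - {i}. c j * of_int (fps_nth (gbasis \<alpha> \<beta> k j) i)) + c i"
      using less.prems by (simp add: sum.remove[of _ i] gbasis_nth)
    finally have eq: "c i = of_int (fps_nth A i) - (\<Sum>j\<in>{..<mdim k} - {i}. c j * of_int (fps_nth (gbasis \<alpha> \<beta> k j) i))"
      by simp
    have "c j * of_int (fps_nth (gbasis \<alpha> \<beta> k j) i) \<in> \<int>" if "j \<in> {..<mdim k} - {i}" for j
      using that less by (cases "j < i") (auto simp: gbasis_nth)
    then show ?case by (subst eq) (intro Ints_diff Ints_sum; simp)
  qed
  have "cfps A = cfps (\<Sum>j<mdim k. fps_const \<lfloor>Re (c j)\<rfloor> * gbasis \<alpha> \<beta> k j)"
    unfolding c cfps_sum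
  proof (rule sum.cong)
    fix j assume "j \<in> {..<mdim k}"
    with int obtain x where "c j = of_int x" by (auto elim!: Ints_cases)
    then show "fps_const (c j) * cfps (gbasis \<alpha> \<beta> k j) = cfps (fps_const \<lfloor>Re (c j)\<rfloor> * gbasis \<alpha> \<beta> k j)"
      by simp
  qed simp
  then show ?thesis using that by simp
qed

text \<open>The classical formula for T_p with p prime, polymorphic so that one operator serves
  integral series (for congruences) and complex ones (for values). The weight enters only through
  p^(k - 1).\<close>

definition hecke_fps :: "nat \<Rightarrow> nat \<Rightarrow> 'a :: comm_ring_1 fps \<Rightarrow> 'a fps" where
  "hecke_fps p k A = Abs_fps (\<lambda>n. fps_nth A (p * n) + of_nat (p ^ (k - 1)) * (if p dvd n then fps_nth A (n div p) else 0))"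

lemma cfps_hecke_fps: "cfps (hecke_fps p k A) = hecke_fps p k (cfps A)"
  by (auto simp: fps_eq_iff hecke_fps_def)

lemma hecke_fps_linear:
  "hecke_fps p k (A + B) = hecke_fps p k A + hecke_fps p k B"
  "hecke_fps p k (A - B) = hecke_fps p k A - hecke_fps p k B"
  "hecke_fps p k (fps_const c * A) = fps_const c * hecke_fps p k A"
  "hecke_fps p k 0 = 0"
  by (auto simp: fps_eq_iff hecke_fps_def algebra_simps)

lemma hecke_fps_sum: "hecke_fps p k (\<Sum>i\<in>I. f i) = (\<Sum>i\<in>I. hecke_fps p k (f i))"
  by (induction I rule: infinite_finite_induct) (simp_all add: hecke_fps_linear)

lemma hecke_fps_nth_0: "p > 0 \<Longrightarrow> fps_nth (hecke_fps p k A) 0 = (1 + of_nat p ^ (k - 1)) * fps_nth A 0"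
  by (simp add: hecke_fps_def algebra_simps)

lemma sum_nome_roots:
  assumes p: "p > 0"
  shows "(\<Sum>b<p. nome (of_nat b / of_nat p) ^ m) = (if p dvd m then of_nat p else 0)"
proof -
  define x where "x = nome (of_nat m / of_nat p)"
  have eq: "nome (of_nat b / of_nat p) ^ m = x ^ b" for b
    unfolding x_def nome_power by (simp add: mult_ac)
  have xp: "x ^ p = 1"
    unfolding x_def nome_power using p nome_of_int[of "int m"] by simp
  show ?thesis
  proof (cases "p dvd m")
    case True
    then obtain l where "m = p * l" by blast
    then have "x = 1" unfolding x_def using p nome_of_int[of "int l"] by simp
    with True show ?thesis unfolding eq by simp
  next
    case False
    have "x \<noteq> 1"
    proof
      assume "x = 1"
      then obtain l :: int where l: "Im (2 * of_real pi * \<i> * (of_nat m / of_nat p)) = of_int (2 * l) * pi"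
        unfolding x_def nome_def exp_eq_1 by blast
      have "of_nat m / of_nat p = (of_real (real m / real p) :: complex)" by simp
      with l have "2 * pi * (real m / real p) = 2 * pi * of_int l" by (simp del: of_real_divide)
      moreover have "2 * pi \<noteq> 0" by simp
      ultimately have "real m / real p = of_int l" using mult_left_cancel by blast
      then have "real m = of_int (l * int p)" using p by (simp add: field_simps)
      then have "int m = l * int p" by linarith
      then have "p dvd m" by (metis dvd_triv_right int_dvd_int_iff)
      with False show False by simp
    qed
    with False show ?thesis unfolding eq using geometric_sum[of x p] xp by simp
  qed
qed

definition hecke_val :: "nat \<Rightarrow> nat \<Rightarrow> complex fps \<Rightarrow> complex \<Rightarrow> complex" where
  "hecke_val p k A z = of_nat p ^ (k - 1) * qfun A (of_nat p * z) + (\<Sum>b<p. qfun A ((z + of_nat b) / of_nat p)) / of_nat p"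

text \<open>Summing over b filters the exponents divisible by p, which turns the series at z / p
  into that of the coefficients with index p n.\<close>

lemma hecke_fps_sums:
  assumes A: "conv_disc A" and p: "p > 0" and z: "Im z > 0"
  shows "(\<lambda>n. fps_nth (hecke_fps p k A) n * nome z ^ n) sums hecke_val p k A z"
proof -
  have mono: "strict_mono (\<lambda>n. p * n)" using p by (auto intro!: strict_monoI)
  have pz: "Im (of_nat p * z) > 0" "Im ((z + of_nat b) / of_nat p) > 0" for b using p z by simp_all
  have "(\<lambda>n. fps_nth A n * nome (of_nat p * z) ^ n) sums qfun A (of_nat p * z)"
    by (rule qfun_sums[OF A pz(1)])
  then have "(\<lambda>n. (\<lambda>m. (if p dvd m then fps_nth A (m div p) else 0) * nome z ^ m) (p * n)) sums qfun A (of_nat p * z)"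
    using p by (simp add: nome_power mult_ac)
  then have 1: "(\<lambda>m. (if p dvd m then fps_nth A (m div p) else 0) * nome z ^ m) sums qfun A (of_nat p * z)"
    by (subst (asm) sums_mono_reindex[OF mono]) (auto simp: image_iff dvd_def)
  have "(\<lambda>m. \<Sum>b<p. fps_nth A m * nome ((z + of_nat b) / of_nat p) ^ m) sums (\<Sum>b<p. qfun A ((z + of_nat b) / of_nat p))"
    by (intro sums_sum qfun_sums A pz)
  also have "(\<lambda>m. \<Sum>b<p. fps_nth A m * nome ((z + of_nat b) / of_nat p) ^ m) =
     (\<lambda>m. fps_nth A m * nome (z / of_nat p) ^ m * (if p dvd m then of_nat p else 0))"
    by (simp add: add_divide_distrib nome_add power_mult_distrib sum_distrib_left mult.assoc flip: sum_nome_roots[OF p])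
  finally have "(\<lambda>n. (\<lambda>m. fps_nth A m * nome (z / of_nat p) ^ m * (if p dvd m then of_nat p else 0)) (p * n))
      sums (\<Sum>b<p. qfun A ((z + of_nat b) / of_nat p))"
    by (subst sums_mono_reindex[OF mono]) (auto simp: image_iff dvd_def)
  then have "(\<lambda>n. of_nat p * (fps_nth A (p * n) * nome z ^ n)) sums (\<Sum>b<p. qfun A ((z + of_nat b) / of_nat p))"
    using p by (simp add: nome_power mult_ac)
  then have "(\<lambda>n. of_nat p * (fps_nth A (p * n) * nome z ^ n) / of_nat p) sums ((\<Sum>b<p. qfun A ((z + of_nat b) / of_nat p)) / of_nat p)"
    by (rule sums_divide)
  then have 2: "(\<lambda>n. fps_nth A (p * n) * nome z ^ n) sums ((\<Sum>b<p. qfun A ((z + of_nat b) / of_nat p)) / of_nat p)"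
    using p by simp
  show ?thesis
    using sums_add[OF sums_mult[OF 1, of "of_nat p ^ (k - 1)"] 2]
    by (simp add: hecke_fps_def hecke_val_def algebra_simps)
qed

lemma conv_discI_nome:
  assumes "\<And>z. Im z > 0 \<Longrightarrow> summable (\<lambda>n. fps_nth A n * nome z ^ n)"
  shows "conv_disc A"
proof (rule conv_discI)
  fix w :: complex assume w: "norm w < 1"
  show "summable (\<lambda>n. fps_nth A n * w ^ n)"
  proof (cases "w = 0")
    case True
    then show ?thesis using powser_sums_zero[of "fps_nth A"] by (auto simp: summable_def)
  next
    case False
    from nome_surj[OF this w] assms show ?thesis by metis
  qed
qed

lemma conv_disc_hecke_fps: "conv_disc A \<Longrightarrow> p > 0 \<Longrightarrow> conv_disc (hecke_fps p k A)"
  by (rule conv_discI_nome) (blast intro: sums_summable hecke_fps_sums)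

lemma qfun_hecke_fps:
  assumes "conv_disc A" "p > 0" "Im z > 0"
  shows "qfun (hecke_fps p k A) z = hecke_val p k A z"
  using qfun_sums[OF conv_disc_hecke_fps[OF assms(1,2)] assms(3)] hecke_fps_sums[OF assms]
  by (rule sums_unique2)

text \<open>The permutation b -> -1/b of the nonzero residues, by which z -> -1/z permutes the
  points (z + b) / p.\<close>

definition neg_inv :: "nat \<Rightarrow> nat \<Rightarrow> nat" where
  "neg_inv p b = (SOME b'. b' < p \<and> p dvd b * b' + 1)"

lemma neg_inv:
  assumes p: "prime p" and b: "b \<in> {1..<p}"
  shows "neg_inv p b \<in> {1..<p}" "p dvd b * neg_inv p b + 1"
proof -
  have "\<not> p dvd b" using b by (auto dest: dvd_imp_le)
  then have "coprime b p" using prime_imp_coprime[OF p] by (simp only: coprime_commute)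
  then obtain x where x: "[b * x = 1] (mod p)" using cong_solve_coprime_nat[of b p] by auto
  have p1: "p > 1" using p prime_gt_1_nat by blast
  have "[b * (x * (p - 1) mod p) = (b * x) * (p - 1)] (mod p)"
    by (simp add: cong_def mod_mult_right_eq mult.assoc)
  also have "[(b * x) * (p - 1) = 1 * (p - 1)] (mod p)" by (rule cong_mult[OF x cong_refl])
  finally have "[b * (x * (p - 1) mod p) + 1 = 1 * (p - 1) + 1] (mod p)" by (rule cong_add) simp
  also have "1 * (p - 1) + 1 = p" using p1 by simp
  also have "[p = 0] (mod p)" by (simp add: cong_def)
  finally have "p dvd b * (x * (p - 1) mod p) + 1" by (simp only: cong_0_iff)
  moreover have "x * (p - 1) mod p < p" using p1 by simp
  ultimately have "neg_inv p b < p \<and> p dvd b * neg_inv p b + 1"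
    unfolding neg_inv_def by (intro someI[of "\<lambda>b'. b' < p \<and> p dvd b * b' + 1"]) simp
  moreover from this have "neg_inv p b \<noteq> 0" using p1 by (intro notI) simp
  ultimately show "neg_inv p b \<in> {1..<p}" "p dvd b * neg_inv p b + 1" by auto
qed

lemma neg_inv_unique:
  fixes p b b' x :: nat
  assumes p: "prime p" and b: "b < p" "b' < p" and dvd: "p dvd x * b + 1" "p dvd x * b' + 1"
  shows "b = b'"
proof -
  have "int p dvd int (x * b + 1) - int (x * b' + 1)"
    by (intro dvd_diff) (simp_all only: int_dvd_int_iff dvd)
  then have "int p dvd int x * (int b - int b')" by (simp add: algebra_simps)
  moreover have "\<not> int p dvd int x"
  proof
    assume "int p dvd int x"
    then have "p dvd x" by simp
    then have "p dvd x * b" by simp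
    with dvd(1) have "p dvd 1" using dvd_add_right_iff by blast
    with p show False by simp
  qed
  ultimately have "int p dvd int b - int b'" using p by (metis prime_dvd_multD prime_int_nat_transfer prime_nat_int_transfer)
  then have "[int b = int b'] (mod int p)" by (simp add: cong_iff_dvd_diff)
  then show ?thesis using b by (simp add: cong_int_iff cong_less_modulus_unique_nat)
qed

lemma neg_inv_neg_inv:
  assumes "prime p" "b \<in> {1..<p}"
  shows "neg_inv p (neg_inv p b) = b"
proof (rule neg_inv_unique[OF assms(1)])
  show "p dvd neg_inv p b * neg_inv p (neg_inv p b) + 1" by (intro neg_inv assms)
  show "p dvd neg_inv p b * b + 1" using neg_inv(2)[OF assms] by (simp add: mult.commute)
qed (use assms neg_inv in auto)

text \<open>With b b' + 1 = p y, the matrix with rows (b, -y) and (p, -b') has determinant 1 and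
  maps (z + b') / p to (b - 1/z) / p, and its automorphy factor there is z.\<close>

lemma mod_forms_coset_S:
  assumes A: "A \<in> mod_forms k" "even k" and p: "p > 0" and z: "Im z > 0"
    and dvd: "int p dvd b * b' + 1"
  shows "qfun A ((of_int b - 1 / z) / of_nat p) = z ^ k * qfun A ((z + of_int b') / of_nat p)"
proof -
  obtain y where y: "b * b' + 1 = int p * y" using dvd by blast
  define w where "w = (z + of_int b') / of_nat p"
  have w: "Im w > 0" using p z by (simp add: w_def)
  have nz: "z \<noteq> 0" using z by auto
  have wp: "w * of_nat p = z + of_int b'" using p by (simp add: w_def)
  have den: "of_int (int p) * w + of_int (- b') = z" using p by (simp add: w_def)
  have "b * (- b') - (- y) * int p = 1" using y by (simp add: algebra_simps)
  from mod_forms_mobius[OF A this w]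
  have "qfun A ((of_int b * w + of_int (- y)) / z) = z ^ k * qfun A w" unfolding den .
  moreover have "of_int (b * b' + 1) = (of_int (int p * y) :: complex)" by (simp only: y)
  then have "of_nat p * of_int y = (of_int b * of_int b' + 1 :: complex)" by simp
  then have "of_int b * (w * of_nat p) - of_nat p * of_int y = of_int b * z - 1"
    unfolding wp by (simp add: algebra_simps)
  then have "(of_int b * w + of_int (- y)) * of_nat p = of_int b * z - 1"
    by (simp add: algebra_simps)
  then have eq: "of_int b * w + of_int (- y) = (of_int b * z - 1) / of_nat p"
    using p by (simp add: eq_divide_eq)
  have "(of_int b * w + of_int (- y)) / z = (of_int b - 1 / z) / of_nat p"
    unfolding eq using p nz by (simp add: field_simps)
  ultimately show ?thesis by (simp add: w_def)
qed

text \<open>The inversion exchanges the terms at p z and z / p and permutes those with b > 0 through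
  \<open>neg_inv\<close>.\<close>

lemma hecke_fps_mod_form:
  assumes A: "A \<in> mod_forms k" "even k" "k > 0" and p: "prime p"
  shows "hecke_fps p k A \<in> mod_forms k"
  unfolding mod_forms_def
proof (intro CollectI conjI allI impI)
  have p0: "p > 0" using p prime_gt_0_nat by blast
  have cA: "conv_disc A" using A by auto
  show "conv_disc (hecke_fps p k A)" by (rule conv_disc_hecke_fps[OF cA p0])
  fix z :: complex assume z: "Im z > 0"
  have nz: "z \<noteq> 0" using z by auto
  define f where "f = qfun A"
  obtain m where m: "k = Suc m" using A(3) by (cases k) auto
  have split: "(\<Sum>b<p. g b) = g 0 + (\<Sum>b\<in>{1..<p}. g b)" for g :: "nat \<Rightarrow> complex"
    using p0 by (simp add: atLeast0LessThan[symmetric] sum.atLeast_Suc_lessThan)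
  have S1: "f (of_nat p * (- (1 / z))) = (z / of_nat p) ^ k * f (z / of_nat p)"
    using mod_forms_S[OF A(1), of "z / of_nat p"] z p0 by (simp add: f_def)
  have S2: "f (- (1 / z) / of_nat p) = (of_nat p * z) ^ k * f (of_nat p * z)"
    using mod_forms_S[OF A(1), of "of_nat p * z"] z p0 by (simp add: f_def mult_ac)
  have S3: "(\<Sum>b\<in>{1..<p}. f ((- (1 / z) + of_nat b) / of_nat p)) = z ^ k * (\<Sum>b\<in>{1..<p}. f ((z + of_nat b) / of_nat p))"
    unfolding sum_distrib_left
  proof (rule sum.reindex_bij_witness[where i = "neg_inv p" and j = "neg_inv p"])
    fix b assume b: "b \<in> {1..<p}"
    have "int p dvd int (b * neg_inv p b + 1)" using neg_inv(2)[OF p b] by (simp only: int_dvd_int_iff)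
    then have "int p dvd int b * int (neg_inv p b) + 1" by (simp add: add.commute)
    from mod_forms_coset_S[OF A(1,2) p0 z this]
    show "z ^ k * f ((z + of_nat (neg_inv p b)) / of_nat p) = f ((- (1 / z) + of_nat b) / of_nat p)"
      by (simp add: f_def)
  qed (use p neg_inv neg_inv_neg_inv in auto)
  have "hecke_val p k A (- (1 / z)) = z ^ k * hecke_val p k A z"
    unfolding hecke_val_def f_def[symmetric] split of_nat_0 add_0_right S1 S2 S3
    using p0 nz by (simp add: m field_simps)
  then show "qfun (hecke_fps p k A) (- (1 / z)) = z ^ k * qfun (hecke_fps p k A) z"
    by (simp only: qfun_hecke_fps[OF cA p0 z] qfun_hecke_fps[OF cA p0 Im_S[OF z]])
qed

section \<open>From q-expansions to the function spaces of the statement\<close>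

definition uhp_fun :: "complex fps \<Rightarrow> complex \<Rightarrow> complex" where
  "uhp_fun A z = (if Im z > 0 then qfun A z else 0)"

lemma cusp_forms_eq:
  assumes k: "even k"
  shows "cusp_forms k = uhp_fun ` {A \<in> mod_forms k. fps_nth A 0 = 0}"
proof (intro equalityI subsetI)
  fix f assume f: "f \<in> cusp_forms k"
  then obtain u where u: "u 0 = 0" "\<And>z. Im z > 0 \<Longrightarrow> (\<lambda>n. u n * exp (2 * of_real pi * \<i> * z) ^ n) sums f z"
    by (auto simp: cusp_forms_def)
  define A where "A = Abs_fps u"
  have s: "(\<lambda>n. fps_nth A n * nome z ^ n) sums f z" if "Im z > 0" for z
    using u(2)[OF that] by (simp add: A_def nome_def)
  have cA: "conv_disc A" by (rule conv_discI_nome) (blast intro: s sums_summable)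
  have q: "qfun A z = f z" if "Im z > 0" for z
    using qfun_sums[OF cA that] s[OF that] by (rule sums_unique2)
  have "f (- (1 / z)) = z ^ k * f z" if z: "Im z > 0" for z
  proof -
    have "\<forall>a b c d :: int. a * d - b * c = 1 \<longrightarrow> (\<forall>z\<in>uhp.
           f ((of_int a * z + of_int b) / (of_int c * z + of_int d)) = (of_int c * z + of_int d) ^ k * f z)"
      using f by (simp add: cusp_forms_def)
    from this[rule_format, of 0 0 "-1" 1 z] z show ?thesis by simp
  qed
  then have "A \<in> mod_forms k" using cA by (simp add: mod_forms_def q q[OF Im_S])
  moreover have "f = uhp_fun A"
    using f q by (auto simp: fun_eq_iff uhp_fun_def cusp_forms_def)
  moreover have "fps_nth A 0 = 0" by (simp add: A_def u)
  ultimately show "f \<in> uhp_fun ` {A \<in> mod_forms k. fps_nth A 0 = 0}" by blast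
next
  fix f assume "f \<in> uhp_fun ` {A \<in> mod_forms k. fps_nth A 0 = 0}"
  then obtain A where A: "A \<in> mod_forms k" "fps_nth A 0 = 0" "f = uhp_fun A" by auto
  have cA: "conv_disc A" using A by auto
  show "f \<in> cusp_forms k"
    unfolding cusp_forms_def
  proof (intro CollectI conjI allI impI ballI)
    show "f z = 0" if "z \<notin> uhp" for z using that by (simp add: A uhp_fun_def)
    show "f holomorphic_on uhp"
      using qfun_holomorphic[OF cA] by (rule holomorphic_transform) (simp add: A uhp_fun_def)
    show "f ((of_int a * z + of_int b) / (of_int c * z + of_int d)) = (of_int c * z + of_int d) ^ k * f z"
      if "a * d - b * c = 1" "z \<in> uhp" for a b c d z
      using that mod_forms_mobius[OF A(1) k that(1), of z] Im_mobius(3)[OF that(1), of z] by (simp add: A uhp_fun_def)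
    show "\<exists>u. u 0 = 0 \<and> (\<forall>z\<in>uhp. (\<lambda>n. u n * exp (2 * of_real pi * \<i> * z) ^ n) sums f z)"
      using qfun_sums[OF cA] by (intro exI[of _ "fps_nth A"]) (simp add: A uhp_fun_def nome_def)
  qed
qed

lemma hecke_op_prime:
  assumes p: "prime p" and k: "k > 0"
  shows "hecke_op k p f z = of_nat p ^ (k - 1) * f (of_nat p * z) + (\<Sum>b<p. f ((z + of_nat b) / of_nat p)) / of_nat p"
proof -
  have S: "{(a, d). a * d = p} = {(1, p), (p, 1)}"
  proof (intro equalityI subsetI)
    fix x assume "x \<in> {(a, d). a * d = p}"
    then obtain a d where x: "x = (a, d)" "a * d = p" by auto
    then have "a = 1 \<or> d = 1" using p by (metis prime_product)
    with x show "x \<in> {(1, p), (p, 1)}" by auto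
  qed auto
  have p1: "p > 1" using p prime_gt_1_nat by blast
  obtain m where m: "k = Suc m" using k by (cases k) auto
  show ?thesis unfolding hecke_op_def S using p1 by (simp add: m field_simps)
qed

text \<open>The extension by zero is respected because p z and (z + b) / p lie in the half-plane
  only if z does.\<close>

lemma hecke_op_uhp_fun:
  assumes "conv_disc A" "prime p" "k > 0"
  shows "hecke_op k p (uhp_fun A) = uhp_fun (hecke_fps p k A)"
proof
  fix z
  have p0: "p > 0" using assms(2) prime_gt_0_nat by blast
  show "hecke_op k p (uhp_fun A) z = uhp_fun (hecke_fps p k A) z"
  proof (cases "Im z > 0")
    case True
    then show ?thesis using p0 assms
      by (simp add: hecke_op_prime uhp_fun_def qfun_hecke_fps hecke_val_def)
  next
    case False
    then have "\<not> Im (of_nat p * z) > 0" "\<not> Im ((z + of_nat b) / of_nat p) > 0" for b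
      using p0 by (simp_all add: zero_less_mult_iff zero_less_divide_iff)
    with False assms show ?thesis by (simp add: hecke_op_prime uhp_fun_def)
  qed
qed

section \<open>Characteristic polynomials modulo \<open>l\<close>\<close>

definition fps_cong :: "nat \<Rightarrow> int fps \<Rightarrow> int fps \<Rightarrow> bool" where
  "fps_cong l A B \<longleftrightarrow> fps_const (int l) dvd A - B"

lemma fps_const_dvd_iff: "fps_const c dvd A \<longleftrightarrow> (\<forall>n. c dvd fps_nth A n)" for A :: "int fps"
proof
  assume "\<forall>n. c dvd fps_nth A n"
  then have "A = fps_const c * Abs_fps (\<lambda>n. fps_nth A n div c)" by (simp add: fps_eq_iff)
  then show "fps_const c dvd A" by (rule dvdI)
qed auto

lemma fps_cong_iff: "fps_cong l A B \<longleftrightarrow> (\<forall>n. [fps_nth A n = fps_nth B n] (mod int l))"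
  by (simp add: fps_cong_def fps_const_dvd_iff cong_iff_dvd_diff)

lemma fps_cong_refl [simp]: "fps_cong l A A"
  by (simp add: fps_cong_def)

lemma fps_cong_sym: "fps_cong l A B \<Longrightarrow> fps_cong l B A"
  by (auto simp: fps_cong_iff intro: cong_sym)

lemma fps_cong_trans [trans]: "fps_cong l A B \<Longrightarrow> fps_cong l B C \<Longrightarrow> fps_cong l A C"
  unfolding fps_cong_iff using cong_trans by blast

lemma fps_cong_add: "fps_cong l A B \<Longrightarrow> fps_cong l C D \<Longrightarrow> fps_cong l (A + C) (B + D)"
  by (auto simp: fps_cong_iff intro: cong_add)

lemma fps_cong_diff: "fps_cong l A B \<Longrightarrow> fps_cong l C D \<Longrightarrow> fps_cong l (A - C) (B - D)"
  by (auto simp: fps_cong_iff intro: cong_diff)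

lemma fps_cong_mult: "fps_cong l A B \<Longrightarrow> fps_cong l C D \<Longrightarrow> fps_cong l (A * C) (B * D)"
  by (auto simp: fps_cong_iff fps_mult_nth intro!: cong_sum cong_mult)

lemma fps_cong_power: "fps_cong l A B \<Longrightarrow> fps_cong l (A ^ n) (B ^ n)"
  by (induction n) (auto intro: fps_cong_mult)

lemma fps_cong_sum: "(\<And>i. i \<in> I \<Longrightarrow> fps_cong l (f i) (g i)) \<Longrightarrow> fps_cong l (sum f I) (sum g I)"
  by (induction I rule: infinite_finite_induct) (auto intro: fps_cong_add)

lemma fps_cong_const: "[a = b] (mod int l) \<Longrightarrow> fps_cong l (fps_const a) (fps_const b)"
  by (auto simp: fps_cong_iff)

lemma det_dvd_diff:
  fixes A B :: "'a :: comm_ring_1 mat"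
  assumes AB: "A \<in> carrier_mat n n" "B \<in> carrier_mat n n"
    and dvd: "\<And>i j. i < n \<Longrightarrow> j < n \<Longrightarrow> c dvd A $$ (i, j) - B $$ (i, j)"
  shows "c dvd det A - det B"
proof -
  have prod: "c dvd prod f I - prod g I" if "\<And>i. i \<in> I \<Longrightarrow> c dvd f i - g i" for f g :: "nat \<Rightarrow> 'a" and I
    using that
  proof (induction I rule: infinite_finite_induct)
    case (insert x I)
    have "f x * prod f I - g x * prod g I = f x * (prod f I - prod g I) + (f x - g x) * prod g I"
      by (simp add: algebra_simps)
    with insert show ?case by simp
  qed auto
  show ?thesis
    unfolding det_def'[OF AB(1)] det_def'[OF AB(2)] sum_subtractf[symmetric] right_diff_distrib[symmetric]
    by (intro dvd_sum dvd_mult prod dvd) (auto simp: permutes_in_image)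
qed

lemma char_poly_dvd_diff:
  fixes A B :: "int mat"
  assumes AB: "A \<in> carrier_mat n n" "B \<in> carrier_mat n n"
    and dvd: "\<And>i j. i < n \<Longrightarrow> j < n \<Longrightarrow> c dvd A $$ (i, j) - B $$ (i, j)"
  shows "c dvd coeff (char_poly A) m - coeff (char_poly B) m"
proof -
  have "[:c:] dvd char_poly A - char_poly B"
    unfolding char_poly_def
  proof (rule det_dvd_diff)
    fix i j assume ij: "i < n" "j < n"
    have "char_poly_matrix A $$ (i, j) - char_poly_matrix B $$ (i, j) = [:B $$ (i, j) - A $$ (i, j):]"
      using ij AB by (auto simp: char_poly_matrix_def)
    moreover have "c dvd B $$ (i, j) - A $$ (i, j)" using dvd[OF ij] by (simp add: dvd_diff_commute)
    ultimately show "[:c:] dvd char_poly_matrix A $$ (i, j) - char_poly_matrix B $$ (i, j)"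
      by (simp add: const_poly_dvd)
  qed (use AB in auto)
  then show ?thesis unfolding const_poly_dvd_iff by (metis coeff_diff)
qed

lemma basis_list_expand:
  assumes bs: "basis_list V bs" and v: "v \<in> V"
  shows "(\<Sum>l<length bs. (\<lambda>z. cfun.representation (set bs) v (bs ! l) * (bs ! l) z)) = v"
proof -
  have "(\<Sum>l<length bs. (\<lambda>z. cfun.representation (set bs) v (bs ! l) * (bs ! l) z)) =
        (\<Sum>b\<in>set bs. (\<lambda>z. cfun.representation (set bs) v b * b z))"
    by (rule sum.reindex_bij_betw[OF bij_betw_nth]) (use bs in \<open>auto simp: basis_list_def\<close>)
  also have "\<dots> = v"
    by (rule cfun.sum_representation_eq) (use assms in \<open>auto simp: basis_list_def\<close>)
  finally show ?thesis .
qed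

lemma representation_lincomb:
  assumes bs: "basis_list V bs" and x: "\<And>i. i \<in> I \<Longrightarrow> x i \<in> V"
  shows "cfun.representation (set bs) (\<Sum>i\<in>I. (\<lambda>z. c i * x i z)) b = (\<Sum>i\<in>I. c i * cfun.representation (set bs) (x i) b)"
proof -
  have ind: "cfun.independent (set bs)" and sp: "cfun.span (set bs) = V" using bs by (auto simp: basis_list_def)
  have "cfun.representation (set bs) (\<Sum>i\<in>I. (\<lambda>z. c i * x i z)) =
      (\<lambda>b. \<Sum>i\<in>I. cfun.representation (set bs) (\<lambda>z. c i * x i z) b)"
    by (rule cfun.representation_sum[OF ind]) (rule cfun.span_scale, simp add: sp x)
  also have "\<dots> = (\<lambda>b. \<Sum>i\<in>I. c i * cfun.representation (set bs) (x i) b)"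
    using x sp by (intro ext sum.cong refl) (subst cfun.representation_scale[OF ind], auto)
  finally show ?thesis by simp
qed

lemma representation_change_basis:
  assumes bs: "basis_list V bs" "basis_list V bs'" and v: "v \<in> V"
  shows "cfun.representation (set bs) v b =
    (\<Sum>l<length bs'. cfun.representation (set bs') v (bs' ! l) * cfun.representation (set bs) (bs' ! l) b)"
proof -
  have "bs' ! l \<in> V" if "l < length bs'" for l
    using that bs(2) cfun.span_base[of "bs' ! l" "set bs'"] by (auto simp: basis_list_def)
  then show ?thesis
    by (subst basis_list_expand[OF bs(2) v, symmetric]) (rule representation_lincomb[OF bs(1)], simp)
qed

text \<open>\<open>charpoly_on\<close> picks an unknown basis. The change-of-basis matrices
  \<open>P\<close> and \<open>Q\<close> are inverse to each other and conjugate one matrix of T into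
  the other, so any basis may be used.\<close>

lemma charpoly_on_basis:
  assumes bs: "basis_list V bs"
    and T: "\<And>x. x \<in> V \<Longrightarrow> T x \<in> V" "\<And>x y. T (x + y) = T x + T y" "\<And>c x. T (\<lambda>z. c * x z) = (\<lambda>z. c * T x z)"
  shows "charpoly_on V T = char_poly (matrix_wrt bs T)"
proof -
  define bs' where "bs' = (SOME bs. basis_list V bs)"
  have bs': "basis_list V bs'" unfolding bs'_def by (rule someI, rule bs)
  define n where "n = length bs"
  have card: "card (set b) = cfun.dim V" if "basis_list V b" for b
  proof -
    have b: "cfun.span (set b) = V" "cfun.independent (set b)" using that by (auto simp: basis_list_def)
    then have "cfun.span (set b) = cfun.span V" using cfun.span_span by metis
    with b(2) show ?thesis by (intro cfun.dim_eq_card[symmetric])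
  qed
  have len: "length bs' = n"
    using card[OF bs] card[OF bs'] bs bs' by (simp add: basis_list_def distinct_card n_def)
  have inV: "b ! l \<in> V" if "basis_list V b" "l < length b" for b l
    using that cfun.span_base[of "b ! l" "set b"] by (auto simp: basis_list_def)
  have T0: "T 0 = 0"
    using T(3)[of 0 "\<lambda>_. 0"] by (simp add: zero_fun_def)
  have Tsum: "T (\<Sum>i\<in>I. (\<lambda>z. c i * x i z)) = (\<Sum>i\<in>I. (\<lambda>z. c i * T (x i) z))"
    for c :: "nat \<Rightarrow> complex" and x :: "nat \<Rightarrow> complex \<Rightarrow> complex" and I
    by (induction I rule: infinite_finite_induct) (simp_all only: sum.infinite sum.empty sum.insert T0 T(2,3) simp_thms if_False)
  define R R' where "R = cfun.representation (set bs)" and "R' = cfun.representation (set bs')"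
  have delta: "cfun.representation (set b) (b ! j) (b ! i) = (if i = j then 1 else 0)"
    if "basis_list V b" "i < length b" "j < length b" for b i j
    using that by (auto simp: basis_list_def cfun.representation_basis nth_eq_iff_index_eq)
  define P Q where "P = mat n n (\<lambda>(i, j). R (bs' ! j) (bs ! i))" and "Q = mat n n (\<lambda>(i, j). R' (bs ! j) (bs' ! i))"
  define A A' where "A = matrix_wrt bs T" and "A' = matrix_wrt bs' T"
  have c: "P \<in> carrier_mat n n" "Q \<in> carrier_mat n n" "A \<in> carrier_mat n n" "A' \<in> carrier_mat n n"
    by (simp_all add: P_def Q_def A_def A'_def matrix_wrt_def len n_def)
  have PQ: "P * Q = 1\<^sub>m n"
  proof (rule eq_matI)
    fix i j assume ij: "i < dim_row (1\<^sub>m n)" "j < dim_col (1\<^sub>m n)"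
    have "(P * Q) $$ (i, j) = (\<Sum>l<n. R' (bs ! j) (bs' ! l) * R (bs' ! l) (bs ! i))"
      using ij by (simp add: P_def Q_def scalar_prod_def atLeast0LessThan mult.commute)
    also have "\<dots> = R (bs ! j) (bs ! i)"
      unfolding R_def R'_def using representation_change_basis[OF bs bs' inV[OF bs]] ij by (simp add: len n_def)
    finally show "(P * Q) $$ (i, j) = 1\<^sub>m n $$ (i, j)"
      using delta[OF bs] ij by (simp add: R_def n_def)
  qed (use c in auto)
  have QP: "Q * P = 1\<^sub>m n"
  proof (rule eq_matI)
    fix i j assume ij: "i < dim_row (1\<^sub>m n)" "j < dim_col (1\<^sub>m n)"
    have "(Q * P) $$ (i, j) = (\<Sum>l<n. R (bs' ! j) (bs ! l) * R' (bs ! l) (bs' ! i))"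
      using ij by (simp add: P_def Q_def scalar_prod_def atLeast0LessThan mult.commute)
    also have "\<dots> = R' (bs' ! j) (bs' ! i)"
      unfolding R_def R'_def using representation_change_basis[OF bs' bs inV[OF bs']] ij by (simp add: len n_def)
    finally show "(Q * P) $$ (i, j) = 1\<^sub>m n $$ (i, j)"
      using delta[OF bs'] ij by (simp add: R'_def len)
  qed (use c in auto)
  have AP: "A * P = P * A'"
  proof (rule eq_matI)
    fix i j assume "i < dim_row (P * A')" "j < dim_col (P * A')"
    then have ij: "i < n" "j < n" using c by auto
    have "(A * P) $$ (i, j) = (\<Sum>l<n. R (bs' ! j) (bs ! l) * R (T (bs ! l)) (bs ! i))"
      using ij by (simp add: P_def A_def matrix_wrt_def R_def scalar_prod_def atLeast0LessThan mult.commute n_def)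
    also have "\<dots> = R (\<Sum>l<n. (\<lambda>z. R (bs' ! j) (bs ! l) * T (bs ! l) z)) (bs ! i)"
      unfolding R_def by (rule representation_lincomb[OF bs, symmetric]) (use T(1) inV[OF bs] in \<open>auto simp: n_def\<close>)
    also have "\<dots> = R (T (\<Sum>l<n. (\<lambda>z. R (bs' ! j) (bs ! l) * (bs ! l) z))) (bs ! i)"
      by (simp only: Tsum)
    also have "\<dots> = R (T (bs' ! j)) (bs ! i)"
      using basis_list_expand[OF bs, of "bs' ! j"] inV[OF bs', of j] ij by (simp add: R_def n_def len)
    also have "\<dots> = (\<Sum>l<n. R' (T (bs' ! j)) (bs' ! l) * R (bs' ! l) (bs ! i))"
      unfolding R_def R'_def using representation_change_basis[OF bs bs' T(1)[OF inV[OF bs']]] ij by (simp add: len)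
    also have "\<dots> = (P * A') $$ (i, j)"
      using ij by (simp add: P_def A'_def matrix_wrt_def R'_def scalar_prod_def atLeast0LessThan mult.commute len)
    finally show "(A * P) $$ (i, j) = (P * A') $$ (i, j)" .
  qed (use c in auto)
  have "A = A * (P * Q)" using c by (simp add: PQ)
  also have "\<dots> = (A * P) * Q" by (rule assoc_mult_mat[symmetric]) (use c in auto)
  finally have "A = P * A' * Q" by (simp only: AP)
  then have "similar_mat A A'"
    unfolding similar_mat_def using similar_mat_witI[OF PQ QP _ c(3) c(4) c(1) c(2)] by blast
  then have "char_poly A = char_poly A'" by (rule char_poly_similar)
  then show ?thesis by (simp add: charpoly_on_def A_def A'_def bs'_def)
qed

lemma sum_fun_apply: "(\<Sum>i\<in>I. f i) z = (\<Sum>i\<in>I. f i z)" for f :: "'i \<Rightarrow> complex \<Rightarrow> complex"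
  by (induction I rule: infinite_finite_induct) simp_all

lemma conv_disc_sum: "(\<And>i. i \<in> I \<Longrightarrow> conv_disc (f i)) \<Longrightarrow> conv_disc (\<Sum>i\<in>I. f i)"
  by (induction I rule: infinite_finite_induct) simp_all

lemma qfun_sum:
  "Im z > 0 \<Longrightarrow> (\<And>i. i \<in> I \<Longrightarrow> conv_disc (f i)) \<Longrightarrow> qfun (\<Sum>i\<in>I. f i) z = (\<Sum>i\<in>I. qfun (f i) z)"
  by (induction I rule: infinite_finite_induct) (simp_all add: qfun_add conv_disc_sum)

lemma uhp_fun_lincomb:
  assumes "\<And>i. i \<in> I \<Longrightarrow> conv_disc (A i)"
  shows "uhp_fun (\<Sum>i\<in>I. fps_const (c i) * A i) = (\<Sum>i\<in>I. (\<lambda>z. c i * uhp_fun (A i) z))"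
  using assms by (auto simp: fun_eq_iff uhp_fun_def sum_fun_apply qfun_sum qfun_mult)

lemma uhp_fun_inject: "conv_disc A \<Longrightarrow> conv_disc B \<Longrightarrow> uhp_fun A = uhp_fun B \<Longrightarrow> A = B"
  by (rule qfun_eqD) (auto simp: fun_eq_iff uhp_fun_def split: if_splits)

lemma hecke_op_linear:
  "hecke_op k p (f + g) = hecke_op k p f + hecke_op k p g"
  "hecke_op k p (\<lambda>z. c * f z) = (\<lambda>z. c * hecke_op k p f z)"
  by (auto simp: fun_eq_iff hecke_op_def sum.distrib sum_distrib_left algebra_simps case_prod_unfold)

text \<open>Element 0 of the full basis is the only one with a constant term, so a cusp form has no
  component along it; hence the shift \<open>Suc j\<close>.\<close>

lemma cusp_basis:
  assumes ws: "weight_split \<alpha> \<beta>" and k: "even k"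
  defines "v \<equiv> (\<lambda>j. uhp_fun (cfps (gbasis \<alpha> \<beta> k (Suc j))))"
  shows "basis_list (cusp_forms k) (map v [0..<mdim k - 1])"
    and "inj_on v {..<mdim k - 1}"
proof -
  define N where "N = mdim k - 1"
  have SucN: "Suc j < mdim k" if "j < N" for j using that by (auto simp: N_def)
  have mf: "cfps (gbasis \<alpha> \<beta> k (Suc j)) \<in> mod_forms k" if "j < N" for j
    by (rule gbasis_mod_form[OF ws k SucN[OF that]])
  have lin: "(\<Sum>j<N. (\<lambda>z. c j * v j z)) = uhp_fun (\<Sum>j<N. fps_const (c j) * cfps (gbasis \<alpha> \<beta> k (Suc j)))" for c
    unfolding v_def by (rule uhp_fun_lincomb[symmetric]) (use mf in auto)
  have ind: "c i = 0" if c: "(\<Sum>j<N. (\<lambda>z. c j * v j z)) = 0" and i: "i < N" for c i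
  proof -
    have "uhp_fun (\<Sum>j<N. fps_const (c j) * cfps (gbasis \<alpha> \<beta> k (Suc j))) = uhp_fun 0"
      using c unfolding lin by (auto simp: fun_eq_iff uhp_fun_def)
    then have "(\<Sum>j<N. fps_const (c j) * cfps (gbasis \<alpha> \<beta> k (Suc j))) = 0"
      by (rule uhp_fun_inject[rotated -1]) (use mf in \<open>auto intro!: conv_disc_sum conv_disc_mult\<close>)
    then have z: "(\<Sum>j<Suc N. fps_const (case_nat 0 c j) * cfps (gbasis \<alpha> \<beta> k j)) = 0"
      by (simp add: sum.lessThan_Suc_shift del: sum.lessThan_Suc)
    have "0 dvd case_nat 0 c (Suc i)"
    proof (rule unitriangular_dvd[where N = "Suc N" and F = "\<lambda>j. cfps (gbasis \<alpha> \<beta> k j)"])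
      show "0 dvd fps_nth (\<Sum>j<Suc N. fps_const (case_nat 0 c j) * cfps (gbasis \<alpha> \<beta> k j)) n" for n
        unfolding z by simp
    qed (use i in \<open>simp_all add: gbasis_nth\<close>)
    then show ?thesis by simp
  qed
  show inj: "inj_on v {..<mdim k - 1}"
    unfolding N_def[symmetric]
  proof (rule linorder_inj_onI)
    fix i j assume ij: "i < j" "i \<in> {..<N}" "j \<in> {..<N}"
    show "v i \<noteq> v j"
    proof
      assume "v i = v j"
      then have "cfps (gbasis \<alpha> \<beta> k (Suc i)) = cfps (gbasis \<alpha> \<beta> k (Suc j))"
        unfolding v_def by (rule uhp_fun_inject[rotated -1]) (use mf[of i] mf[of j] ij in auto)
      then have "fps_nth (gbasis \<alpha> \<beta> k (Suc i)) (Suc i) = fps_nth (gbasis \<alpha> \<beta> k (Suc j)) (Suc i)" by simp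
      with ij show False by (simp add: gbasis_nth)
    qed
  qed auto
  have set: "set (map v [0..<mdim k - 1]) = v ` {..<N}" by (auto simp: N_def)
  have sum: "(\<Sum>x\<in>v ` {..<N}. (\<lambda>z. u x * x z)) = (\<Sum>j<N. (\<lambda>z. u (v j) * v j z))" for u
    using inj by (simp add: sum.reindex N_def)
  have indep: "cfun.independent (v ` {..<N})"
    unfolding cfun.dependent_finite[OF finite_imageI[OF finite_lessThan]] sum
  proof
    assume "\<exists>u. (\<exists>x\<in>v ` {..<N}. u x \<noteq> 0) \<and> (\<Sum>j<N. (\<lambda>z. u (v j) * v j z)) = 0"
    then obtain u i where "i < N" "u (v i) \<noteq> 0" "(\<Sum>j<N. (\<lambda>z. u (v j) * v j z)) = 0" by blast
    with ind[of "\<lambda>j. u (v j)" i] show False by simp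
  qed
  have "cfun.span (v ` {..<N}) = cusp_forms k"
  proof (intro equalityI subsetI)
    fix f assume "f \<in> cfun.span (v ` {..<N})"
    then obtain u where "f = (\<Sum>j<N. (\<lambda>z. u (v j) * v j z))"
      unfolding cfun.span_finite[OF finite_imageI[OF finite_lessThan]] sum by blast
    then have "f = uhp_fun (\<Sum>j<N. fps_const (u (v j)) * cfps (gbasis \<alpha> \<beta> k (Suc j)))" unfolding lin .
    moreover have "(\<Sum>j<N. fps_const (u (v j)) * cfps (gbasis \<alpha> \<beta> k (Suc j))) \<in> mod_forms k"
      using mf by (auto intro!: mod_forms_sum mod_forms_scale)
    ultimately show "f \<in> cusp_forms k"
      unfolding cusp_forms_eq[OF k] by (auto simp: fps_sum_nth gbasis_nth)
  next
    fix f assume "f \<in> cusp_forms k"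
    then obtain A where A: "A \<in> mod_forms k" "fps_nth A 0 = 0" "f = uhp_fun A"
      unfolding cusp_forms_eq[OF k] by auto
    obtain c where c: "A = (\<Sum>j<mdim k. fps_const (c j) * cfps (gbasis \<alpha> \<beta> k j))"
      using mod_form_expansion[OF ws k A(1)] by blast
    have "A = (\<Sum>j<N. fps_const (c (Suc j)) * cfps (gbasis \<alpha> \<beta> k (Suc j)))"
    proof (cases "mdim k = 0")
      case True
      then have "N = 0" by (simp add: N_def)
      with True c show ?thesis by (simp only: lessThan_0 sum.empty)
    next
      case False
      then have m: "mdim k = Suc N" by (simp add: N_def)
      have c': "A = fps_const (c 0) * cfps (gbasis \<alpha> \<beta> k 0) + (\<Sum>j<N. fps_const (c (Suc j)) * cfps (gbasis \<alpha> \<beta> k (Suc j)))"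
        using c unfolding m by (simp only: sum.lessThan_Suc_shift)
      have "fps_nth A 0 = c 0" by (subst c') (simp add: gbasis_nth fps_sum_nth)
      with A(2) have "c 0 = 0" by simp
      with c' show ?thesis by simp
    qed
    then have "f = (\<Sum>j<N. (\<lambda>z. c (Suc j) * v j z))"
      unfolding A(3) lin by (rule arg_cong)
    also have "\<dots> \<in> cfun.span (v ` {..<N})"
      by (rule cfun.span_sum, rule cfun.span_scale, rule cfun.span_base) simp
    finally show "f \<in> cfun.span (v ` {..<N})" .
  qed
  with indep inj show "basis_list (cusp_forms k) (map v [0..<mdim k - 1])"
    unfolding basis_list_def set by (simp add: distinct_map N_def lessThan_atLeast0)
qed

lemma cusp_dim_eq:
  assumes "weight_split \<alpha> \<beta>" "even k"
  shows "cusp_dim k = mdim k - 1"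
proof -
  let ?bs = "map (\<lambda>j. uhp_fun (cfps (gbasis \<alpha> \<beta> k (Suc j)))) [0..<mdim k - 1]"
  have b: "basis_list (cusp_forms k) ?bs" by (rule cusp_basis(1)[OF assms])
  then have "cfun.span (set ?bs) = cusp_forms k" "cfun.independent (set ?bs)"
    unfolding basis_list_def by blast+
  moreover from this(1) have "cfun.span (set ?bs) = cfun.span (cusp_forms k)" using cfun.span_span by metis
  ultimately have "cusp_dim k = card (set ?bs)"
    unfolding cusp_dim_def by (intro cfun.dim_eq_card)
  also have "\<dots> = length ?bs" by (rule distinct_card) (use b in \<open>simp add: basis_list_def\<close>)
  finally show ?thesis by simp
qed

lemma poly_cong_of_int:
  assumes "\<And>i. int m dvd coeff P i - coeff Q i"
  shows "poly_cong m (map_poly of_int P) (map_poly of_int Q)"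
proof -
  have "\<exists>c::int. complex_of_int (coeff P i) - of_int (coeff Q i) = of_nat m * of_int c" for i
  proof -
    obtain c where "coeff P i - coeff Q i = int m * c" using assms[of i] by blast
    then have "complex_of_int (coeff P i - coeff Q i) = of_int (int m * c)" by (rule arg_cong)
    then show ?thesis by auto
  qed
  then show ?thesis by (simp add: poly_cong_def coeff_map_poly)
qed

text \<open>A Hecke operator that is triangular modulo \<open>l\<close> has its diagonal as roots modulo \<open>l\<close>.\<close>
lemma hecke_poly_triangular:
  assumes ws: "weight_split \<alpha> \<beta>" and k: "even k" "k > 0" and p: "prime p"
    and tri: "\<And>j. j \<ge> 1 \<Longrightarrow> j < mdim k \<Longrightarrow> \<exists>c. [c j = e j] (mod int l) \<and>
        fps_cong l (hecke_fps p k (gbasis \<alpha> \<beta> k j)) (\<Sum>i<Suc j. fps_const (c i) * gbasis \<alpha> \<beta> k i)"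
  shows "poly_cong l (hecke_poly p k) (\<Prod>j = 1..cusp_dim k. [:- of_int (e j), 1:])"
proof -
  define N where "N = mdim k - 1"
  define g where "g = gbasis \<alpha> \<beta> k"
  define v where "v = (\<lambda>j. uhp_fun (cfps (g (Suc j))))"
  define bs where "bs = map v [0..<N]"
  have p0: "p > 0" using p prime_gt_0_nat by blast
  have basis: "basis_list (cusp_forms k) bs" and inj: "inj_on v {..<N}"
    using cusp_basis[OF ws k(1)] by (simp_all add: bs_def v_def N_def g_def)
  have SucN: "Suc j < mdim k" if "j < N" for j using that by (auto simp: N_def)
  have mf: "cfps (g j) \<in> mod_forms k" if "j < mdim k" for j
    unfolding g_def by (rule gbasis_mod_form[OF ws k(1) that])
  have "\<exists>m. hecke_fps p k (g (Suc j)) = (\<Sum>i<mdim k. fps_const (m i) * g i)" if "j < N" for j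
  proof -
    have "cfps (hecke_fps p k (g (Suc j))) \<in> mod_forms k"
      unfolding cfps_hecke_fps by (rule hecke_fps_mod_form[OF mf[OF SucN[OF that]] k p])
    from int_mod_form_expansion[OF ws k(1) this] show ?thesis unfolding g_def by metis
  qed
  then obtain m where m: "\<And>j. j < N \<Longrightarrow> hecke_fps p k (g (Suc j)) = (\<Sum>i<mdim k. fps_const (m j i) * g i)"
    by metis
  have m0: "m j 0 = 0" if "j < N" for j
  proof -
    have "fps_nth (hecke_fps p k (g (Suc j))) 0 = 0" using p0 by (simp add: hecke_fps_nth_0 g_def gbasis_nth)
    then have "(\<Sum>i<mdim k. m j i * fps_nth (g i) 0) = 0" unfolding m[OF that] by (simp add: fps_sum_nth)
    moreover have "(\<Sum>i<mdim k. m j i * fps_nth (g i) 0) = (\<Sum>i<mdim k. if i = 0 then m j 0 else 0)"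
      by (rule sum.cong) (auto simp: g_def gbasis_nth)
    ultimately show ?thesis using SucN[OF that] by simp
  qed
  have tri': "[m j (Suc i) = (if i = j then e (Suc j) else 0)] (mod int l)" if ij: "i < N" "j < N" "j \<le> i" for i j
  proof -
    obtain c where c: "[c (Suc j) = e (Suc j)] (mod int l)"
      "fps_cong l (hecke_fps p k (g (Suc j))) (\<Sum>i<Suc (Suc j). fps_const (c i) * g i)"
      using tri[of "Suc j"] SucN[OF ij(2)] unfolding g_def by auto
    define c' where "c' = (\<lambda>i. if i < Suc (Suc j) then c i else 0)"
    have "(\<Sum>i<Suc (Suc j). fps_const (c i) * g i) = (\<Sum>i<mdim k. fps_const (c' i) * g i)"
      using SucN[OF ij(2)] by (intro sum.mono_neutral_cong_left) (auto simp: c'_def)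
    with c(2) m[OF ij(2)] have "fps_cong l (\<Sum>i<mdim k. fps_const (m j i) * g i) (\<Sum>i<mdim k. fps_const (c' i) * g i)"
      by simp
    moreover have "(\<Sum>i<mdim k. fps_const (m j i - c' i) * g i) =
        (\<Sum>i<mdim k. fps_const (m j i) * g i) - (\<Sum>i<mdim k. fps_const (c' i) * g i)"
      by (simp only: fps_const_sub[symmetric] left_diff_distrib sum_subtractf)
    ultimately have "\<And>n. int l dvd fps_nth (\<Sum>i<mdim k. fps_const (m j i - c' i) * g i) n"
      by (simp only: fps_cong_def fps_const_dvd_iff)
    then have dvd: "int l dvd fps_nth (\<Sum>i<mdim k. fps_const (m j i - c' i) * g i) n" for n by blast
    have "int l dvd m j (Suc i) - c' (Suc i)"
      by (rule unitriangular_dvd[where N = "mdim k" and F = g and c = "\<lambda>i. m j i - c' i"])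
         (use SucN[OF ij(1)] dvd in \<open>simp_all add: g_def gbasis_nth\<close>)
    then have "[m j (Suc i) = c' (Suc i)] (mod int l)" by (simp add: cong_iff_dvd_diff)
    with c(1) ij(3) show ?thesis by (auto simp: c'_def intro: cong_trans)
  qed
  define M where "M = mat N N (\<lambda>(i, j). m j (Suc i))"
  \<comment> \<open>Above the diagonal \<open>M'\<close> copies \<open>M\<close>, so a congruence is
    required only on and below it, and that is \<open>tri'\<close>.\<close>
  define M' where "M' = mat N N (\<lambda>(i, j). if i = j then e (Suc j) else if i < j then m j (Suc i) else 0)"
  have cM: "M \<in> carrier_mat N N" "M' \<in> carrier_mat N N" by (simp_all add: M_def M'_def)
  have inV: "v j \<in> cusp_forms k" if "j < N" for j
    unfolding cusp_forms_eq[OF k(1)] v_def using mf[OF SucN[OF that]]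
    by (auto simp: g_def gbasis_nth intro!: imageI)
  have T: "hecke_op k p (v j) = (\<Sum>i<N. (\<lambda>z. of_int (m j (Suc i)) * v i z))" if "j < N" for j
  proof -
    have mN: "mdim k = Suc N" using SucN[OF that] by (simp add: N_def)
    have "hecke_op k p (v j) = uhp_fun (cfps (hecke_fps p k (g (Suc j))))"
      unfolding v_def cfps_hecke_fps by (rule hecke_op_uhp_fun[OF _ p k(2)]) (use mf[OF SucN[OF that]] in auto)
    also have "\<dots> = uhp_fun (\<Sum>i<N. fps_const (of_int (m j (Suc i))) * cfps (g (Suc i)))"
      unfolding m[OF that] mN cfps_sum by (simp add: sum.lessThan_Suc_shift m0[OF that] del: sum.lessThan_Suc)
    also have "\<dots> = (\<Sum>i<N. (\<lambda>z. of_int (m j (Suc i)) * v i z))"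
      unfolding v_def by (rule uhp_fun_lincomb) (use mf SucN in auto)
    finally show ?thesis .
  qed
  have "matrix_wrt bs (hecke_op k p) = map_mat of_int M"
  proof (rule eq_matI)
    fix i j assume "i < dim_row (map_mat of_int M)" "j < dim_col (map_mat of_int M)"
    then have ij: "i < N" "j < N" by (simp_all add: M_def)
    have "matrix_wrt bs (hecke_op k p) $$ (i, j) = cfun.representation (set bs) (hecke_op k p (v j)) (v i)"
      using ij by (simp add: matrix_wrt_def bs_def)
    also have "\<dots> = (\<Sum>l<N. of_int (m j (Suc l)) * cfun.representation (set bs) (v l) (v i))"
      unfolding T[OF ij(2)] by (rule representation_lincomb[OF basis]) (use inV in auto)
    also have "\<dots> = (\<Sum>l<N. of_int (m j (Suc l)) * (if l = i then 1 else 0))"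
    proof (rule sum.cong)
      fix l assume l: "l \<in> {..<N}"
      have "v l \<in> set bs" using l by (auto simp: bs_def)
      then show "of_int (m j (Suc l)) * cfun.representation (set bs) (v l) (v i) = of_int (m j (Suc l)) * (if l = i then 1 else 0)"
        using basis inj_onD[OF inj, of i l] l ij by (auto simp: cfun.representation_basis basis_list_def)
    qed simp
    also have "\<dots> = of_int (m j (Suc i))" using ij by (simp add: if_distrib cong: if_cong)
    finally show "matrix_wrt bs (hecke_op k p) $$ (i, j) = map_mat of_int M $$ (i, j)" using ij by (simp add: M_def)
  qed (simp_all add: matrix_wrt_def bs_def M_def)
  moreover have "hecke_poly p k = char_poly (matrix_wrt bs (hecke_op k p))"
    unfolding hecke_poly_def
  proof (rule charpoly_on_basis[OF basis _ hecke_op_linear])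
    fix x assume "x \<in> cusp_forms k"
    then obtain A where A: "A \<in> mod_forms k" "fps_nth A 0 = 0" "x = uhp_fun A"
      unfolding cusp_forms_eq[OF k(1)] by auto
    have "hecke_op k p x = uhp_fun (hecke_fps p k A)" unfolding A(3) by (rule hecke_op_uhp_fun[OF _ p k(2)]) (use A in auto)
    then show "hecke_op k p x \<in> cusp_forms k"
      unfolding cusp_forms_eq[OF k(1)] using hecke_fps_mod_form[OF A(1) k p] A(2) p0
      by (auto simp: hecke_fps_nth_0)
  qed
  ultimately have hp: "hecke_poly p k = map_poly of_int (char_poly M)"
    using of_int_hom.char_poly_hom[OF cM(1)] by simp
  have "upper_triangular M'" by (auto simp: M'_def)
  then have "char_poly M' = (\<Prod>a\<leftarrow>diag_mat M'. [:- a, 1:])"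
    by (rule char_poly_upper_triangular[OF cM(2)])
  also have "diag_mat M' = map (\<lambda>i. e (Suc i)) [0..<N]" by (simp add: diag_mat_def M'_def)
  also have "(\<Prod>a\<leftarrow>map (\<lambda>i. e (Suc i)) [0..<N]. [:- a, 1:]) = (\<Prod>i<N. [:- e (Suc i), 1:])"
    by (induction N) simp_all
  also have "\<dots> = (\<Prod>j = 1..N. [:- e j, 1:])"
    by (rule prod.reindex_bij_witness[where i = "\<lambda>j. j - 1" and j = Suc]) auto
  finally have "map_poly complex_of_int (char_poly M') = (\<Prod>j = 1..cusp_dim k. [:- of_int (e j), 1:])"
    by (simp add: of_int_poly_hom.hom_prod cusp_dim_eq[OF ws k(1)] N_def)
  moreover have "poly_cong l (map_poly of_int (char_poly M)) (map_poly of_int (char_poly M'))"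
  proof (rule poly_cong_of_int, rule char_poly_dvd_diff[OF cM])
    fix i j assume ij: "i < N" "j < N"
    show "int l dvd M $$ (i, j) - M' $$ (i, j)"
      using tri'[of i j] ij by (cases "i < j") (auto simp: M_def M'_def cong_iff_dvd_diff)
  qed
  ultimately show ?thesis by (simp add: hp)
qed

section \<open>The theta operator modulo \<open>l\<close>\<close>

definition evy :: "int fps \<Rightarrow> int poly \<Rightarrow> int fps" where
  "evy y P = poly (map_poly fps_const P) y"

lemma evy_0 [simp]: "evy y 0 = 0"
  by (simp add: evy_def)

lemma evy_pCons [simp]: "evy y (pCons a P) = fps_const a + y * evy y P"
  by (cases "a = 0 \<and> P = 0") (auto simp: evy_def map_poly_pCons)

lemma evy_1 [simp]: "evy y 1 = 1"
  by (simp add: one_pCons)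

lemma evy_add [simp]: "evy y (P + Q) = evy y P + evy y Q"
  by (induction P Q rule: poly_induct2) (simp_all add: algebra_simps flip: fps_const_add)

lemma evy_smult [simp]: "evy y (Polynomial.smult c P) = fps_const c * evy y P"
  by (induction P) (simp_all add: algebra_simps flip: fps_const_mult)

lemma evy_diff [simp]: "evy y (P - Q) = evy y P - evy y Q"
  using evy_add[of y "P - Q" Q] by (simp add: algebra_simps)

lemma evy_minus [simp]: "evy y (- P) = - evy y P"
  using evy_diff[of y 0 P] by simp

lemma evy_mult [simp]: "evy y (P * Q) = evy y P * evy y Q"
  by (induction P) (simp_all add: algebra_simps)

lemma evy_monom [simp]: "evy y (Polynomial.monom c n) = fps_const c * y ^ n"
  by (induction n) (simp_all add: monom_0 monom_Suc mult_ac)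

text \<open>\<open>A\<close> is congruent modulo \<open>l\<close> to a polynomial in \<open>y\<close> of degree less than \<open>m\<close>.\<close>
definition low_degree :: "nat \<Rightarrow> int fps \<Rightarrow> nat \<Rightarrow> int fps \<Rightarrow> bool" where
  "low_degree l y m A \<longleftrightarrow> (\<exists>P. (\<forall>i\<ge>m. coeff P i = 0) \<and> fps_cong l A (evy y P))"

lemma low_degree_cong: "fps_cong l A B \<Longrightarrow> low_degree l y m B \<Longrightarrow> low_degree l y m A"
  unfolding low_degree_def using fps_cong_trans by blast

lemma low_degree_add: "low_degree l y m A \<Longrightarrow> low_degree l y m B \<Longrightarrow> low_degree l y m (A + B)"
  unfolding low_degree_def
  by (elim exE conjE, rule_tac x = "P + Pa" in exI) (auto intro: fps_cong_add)

lemma low_degree_const_mult: "low_degree l y m A \<Longrightarrow> low_degree l y m (fps_const c * A)"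
  unfolding low_degree_def
  by (elim exE conjE, rule_tac x = "Polynomial.smult c P" in exI) (auto intro: fps_cong_mult)

lemma low_degree_diff: "low_degree l y m A \<Longrightarrow> low_degree l y m B \<Longrightarrow> low_degree l y m (A - B)"
  unfolding low_degree_def
  by (elim exE conjE, rule_tac x = "P - Pa" in exI) (auto intro: fps_cong_diff)

lemma low_degree_mono: "low_degree l y m A \<Longrightarrow> m \<le> n \<Longrightarrow> low_degree l y n A"
  unfolding low_degree_def by (meson order_trans)

lemma low_degree_power: "i < m \<Longrightarrow> low_degree l y m (y ^ i)"
  unfolding low_degree_def by (rule exI[of _ "Polynomial.monom 1 i"]) auto

lemma low_degree_0 [simp]: "low_degree l y m 0"
  unfolding low_degree_def by (rule exI[of _ 0]) auto

lemma low_degree_sum: "(\<And>i. i \<in> I \<Longrightarrow> low_degree l y m (f i)) \<Longrightarrow> low_degree l y m (\<Sum>i\<in>I. f i)"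
  by (induction I rule: infinite_finite_induct) (auto intro: low_degree_add)

text \<open>The series y is transcendental modulo l. Write y = 1 + q u with u(0) prime to l and
  divide P by X - 1: the constant coefficient shows that l divides P(1), and cancelling q u leaves
  the same situation for the quotient, whose degree is lower by one.\<close>

lemma evy_cong_0_imp_dvd:
  assumes l: "prime l" and y: "fps_nth y 0 = 1" "\<not> int l dvd fps_nth y 1"
    and P: "\<And>i. i > m \<Longrightarrow> coeff P i = 0" "fps_cong l (evy y P) 0"
  shows "int l dvd coeff P m"
  using P
proof (induction m arbitrary: P)
  case 0
  have "P = [:coeff P 0:]" using 0(1) by (auto simp: poly_eq_iff coeff_pCons split: nat.splits)
  then have "evy y P = fps_const (coeff P 0)" by (metis evy_0 evy_pCons add_0_right mult_zero_right)
  moreover have "\<forall>n. int l dvd fps_nth (evy y P - 0) n"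
    using 0(2) unfolding fps_cong_def fps_const_dvd_iff .
  then have "int l dvd fps_nth (evy y P - 0) 0" by blast
  ultimately show ?case by simp
next
  case (Suc m)
  define Q where "Q = synthetic_div P 1"
  have PQ: "P = [:-1, 1:] * Q + [:poly P 1:]" unfolding Q_def using synthetic_div_correct'[of 1 P] by simp
  have "degree P \<le> Suc m" using Suc.prems(1) by (intro degree_le) auto
  then have "degree Q \<le> m" unfolding Q_def degree_synthetic_div by simp
  then have Q0: "coeff Q i = 0" if "i > m" for i using that by (simp add: coeff_eq_0)
  have ev: "evy y P = (y - 1) * evy y Q + fps_const (poly P 1)"
    by (subst PQ) (simp add: algebra_simps flip: fps_const_neg)
  have dvd: "int l dvd fps_nth (evy y P) n" for n
    using Suc.prems(2) by (simp add: fps_cong_def fps_const_dvd_iff)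
  have p1: "int l dvd poly P 1" using dvd[of 0] unfolding ev by (simp add: y)
  have yX: "y - 1 = fps_X * fps_shift 1 (y - 1)" by (simp add: fps_eq_iff y)
  define u where "u = fps_shift 1 (y - 1)"
  have u0: "fps_nth u 0 = fps_nth y 1" by (simp add: u_def)
  have uE: "int l dvd fps_nth (u * evy y Q) n" for n
  proof -
    have "fps_nth ((y - 1) * evy y Q) (Suc n) = fps_nth (u * evy y Q) n"
      unfolding u_def by (subst yX) (simp add: mult.assoc)
    then show ?thesis using dvd[of "Suc n"] p1 unfolding ev by simp
  qed
  have E: "int l dvd fps_nth (evy y Q) n" for n
  proof (induction n rule: less_induct)
    case (less n)
    have "fps_nth (u * evy y Q) n = fps_nth u 0 * fps_nth (evy y Q) n + (\<Sum>i=1..n. fps_nth u i * fps_nth (evy y Q) (n - i))"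
      by (simp add: fps_mult_nth sum.atLeast_Suc_atMost)
    moreover have "int l dvd (\<Sum>i=1..n. fps_nth u i * fps_nth (evy y Q) (n - i))"
      by (rule dvd_sum) (use less in auto)
    ultimately have "int l dvd fps_nth u 0 * fps_nth (evy y Q) n" using uE[of n] by (simp add: dvd_add_left_iff)
    then show ?case using l y(2) unfolding u0 by (simp add: prime_dvd_mult_iff)
  qed
  then have "fps_cong l (evy y Q) 0" by (simp add: fps_cong_def fps_const_dvd_iff)
  from Suc.IH[OF Q0 this] have "int l dvd coeff Q m" .
  moreover have "coeff P (Suc m) = coeff Q m - coeff Q (Suc m)" by (subst PQ) simp
  ultimately show ?case using Q0[of "Suc m"] by simp
qed

lemma low_degree_top_imp_dvd:
  assumes l: "prime l" and y: "fps_nth y 0 = 1" "\<not> int l dvd fps_nth y 1"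
    and low: "low_degree l y m (fps_const c * y ^ m)"
  shows "int l dvd c"
proof -
  obtain P where P: "\<forall>i\<ge>m. coeff P i = 0" "fps_cong l (fps_const c * y ^ m) (evy y P)"
    using low unfolding low_degree_def by blast
  have "fps_cong l (fps_const c * y ^ m - evy y P) (evy y P - evy y P)"
    by (rule fps_cong_diff[OF P(2) fps_cong_refl])
  then have "fps_cong l (evy y (Polynomial.monom c m - P)) 0" by simp
  then have "int l dvd coeff (Polynomial.monom c m - P) m"
    by (intro evy_cong_0_imp_dvd[OF l y]) (use P in auto)
  then show ?thesis using P by simp
qed

definition theta :: "int fps \<Rightarrow> int fps" where
  "theta A = fps_X * fps_deriv A"

lemma theta_nth [simp]: "fps_nth (theta A) n = int n * fps_nth A n"
  by (cases n) (simp_all add: theta_def)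

lemma theta_simps:
  "theta (A + B) = theta A + theta B" "theta (A - B) = theta A - theta B"
  "theta (fps_const c) = 0" "theta 0 = 0" "theta (A * B) = theta A * B + A * theta B" "theta 1 = 0"
  by (simp_all add: theta_def algebra_simps)

lemma theta_power: "theta (A ^ n) = of_nat n * A ^ (n - 1) * theta A"
  by (simp add: theta_def fps_deriv_power fps_of_nat mult_ac)

lemma fps_cong_theta: "fps_cong l A B \<Longrightarrow> fps_cong l (theta A) (theta B)"
  by (auto simp: fps_cong_iff intro: cong_mult)

lemma theta_evy: "theta (evy y P) = evy y (pderiv P) * theta y"
  by (induction P) (simp_all add: theta_simps pderiv_pCons algebra_simps)

text \<open>Differentiation with respect to y lowers the degree by 1, and theta y has degree s + 1
  in y.\<close>

lemma low_degree_theta: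
  assumes th: "fps_cong l (theta y) (fps_const (-2) * (y ^ Suc s - 1))"
    and low: "low_degree l y m A"
  shows "low_degree l y (m + s) (theta A)"
proof -
  obtain P where P: "\<forall>i\<ge>m. coeff P i = 0" "fps_cong l A (evy y P)"
    using low unfolding low_degree_def by blast
  define Q where "Q = pderiv P * (Polynomial.smult (-2) (Polynomial.monom 1 (Suc s) - 1))"
  have "fps_cong l (theta A) (theta (evy y P))" by (rule fps_cong_theta[OF P(2)])
  also have "fps_cong l (theta (evy y P)) (evy y (pderiv P) * (fps_const (-2) * (y ^ Suc s - 1)))"
    unfolding theta_evy by (intro fps_cong_mult fps_cong_refl th)
  also have "evy y (pderiv P) * (fps_const (-2) * (y ^ Suc s - 1)) = evy y Q"
    by (simp add: Q_def flip: fps_const_neg)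
  finally have "fps_cong l (theta A) (evy y Q)" .
  moreover have "coeff Q i = 0" if "i \<ge> m + s" for i
  proof -
    have "Q = Polynomial.smult (-2) (Polynomial.monom 1 (Suc s) * pderiv P) + Polynomial.smult 2 (pderiv P)"
      by (simp add: Q_def algebra_simps smult_diff_right smult_add_left[symmetric])
    moreover have "coeff (pderiv P) j = 0" if "Suc j \<ge> m" for j using P(1) that by (simp add: coeff_pderiv)
    ultimately show ?thesis using that by (auto simp: coeff_monom_mult)
  qed
  ultimately show ?thesis unfolding low_degree_def by blast
qed

section \<open>Frobenius and Fermat congruences, and their effect on Hecke operators\<close>

lemma fps_cong_add_power:
  assumes l: "prime l"
  shows "fps_cong l ((A + B) ^ l) (A ^ l + B ^ l)"
proof -
  have l0: "l > 0" using l prime_gt_0_nat by blast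
  have "(A + B) ^ l = (\<Sum>k\<le>l. of_nat (l choose k) * A ^ k * B ^ (l - k))" by (rule binomial_ring)
  also have "fps_cong l \<dots> (\<Sum>k\<le>l. if k = 0 then B ^ l else if k = l then A ^ l else 0)"
  proof (rule fps_cong_sum)
    fix k assume k: "k \<in> {..l}"
    show "fps_cong l (of_nat (l choose k) * A ^ k * B ^ (l - k)) (if k = 0 then B ^ l else if k = l then A ^ l else 0)"
    proof (cases "k = 0 \<or> k = l")
      case False
      then have "l dvd (l choose k)" using k l by (intro dvd_choose_prime) (auto simp: prime_gt_0_nat)
      then have "fps_const (int l) dvd of_nat (l choose k)"
        by (metis fps_of_nat of_nat_dvd_iff fps_const_mult dvd_def of_nat_mult)
      then show ?thesis using False unfolding fps_cong_def by (simp add: dvd_mult2)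
    qed auto
  qed
  also have "(\<Sum>k\<le>l. if k = 0 then B ^ l else if k = l then A ^ l else 0) = A ^ l + B ^ l"
  proof -
    have "(\<Sum>k\<le>l. if k = 0 then B ^ l else if k = l then A ^ l else 0) =
          (\<Sum>k\<in>{0, l}. if k = 0 then B ^ l else if k = l then A ^ l else 0)"
      by (rule sum.mono_neutral_right) auto
    then show ?thesis using l0 by (simp add: add.commute)
  qed
  finally show ?thesis .
qed

lemma fermat_nat: "prime l \<Longrightarrow> [a ^ l = a] (mod l)"
proof (induction a)
  case 0
  then show ?case using prime_gt_0_nat[of l] by (simp add: power_0_left)
next
  case (Suc a)
  have "fps_cong l ((fps_const (int a) + fps_const 1) ^ l) (fps_const (int a) ^ l + fps_const 1 ^ l)"
    by (rule fps_cong_add_power[OF Suc.prems])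
  then have "[fps_nth ((fps_const (int a) + fps_const 1) ^ l) 0 = fps_nth (fps_const (int a) ^ l + fps_const 1 ^ l) 0] (mod int l)"
    unfolding fps_cong_iff by (rule spec)
  then have "[(int a + 1) ^ l = int a ^ l + 1] (mod int l)"
    by (simp only: fps_const_power fps_const_add fps_nth_fps_const simp_thms if_True power_one)
  then have "[int (Suc a ^ l) = int (a ^ l + 1)] (mod int l)" by (simp add: add.commute)
  then have "[Suc a ^ l = a ^ l + 1] (mod l)" by (simp only: cong_int_iff)
  also have "[a ^ l + 1 = a + 1] (mod l)" by (intro cong_add cong_refl Suc.IH Suc.prems)
  finally show ?case by simp
qed

lemma fermat_little: "prime l \<Longrightarrow> \<not> l dvd a \<Longrightarrow> [a ^ (l - 1) = 1] (mod l)"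
proof -
  assume l: "prime l" and a: "\<not> l dvd a"
  have "a * a ^ (l - 1) = a ^ l" using prime_gt_0_nat[OF l] by (cases l) simp_all
  then have "[a * a ^ (l - 1) = a * 1] (mod l)" using fermat_nat[OF l, of a] by simp
  moreover have "coprime a l" using prime_imp_coprime[OF l a] by (simp only: coprime_commute)
  ultimately show ?thesis by (simp only: cong_mult_lcancel_nat)
qed

lemma fermat_int: "prime l \<Longrightarrow> [a ^ l = a] (mod int l)"
proof -
  assume l: "prime l"
  define b where "b = nat (a mod int l)"
  have l0: "l > 0" using l prime_gt_0_nat by blast
  have ab: "[a = int b] (mod int l)" using l0 by (simp add: b_def cong_def)
  have "[a ^ l = int b ^ l] (mod int l)" by (rule cong_pow[OF ab])
  also have "int b ^ l = int (b ^ l)" by simp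
  also have "[int (b ^ l) = int b] (mod int l)" using fermat_nat[OF l, of b] by (simp only: cong_int_iff)
  also have "[int b = a] (mod int l)" by (rule cong_sym[OF ab])
  finally show ?thesis .
qed

text \<open>Coefficients are split off one at a time, using additivity of l-th powers and a^l = a
  modulo l. After n + 1 stages the remaining tail no longer touches coefficient n.\<close>

lemma fps_frobenius:
  assumes l: "prime l"
  shows "fps_cong l (A ^ l) (A oo fps_X ^ l)"
proof -
  have l0: "l > 0" using l prime_gt_0_nat by blast
  have step: "fps_cong l (A ^ l) ((fps_cutoff N A oo fps_X ^ l) + fps_X ^ (N * l) * fps_shift N A ^ l)" for N
  proof (induction N)
    case (Suc N)
    define a where "a = fps_nth A N"
    have sh: "fps_shift N A = fps_const a + fps_X * fps_shift (Suc N) A"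
      by (auto simp: fps_eq_iff a_def)
    have "fps_cong l (fps_shift N A ^ l) (fps_const a ^ l + (fps_X * fps_shift (Suc N) A) ^ l)"
      unfolding sh by (rule fps_cong_add_power[OF l])
    also have "fps_cong l \<dots> (fps_const a + (fps_X * fps_shift (Suc N) A) ^ l)"
      by (intro fps_cong_add fps_cong_refl) (simp add: fps_const_power fps_cong_const fermat_int[OF l])
    finally have 1: "fps_cong l (fps_shift N A ^ l) (fps_const a + fps_X ^ l * fps_shift (Suc N) A ^ l)"
      by (simp add: power_mult_distrib)
    have cut: "fps_cutoff (Suc N) A = fps_cutoff N A + fps_const a * fps_X ^ N"
      by (auto simp: fps_eq_iff fps_cutoff_def a_def dest: less_antisym)
    have cmp: "fps_cutoff (Suc N) A oo fps_X ^ l = (fps_cutoff N A oo fps_X ^ l) + fps_X ^ (N * l) * fps_const a"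
      unfolding cut fps_compose_add_distrib using l0
      by (simp add: fps_eq_iff fps_nth_compose_X_power) (auto simp: mult.commute)
    from Suc.IH have "fps_cong l (A ^ l) ((fps_cutoff N A oo fps_X ^ l) + fps_X ^ (N * l) * fps_shift N A ^ l)" .
    also have "fps_cong l \<dots> ((fps_cutoff N A oo fps_X ^ l) + fps_X ^ (N * l) * (fps_const a + fps_X ^ l * fps_shift (Suc N) A ^ l))"
      by (intro fps_cong_add fps_cong_mult fps_cong_refl 1)
    also have "\<dots> = (fps_cutoff (Suc N) A oo fps_X ^ l) + fps_X ^ (Suc N * l) * fps_shift (Suc N) A ^ l"
      unfolding cmp by (simp add: algebra_simps power_add)
    finally show ?case .
  qed simp
  show ?thesis
    unfolding fps_cong_iff
  proof
    fix n
    have "[fps_nth (A ^ l) n = fps_nth ((fps_cutoff (Suc n) A oo fps_X ^ l) + fps_X ^ (Suc n * l) * fps_shift (Suc n) A ^ l) n] (mod int l)"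
      using step[of "Suc n"] unfolding fps_cong_iff by blast
    moreover have "n < Suc n * l" using l0 by (metis Suc_le_eq le_imp_less_Suc less_le_trans mult_le_mono2 nat_mult_1_right lessI One_nat_def)
    then have "fps_nth (fps_X ^ (Suc n * l) * fps_shift (Suc n) A ^ l) n = 0" by (simp add: fps_X_power_mult_nth)
    moreover have "fps_nth (fps_cutoff (Suc n) A oo fps_X ^ l) n = fps_nth (A oo fps_X ^ l) n"
      using l0 by (auto simp: fps_nth_compose_X_power fps_cutoff_def intro: le_less_trans[OF div_le_dividend])
    ultimately show "[fps_nth (A ^ l) n = fps_nth (A oo fps_X ^ l) n] (mod int l)" by simp
  qed
qed

text \<open>For distinct primes p and l, divisibility by l is the same for n, for p n and, where it
  is integral, for n / p. So the identity is exact and not only modulo l.\<close>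

lemma hecke_fps_frobenius:
  assumes "prime l" "prime p" "p \<noteq> l"
  shows "hecke_fps p k (A oo fps_X ^ l) = hecke_fps p k A oo fps_X ^ l"
proof -
  have l0: "l > 0" "p > 0" using assms prime_gt_0_nat by blast+
  have nd: "\<not> l dvd p" "\<not> p dvd l" using assms primes_dvd_imp_eq by blast+
  have "fps_nth (hecke_fps p k (A oo fps_X ^ l)) n = fps_nth (hecke_fps p k A oo fps_X ^ l) n" for n
  proof (cases "l dvd n")
    case True
    then obtain m where n: "n = l * m" by blast
    have "p dvd n \<longleftrightarrow> p dvd m" using nd assms by (simp add: n prime_dvd_mult_iff)
    then show ?thesis using l0 assms
      by (auto simp: n hecke_fps_def fps_nth_compose_X_power mult.left_commute[of p l] div_mult_swap[symmetric])
  next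
    case False
    then have "\<not> l dvd p * n" "p dvd n \<Longrightarrow> \<not> l dvd n div p"
      using nd assms by (auto simp: prime_dvd_mult_iff elim!: dvdE)
    with False show ?thesis by (simp add: hecke_fps_def fps_nth_compose_X_power)
  qed
  then show ?thesis by (simp add: fps_eq_iff)
qed

text \<open>The coefficient at p n gains the factor p n. The one at n / p gains n / p, which the
  passage from p^(k - 1) to p^(k + 1) turns into p n as well.\<close>

lemma hecke_fps_theta:
  assumes "k > 0" "p > 0"
  shows "hecke_fps p (k + 2) (theta A) = fps_const (int p) * theta (hecke_fps p k A)"
proof -
  obtain m where m: "k = Suc m" using assms by (cases k) auto
  have "fps_nth (hecke_fps p (k + 2) (theta A)) n = fps_nth (fps_const (int p) * theta (hecke_fps p k A)) n" for n
    by (cases "p dvd n") (auto simp: hecke_fps_def m algebra_simps elim!: dvdE)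
  then show ?thesis by (simp add: fps_eq_iff)
qed

lemma hecke_fps_cong: "fps_cong l A B \<Longrightarrow> fps_cong l (hecke_fps p k A) (hecke_fps p k B)"
  by (auto simp: fps_cong_iff hecke_fps_def intro!: cong_add cong_mult)

lemma power_cong_exponent:
  assumes l: "prime l" "\<not> l dvd p" and k: "[k = k'] (mod l - 1)" "k > 0" "k' > 0"
  shows "[p ^ (k - 1) = p ^ (k' - 1)] (mod l)"
proof -
  have main: "[p ^ (a - 1) = p ^ (b - 1)] (mod l)" if ab: "[a = b] (mod l - 1)" "a > 0" "a \<le> b" for a b :: nat
  proof -
    obtain t where t: "b = a + (l - 1) * t"
      using ab by (metis cong_iff_lin_nat cong_le_nat mult.commute cong_sym add.commute)
    have "p ^ (b - 1) = p ^ (a - 1) * (p ^ (l - 1)) ^ t"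
      using ab(2) by (simp add: t power_mult[symmetric] power_add[symmetric])
    moreover have "[p ^ (a - 1) * (p ^ (l - 1)) ^ t = p ^ (a - 1) * 1 ^ t] (mod l)"
      by (intro cong_mult cong_pow cong_refl fermat_little l)
    ultimately show ?thesis by (simp add: cong_sym)
  qed
  show ?thesis
    using main[of k k'] main[of k' k] k by (cases "k \<le> k'") (auto intro: cong_sym)
qed

text \<open>By Fermat, the residue of p^(k - 1) has period l - 1 in k.\<close>

lemma hecke_fps_weight_cong:
  assumes "prime l" "\<not> l dvd p" "[k = k'] (mod l - 1)" "k > 0" "k' > 0"
  shows "fps_cong l (hecke_fps p k A) (hecke_fps p k' A)"
proof -
  have "[int (p ^ (k - 1)) = int (p ^ (k' - 1))] (mod int l)"
    using power_cong_exponent[OF assms] by (simp only: cong_int_iff)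
  then show ?thesis
    unfolding fps_cong_iff hecke_fps_def by (auto intro!: cong_add cong_mult)
qed

section \<open>Hecke operators modulo 5 and 7\<close>

lemma low_degree_power_mult: "low_degree l y m A \<Longrightarrow> low_degree l y (m + n) (y ^ n * A)"
proof -
  assume "low_degree l y m A"
  then obtain P where P: "\<forall>i\<ge>m. coeff P i = 0" "fps_cong l A (evy y P)"
    unfolding low_degree_def by blast
  have "fps_cong l (y ^ n * A) (evy y (Polynomial.monom 1 n * P))"
    using P(2) by (auto intro: fps_cong_mult)
  moreover have "\<forall>i\<ge>m + n. coeff (Polynomial.monom 1 n * P) i = 0"
    using P(1) by (auto simp: coeff_monom_mult)
  ultimately show ?thesis unfolding low_degree_def by blast
qed

lemma low_degree_1: "m > 0 \<Longrightarrow> low_degree l y m (fps_const c)"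
  using low_degree_const_mult[OF low_degree_power[of 0 m l y], of c] by simp

lemma fps_cong_compose_power: "l > 0 \<Longrightarrow> fps_cong m A B \<Longrightarrow> fps_cong m (A oo fps_X ^ l) (B oo fps_X ^ l)"
  by (auto simp: fps_cong_iff fps_nth_compose_X_power)

lemma evy_eq_sum:
  assumes "\<forall>i\<ge>m. coeff P i = 0"
  shows "evy y P = (\<Sum>i<m. fps_const (coeff P i) * y ^ i)"
proof -
  have "P = (\<Sum>i<m. Polynomial.monom (coeff P i) i)"
    using assms by (auto simp: poly_eq_iff coeff_sum if_distrib not_less cong: if_cong)
  moreover have "evy y (\<Sum>i<m. f i) = (\<Sum>i<m. evy y (f i))" for f
    by (induction m) simp_all
  ultimately show ?thesis by (metis (no_types, lifting) evy_monom sum.cong)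
qed

lemma low_degree_frobenius:
  assumes l: "prime l" and low: "low_degree l y m A"
  shows "low_degree l y (l * m) (A oo fps_X ^ l)"
proof -
  have l0: "l > 0" using l prime_gt_0_nat by blast
  obtain P where P: "\<forall>i\<ge>m. coeff P i = 0" "fps_cong l A (evy y P)"
    using low unfolding low_degree_def by blast
  have "fps_cong l (A oo fps_X ^ l) (evy y P oo fps_X ^ l)"
    by (rule fps_cong_compose_power[OF l0 P(2)])
  also have "evy y P oo fps_X ^ l = (\<Sum>i<m. (fps_const (coeff P i) * y ^ i) oo fps_X ^ l)"
    unfolding evy_eq_sum[OF P(1)] by (simp only: fps_compose_sum_distrib)
  also have "fps_cong l \<dots> (\<Sum>i<m. fps_const (coeff P i) * y ^ (l * i))"
  proof (rule fps_cong_sum)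
    fix i
    have "(fps_const (coeff P i) * y ^ i) oo fps_X ^ l = fps_const (coeff P i) * (y ^ i oo fps_X ^ l)"
      using l0 by (simp add: fps_compose_mult_distrib)
    also have "fps_cong l \<dots> (fps_const (coeff P i) * (y ^ i) ^ l)"
      by (intro fps_cong_mult fps_cong_refl fps_cong_sym[OF fps_frobenius[OF l]])
    finally show "fps_cong l ((fps_const (coeff P i) * y ^ i) oo fps_X ^ l) (fps_const (coeff P i) * y ^ (l * i))"
      by (simp add: power_mult mult.commute)
  qed
  finally have "fps_cong l (A oo fps_X ^ l) (\<Sum>i<m. fps_const (coeff P i) * y ^ (l * i))" .
  then show ?thesis
    by (rule low_degree_cong)
       (use l0 in \<open>auto intro!: low_degree_sum low_degree_const_mult low_degree_power\<close>)
qed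

lemma hecke_fps_const: "p > 0 \<Longrightarrow> \<exists>d. hecke_fps p k (fps_const c) = fps_const d"
  by (rule exI[of _ "(1 + of_nat p ^ (k - 1)) * c"])
     (auto simp: fps_eq_iff hecke_fps_def algebra_simps elim!: dvdE)

text \<open>
  Modulo \<open>l\<close> the ring of modular forms is \<open>\<int>/l[y]\<close>, where \<open>y\<close> is one of \<open>E\<^sub>4\<close>, \<open>E\<^sub>6\<close> and the other
  one is \<open>1\<close>. Then \<open>T\<^sub>p\<close> is triangular on the powers of \<open>y\<close>.
\<close>
locale hecke_mod =
  fixes l p s w :: nat and y :: "int fps" and \<alpha> \<beta> a :: "nat \<Rightarrow> nat" and \<kappa> :: int
  assumes l: "prime l" "l \<noteq> 2" and p: "prime p" "p \<noteq> l"
    and y0: "fps_nth y 0 = 1" and y1: "\<not> int l dvd fps_nth y 1"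
    and th: "fps_cong l (theta y) (fps_const (-2) * (y ^ Suc s - 1))"
    and w: "even w" "w > 2" "w * Suc s = 12" "[w * s = 2] (mod l - 1)" "[12 = 0] (mod l - 1)"
    and ymf: "cfps y \<in> mod_forms w"
    and ws: "weight_split \<alpha> \<beta>"
    and gb: "\<And>k j. even k \<Longrightarrow> j < mdim k \<Longrightarrow> fps_cong l (gbasis \<alpha> \<beta> k j) (y ^ a k * delta ^ j)"
    and \<kappa>: "fps_cong l delta (fps_const \<kappa> * (y ^ Suc s - 1))"
    and a: "\<And>k. a k \<le> s" "\<And>k. even k \<Longrightarrow> [k = w * a k] (mod l - 1)"
       "\<And>j r. r \<le> s \<Longrightarrow> a (12 * j + w * r) = r"
       "\<And>k j. even k \<Longrightarrow> j < mdim k \<Longrightarrow> 12 * j + w * a k \<le> k"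
begin

lemma l0: "l > 0" and p0: "p > 0" and lp: "\<not> l dvd p"
  using l(1) p prime_gt_0_nat primes_dvd_imp_eq by blast+

text \<open>Up to the constant \<open>\<kappa> ^ j\<close> this is basis element j modulo l when r =
  \<open>a k\<close>, because Delta is a multiple of y^(s + 1) - 1; w (s + 1) = 12 compares the
  weights. Its degree (s + 1) j + r is the exponent at which \<open>eig\<close> below has to be
  evaluated.\<close>

definition Y :: "nat \<Rightarrow> nat \<Rightarrow> int fps" where
  "Y r j = y ^ r * (y ^ Suc s - 1) ^ j"

lemma low_Y: "low_degree l y (Suc s * j + r) (Y r j - y ^ (Suc s * j + r))"
proof (induction j)
  case (Suc j)
  let ?n = "Suc s * j + r"
  have "Y r (Suc j) - y ^ (?n + Suc s) = y ^ Suc s * (Y r j - y ^ ?n) - ((Y r j - y ^ ?n) + y ^ ?n)"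
    by (simp add: Y_def algebra_simps power_add)
  moreover have "low_degree l y (?n + Suc s) (y ^ Suc s * (Y r j - y ^ ?n))"
    by (rule low_degree_power_mult[OF Suc.IH])
  moreover have "low_degree l y (?n + Suc s) ((Y r j - y ^ ?n) + y ^ ?n)"
    by (intro low_degree_add low_degree_mono[OF Suc.IH] low_degree_power) auto
  ultimately have "low_degree l y (?n + Suc s) (Y r (Suc j) - y ^ (?n + Suc s))"
    by (simp only: low_degree_diff)
  then show ?case by (simp add: add_ac)
qed (simp add: Y_def)

lemma gbasis_top:
  assumes "even k" "j < mdim k"
  shows "low_degree l y (Suc s * j + a k) (gbasis \<alpha> \<beta> k j - fps_const (\<kappa> ^ j) * y ^ (Suc s * j + a k))"
proof -
  have "fps_cong l (gbasis \<alpha> \<beta> k j) (y ^ a k * delta ^ j)" by (rule gb[OF assms])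
  also have "fps_cong l \<dots> (y ^ a k * (fps_const \<kappa> * (y ^ Suc s - 1)) ^ j)"
    by (intro fps_cong_mult fps_cong_refl fps_cong_power \<kappa>)
  also have "\<dots> = fps_const (\<kappa> ^ j) * Y (a k) j"
    by (simp add: Y_def power_mult_distrib fps_const_power mult_ac)
  finally have "fps_cong l (gbasis \<alpha> \<beta> k j - fps_const (\<kappa> ^ j) * y ^ (Suc s * j + a k))
     (fps_const (\<kappa> ^ j) * Y (a k) j - fps_const (\<kappa> ^ j) * y ^ (Suc s * j + a k))"
    by (rule fps_cong_diff[OF _ fps_cong_refl])
  also have "\<dots> = fps_const (\<kappa> ^ j) * (Y (a k) j - y ^ (Suc s * j + a k))"
    by (simp only: right_diff_distrib)
  finally show ?thesis by (rule low_degree_cong) (rule low_degree_const_mult[OF low_Y])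
qed

lemma gbasis_low:
  assumes "even k" "j < mdim k" "Suc s * j + a k < m"
  shows "low_degree l y m (gbasis \<alpha> \<beta> k j)"
proof -
  let ?t = "fps_const (\<kappa> ^ j) * y ^ (Suc s * j + a k)"
  have "low_degree l y m ((gbasis \<alpha> \<beta> k j - ?t) + ?t)"
    using assms(3) low_degree_mono[OF gbasis_top[OF assms(1,2)]]
    by (intro low_degree_add low_degree_const_mult low_degree_power) auto
  then show ?thesis by simp
qed

lemma weight_mult: "w * (Suc s * j + r) = 12 * j + w * r"
  by (simp only: distrib_left mult.assoc[symmetric] w(3))

text \<open>The last assumption on \<open>a\<close> says that 12 j + w \<open>a k\<close> does not
  exceed the weight k; dividing by w bounds the degree of each basis element by m.\<close>

lemma mod_form_low:
  assumes A: "cfps A \<in> mod_forms (w * m)"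
  shows "low_degree l y (Suc m) A"
proof -
  have ev: "even (w * m)" using w by simp
  obtain c where c: "A = (\<Sum>j<mdim (w * m). fps_const (c j) * gbasis \<alpha> \<beta> (w * m) j)"
    using int_mod_form_expansion[OF ws ev A] by blast
  show ?thesis unfolding c
  proof (intro low_degree_sum low_degree_const_mult gbasis_low ev)
    fix j assume j: "j \<in> {..<mdim (w * m)}"
    have "12 * j + w * a (w * m) \<le> w * m" using a(4)[OF ev] j by simp
    then have "w * (Suc s * j + a (w * m)) \<le> w * m" by (simp only: weight_mult)
    then show "Suc s * j + a (w * m) < Suc m" using w(2) by simp
  qed simp
qed

text \<open>The diagonal entry of T_p at y^m, as a relation because it is determined only modulo
  l.\<close>

definition eig :: "nat \<Rightarrow> int \<Rightarrow> bool" where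
  "eig m c \<longleftrightarrow> low_degree l y m (hecke_fps p (w * m) (y ^ m) - fps_const c * y ^ m)"

lemma power_mod_form: "cfps (y ^ m) \<in> mod_forms (w * m)"
  using mod_forms_power[OF ymf, of m] by (simp add: mult.commute)

lemma eig_exists: "m > 0 \<Longrightarrow> \<exists>c. eig m c"
proof -
  assume m: "m > 0"
  have "cfps (hecke_fps p (w * m) (y ^ m)) \<in> mod_forms (w * m)"
    unfolding cfps_hecke_fps using w m by (intro hecke_fps_mod_form power_mod_form p) auto
  then have "low_degree l y (Suc m) (hecke_fps p (w * m) (y ^ m))" by (rule mod_form_low)
  then obtain P where P: "\<forall>i\<ge>Suc m. coeff P i = 0" "fps_cong l (hecke_fps p (w * m) (y ^ m)) (evy y P)"
    unfolding low_degree_def by blast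
  have "eig m (coeff P m)"
    unfolding eig_def low_degree_def
  proof (intro exI[of _ "P - Polynomial.monom (coeff P m) m"] conjI allI impI)
    show "coeff (P - Polynomial.monom (coeff P m) m) i = 0" if "m \<le> i" for i
      using P(1) that by (cases "i = m") auto
    show "fps_cong l (hecke_fps p (w * m) (y ^ m) - fps_const (coeff P m) * y ^ m) (evy y (P - Polynomial.monom (coeff P m) m))"
      using fps_cong_diff[OF P(2) fps_cong_refl] by simp
  qed
  then show ?thesis by blast
qed

lemma low_top_cong:
  assumes "low_degree l y m (A - fps_const c * y ^ m)" "low_degree l y m (A - fps_const d * y ^ m)"
  shows "[c = d] (mod int l)"
proof -
  have "low_degree l y m ((A - fps_const d * y ^ m) - (A - fps_const c * y ^ m))"
    by (rule low_degree_diff[OF assms(2,1)])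
  also have "(A - fps_const d * y ^ m) - (A - fps_const c * y ^ m) = fps_const (c - d) * y ^ m"
    by (simp add: algebra_simps flip: fps_const_sub)
  finally have "int l dvd c - d" by (rule low_degree_top_imp_dvd[OF l(1) y0 y1])
  then show ?thesis by (simp add: cong_iff_dvd_diff)
qed

lemma eig_unique: "eig m c \<Longrightarrow> eig m d \<Longrightarrow> [c = d] (mod int l)"
  unfolding eig_def by (rule low_top_cong)

lemma eig_weight:
  assumes "eig m c" "m > 0" "k > 0" "[k = w * m] (mod l - 1)"
  shows "low_degree l y m (hecke_fps p k (y ^ m) - fps_const c * y ^ m)"
proof (rule low_degree_cong)
  show "fps_cong l (hecke_fps p k (y ^ m) - fps_const c * y ^ m) (hecke_fps p (w * m) (y ^ m) - fps_const c * y ^ m)"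
    using assms w by (intro fps_cong_diff fps_cong_refl hecke_fps_weight_cong l lp) auto
  show "low_degree l y m (hecke_fps p (w * m) (y ^ m) - fps_const c * y ^ m)"
    using assms(1) by (simp add: eig_def)
qed

lemma hecke_power_low:
  assumes "k > 0" "[k = w * m] (mod l - 1)"
  shows "low_degree l y (Suc m) (hecke_fps p k (y ^ m))"
proof (cases "m = 0")
  case True
  obtain d where "hecke_fps p k (fps_const (1 :: int)) = fps_const d" using hecke_fps_const[OF p0] by blast
  with True show ?thesis by (simp add: low_degree_1)
next
  case False
  then obtain c where c: "eig m c" using eig_exists by blast
  have "low_degree l y (Suc m) ((hecke_fps p k (y ^ m) - fps_const c * y ^ m) + fps_const c * y ^ m)"
    using eig_weight[OF c _ assms] False
    by (intro low_degree_add low_degree_const_mult low_degree_power) (auto intro: low_degree_mono)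
  then show ?thesis by simp
qed

text \<open>Modulo l, theta y^m = -2 m (y^(m + s) - y^(m - 1)). The coefficient of y^(m + s) in T_p
  (theta y^m) is -2 m d if T_p acts on these monomials, and -2 m p c if T_p is first moved past
  theta. As l divides neither 2 nor m, the factor cancels.\<close>

lemma eig_theta:
  assumes m: "m > 0" "\<not> l dvd m" and c: "eig m c" "eig (m + s) d"
  shows "[d = int p * c] (mod int l)"
proof -
  define n where "n = m + s"
  define k where "k = w * m"
  define H where "H = (hecke_fps p (k + 2) :: int fps \<Rightarrow> int fps)"
  define u where "u = - 2 * int m"
  define E where "E = fps_const u * y ^ n - fps_const u * y ^ (m - 1)"
  have k: "k > 0" "k + 2 > 0" using w m by (simp_all add: k_def)
  \<comment> \<open>Modulo l - 1 both monomials of theta y^m have weight k + 2, since w s = 2 and 12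
    = 0 there; so T_p of weight k + 2 is triangular on both.\<close>
  have wt: "[k + 2 = w * n] (mod l - 1)"
    unfolding k_def n_def distrib_left by (rule cong_add[OF cong_refl cong_sym[OF w(4)]])
  have "w * n = w * (m - 1) + 12"
  proof -
    have "n = (m - 1) + Suc s" using m by (simp add: n_def)
    then have "w * n = w * (m - 1) + w * Suc s" by (simp only: distrib_left)
    then show ?thesis by (simp only: w(3))
  qed
  then have "[w * n = w * (m - 1) + 0] (mod l - 1)" using w(5) by (simp only: cong_add_lcancel_nat)
  with wt have wt': "[k + 2 = w * (m - 1)] (mod l - 1)" using cong_trans by fastforce
  have thY: "fps_cong l (theta (y ^ m)) E"
  proof -
    have "theta (y ^ m) = (fps_const (int m) * y ^ (m - 1)) * theta y"
      by (simp add: theta_power flip: fps_of_nat)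
    also have "fps_cong l \<dots> ((fps_const (int m) * y ^ (m - 1)) * (fps_const (-2) * (y ^ Suc s - 1)))"
      by (intro fps_cong_mult fps_cong_refl th)
    also have "\<dots> = fps_const u * (y ^ (m - 1) * y ^ Suc s) - fps_const u * y ^ (m - 1)"
    proof -
      have cu: "fps_const u = fps_const (-2) * fps_const (int m)" by (simp add: u_def)
      show ?thesis unfolding cu by (simp only: right_diff_distrib mult_1_right mult_1_left mult_ac)
    qed
    also have "y ^ (m - 1) * y ^ Suc s = y ^ n"
      using m by (simp only: power_add[symmetric]) (simp add: n_def)
    finally show ?thesis by (simp add: E_def)
  qed
  have L1: "low_degree l y n (H E - fps_const (u * d) * y ^ n)"
  proof -
    have "H E - fps_const (u * d) * y ^ n = fps_const u * (H (y ^ n) - fps_const d * y ^ n) - fps_const u * H (y ^ (m - 1))"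
      unfolding E_def H_def fps_const_mult[symmetric] by (simp add: hecke_fps_linear algebra_simps)
    moreover have "low_degree l y n (H (y ^ n) - fps_const d * y ^ n)"
      unfolding H_def n_def by (rule eig_weight) (use c m k wt in \<open>auto simp: n_def\<close>)
    moreover have "low_degree l y n (H (y ^ (m - 1)))"
      unfolding H_def by (rule low_degree_mono[OF hecke_power_low[OF k(2) wt']]) (use m in \<open>simp add: n_def\<close>)
    ultimately show ?thesis by (simp only: low_degree_diff low_degree_const_mult)
  qed
  have L2: "low_degree l y n (H E - fps_const (u * (int p * c)) * y ^ n)"
  proof -
    define L where "L = hecke_fps p k (y ^ m) - fps_const c * y ^ m"
    have "low_degree l y m L" using c(1) by (simp add: L_def eig_def k_def)
    then have thL: "low_degree l y n (theta L)" unfolding n_def by (rule low_degree_theta[OF th])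
    have "fps_cong l (H E) (H (theta (y ^ m)))"
      unfolding H_def by (intro hecke_fps_cong fps_cong_sym[OF thY])
    also have "H (theta (y ^ m)) = fps_const (int p) * theta (fps_const c * y ^ m + L)"
      unfolding H_def hecke_fps_theta[OF k(1) p0] by (simp add: L_def)
    also have "\<dots> = fps_const (int p * c) * theta (y ^ m) + fps_const (int p) * theta L"
      by (simp add: theta_simps algebra_simps flip: fps_const_mult)
    also have "fps_cong l \<dots> (fps_const (int p * c) * E + fps_const (int p) * theta L)"
      by (intro fps_cong_add fps_cong_mult fps_cong_refl thY)
    finally have "fps_cong l (H E - fps_const (u * (int p * c)) * y ^ n)
        (fps_const (int p * c) * E + fps_const (int p) * theta L - fps_const (u * (int p * c)) * y ^ n)"
      by (rule fps_cong_diff[OF _ fps_cong_refl])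
    also have "fps_const (int p * c) * E + fps_const (int p) * theta L - fps_const (u * (int p * c)) * y ^ n =
       fps_const (int p) * theta L - fps_const (u * (int p * c)) * y ^ (m - 1)"
      by (simp add: E_def algebra_simps flip: fps_const_mult)
    finally show ?thesis
    proof (rule low_degree_cong)
      show "low_degree l y n (fps_const (int p) * theta L - fps_const (u * (int p * c)) * y ^ (m - 1))"
        by (intro low_degree_diff low_degree_const_mult thL low_degree_power) (use m in \<open>simp add: n_def\<close>)
    qed
  qed
  have "[u * d = u * (int p * c)] (mod int l)" by (rule low_top_cong[OF L1 L2])
  moreover have "coprime u (int l)"
  proof -
    have "\<not> int l dvd u"
    proof
      assume "int l dvd u"
      then have "int l dvd int (2 * m)" by (simp add: u_def)
      then have "l dvd 2 * m" by (simp only: int_dvd_int_iff)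
      then have "l dvd 2" using l(1) m(2) by (simp add: prime_dvd_mult_iff)
      then show False using l primes_dvd_imp_eq two_is_prime_nat by blast
    qed
    then have "coprime (int l) u" using l(1) by (intro prime_imp_coprime) auto
    then show ?thesis by (simp only: coprime_commute)
  qed
  ultimately show ?thesis by (simp only: cong_mult_lcancel)
qed

text \<open>Modulo l, y^(l m) is y^m with q replaced by q^l, a substitution that commutes with T_p.
  The weights w l m and w m agree modulo l - 1, so T_p is the same in both.\<close>

lemma eig_frobenius:
  assumes "eig m c" "m > 0"
  shows "eig (l * m) c"
proof -
  have l1: "[l = 1] (mod l - 1)"
    using cong_add[OF cong_refl[of 1] cong_0_iff[THEN iffD2, OF dvd_refl[of "l - 1"]]] l0 by simp
  have wt: "[w * (l * m) = w * m] (mod l - 1)"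
    using cong_mult[OF cong_refl[of w] cong_mult[OF l1 cong_refl[of m]]] by simp
  define L where "L = hecke_fps p (w * m) (y ^ m) - fps_const c * y ^ m"
  have L: "low_degree l y m L" using assms(1) by (simp add: eig_def L_def)
  have Y: "fps_cong l (y ^ (l * m)) (y ^ m oo fps_X ^ l)"
    using fps_frobenius[OF l(1), of "y ^ m"] by (simp add: power_mult[symmetric] mult.commute)
  have "fps_cong l (hecke_fps p (w * (l * m)) (y ^ (l * m))) (hecke_fps p (w * m) (y ^ (l * m)))"
    using wt w l0 assms by (intro hecke_fps_weight_cong l lp) auto
  also have "fps_cong l \<dots> (hecke_fps p (w * m) (y ^ m oo fps_X ^ l))"
    by (intro hecke_fps_cong Y)
  also have "\<dots> = (fps_const c * y ^ m + L) oo fps_X ^ l"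
    using p l by (subst hecke_fps_frobenius) (auto simp: L_def)
  also have "\<dots> = fps_const c * (y ^ m oo fps_X ^ l) + (L oo fps_X ^ l)"
    using l0 by (simp add: fps_compose_add_distrib fps_compose_mult_distrib)
  also have "fps_cong l \<dots> (fps_const c * y ^ (l * m) + (L oo fps_X ^ l))"
    by (intro fps_cong_add fps_cong_mult fps_cong_refl fps_cong_sym[OF Y])
  finally have "fps_cong l (hecke_fps p (w * (l * m)) (y ^ (l * m)) - fps_const c * y ^ (l * m))
      (fps_const c * y ^ (l * m) + (L oo fps_X ^ l) - fps_const c * y ^ (l * m))"
    by (rule fps_cong_diff[OF _ fps_cong_refl])
  then show ?thesis unfolding eig_def
    by (rule low_degree_cong) (simp add: low_degree_frobenius[OF l(1) L])
qed

text \<open>In weight k' = 12 j + w r, with r = \<open>a k\<close>, the basis consists exactly of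
  the elements 0, ..., j, and modulo l they agree with those of weight k. So the expansion of T_p
  applied to element j in weight k' stops at j and may be read in weight k. To find its diagonal
  coefficient, y^n is expanded in this basis: before and after T_p only element j reaches degree n,
  and the factor \<open>\<kappa> ^ j\<close> cancels.\<close>

lemma hecke_gbasis_triangular:
  assumes k: "even k" "k > 0" and j: "j < mdim k" "j > 0" and c: "eig (Suc s * j + a k) c"
  shows "\<exists>m. [m j = c] (mod int l) \<and>
     fps_cong l (hecke_fps p k (gbasis \<alpha> \<beta> k j)) (\<Sum>i<Suc j. fps_const (m i) * gbasis \<alpha> \<beta> k i)"
proof -
  define r where "r = a k"
  define n where "n = Suc s * j + r"
  define k' where "k' = 12 * j + w * r"
  have r: "r \<le> s" by (simp add: r_def a)
  have wn: "w * n = k'"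
    by (simp only: n_def k'_def weight_mult)
  have ak': "a (12 * i + w * r) = r" for i by (rule a(3)[OF r])
  have ev: "even (12 * i + w * r)" for i using w by simp
  have "w * r \<le> w * s" using r by simp
  moreover have "w * s + w = 12" using w(3) by simp
  ultimately have "w * r < 12" using w(2) by linarith
  moreover have "w * r \<noteq> 2"
  proof (cases "r = 0")
    case False
    then have "w * 1 \<le> w * r" by (intro mult_left_mono) auto
    then show ?thesis using w(2) by linarith
  qed simp
  ultimately have wr: "w * r < 12" "w * r \<noteq> 2" by blast+
  have mdim: "mdim (12 * i + w * r) = Suc i" for i
    using wr by (simp add: mdim_def)
  have kk': "[k = k'] (mod l - 1)"
  proof -
    have "[12 * j + w * r = 0 * j + w * r] (mod l - 1)" by (intro cong_add cong_mult cong_refl w(5))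
    then show ?thesis using a(2)[OF k(1)] unfolding k'_def r_def by (metis add_0 cong_sym cong_trans mult_0)
  qed
  have k'0: "k' > 0" using j by (simp add: k'_def)
  have gg: "fps_cong l (gbasis \<alpha> \<beta> k i) (gbasis \<alpha> \<beta> (12 * i' + w * r) i)" if "i \<le> i'" "i \<le> j" for i i'
  proof -
    have "fps_cong l (gbasis \<alpha> \<beta> k i) (y ^ r * delta ^ i)" using gb[OF k(1), of i] that j by (simp add: r_def)
    moreover have "fps_cong l (gbasis \<alpha> \<beta> (12 * i' + w * r) i) (y ^ r * delta ^ i)"
      using gb[OF ev, of i i'] that by (simp add: mdim ak')
    ultimately show ?thesis using fps_cong_sym fps_cong_trans by blast
  qed
  define g where "g = gbasis \<alpha> \<beta> k'"
  have mdk: "mdim k' = Suc j" unfolding k'_def by (rule mdim)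
  have evk: "even k'" unfolding k'_def by (rule ev)
  have ak: "a k' = r" unfolding k'_def by (rule ak')
  have "cfps (g j) \<in> mod_forms k'" unfolding g_def by (rule gbasis_mod_form[OF ws evk]) (simp add: mdk)
  then have "cfps (hecke_fps p k' (g j)) \<in> mod_forms k'"
    unfolding cfps_hecke_fps by (rule hecke_fps_mod_form[OF _ evk k'0 p(1)])
  then obtain m where m: "hecke_fps p k' (g j) = (\<Sum>i<Suc j. fps_const (m i) * g i)"
    using int_mod_form_expansion[OF ws evk] unfolding mdk g_def by metis
  obtain d where d: "y ^ n = (\<Sum>i<Suc j. fps_const (d i) * g i)"
    using int_mod_form_expansion[OF ws evk, of "y ^ n"] power_mod_form[of n] unfolding mdk g_def wn by metis
  have gtop: "low_degree l y n (g j - fps_const (\<kappa> ^ j) * y ^ n)"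
    using gbasis_top[OF evk, of j] by (simp add: g_def mdk ak n_def)
  have glow: "low_degree l y n (g i)" if "i < j" for i
    unfolding g_def
    by (rule gbasis_low[OF evk]) (use that mult_strict_left_mono[OF that, of "Suc s"] in \<open>simp_all add: mdk ak n_def\<close>)
  have comb: "low_degree l y n ((\<Sum>i<Suc j. fps_const (e i) * f i) - fps_const (e j * b) * y ^ n)"
    if "\<And>i. i < j \<Longrightarrow> low_degree l y n (f i)" "low_degree l y n (f j - fps_const b * y ^ n)" for e f b
  proof -
    have eq: "(\<Sum>i<Suc j. fps_const (e i) * f i) - fps_const (e j * b) * y ^ n =
       (\<Sum>i<j. fps_const (e i) * f i) + fps_const (e j) * (f j - fps_const b * y ^ n)"
      by (simp add: algebra_simps flip: fps_const_mult)
    show ?thesis unfolding eq using that by (auto intro!: low_degree_add low_degree_sum low_degree_const_mult)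
  qed
  have "low_degree l y n (y ^ n - fps_const (d j * \<kappa> ^ j) * y ^ n)"
    using comb[of g "\<kappa> ^ j" d, OF glow gtop] unfolding d[symmetric] .
  moreover have "low_degree l y n (y ^ n - fps_const 1 * y ^ n)" by simp
  ultimately have dk: "[d j * \<kappa> ^ j = 1] (mod int l)" by (rule low_top_cong)
  define H where "H = (hecke_fps p k' :: int fps \<Rightarrow> int fps)"
  have Hlow: "low_degree l y n (H (g i))" if i: "i < j" for i
  \<comment> \<open>Here element 0 is constant modulo l and belongs to weight 0, which the weight
    congruences exclude; but T_p maps constants to constants.\<close>
  proof (cases "i = 0 \<and> r = 0")
    case True
    have "fps_cong l (g 0) 1" using gb[OF evk, of 0] True by (simp add: mdk ak g_def)
    then have "fps_cong l (H (g 0)) (H (fps_const 1))" unfolding H_def by (intro hecke_fps_cong) simp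
    moreover obtain d where "H (fps_const (1 :: int)) = fps_const d" using hecke_fps_const[OF p0] unfolding H_def by blast
    ultimately have "fps_cong l (H (g 0)) (fps_const d)" by simp
    then have "low_degree l y n (H (g 0))"
      by (rule low_degree_cong[OF _ low_degree_1]) (use j in \<open>simp add: n_def\<close>)
    with True show ?thesis by simp
  next
    case False
    define k2 where "k2 = 12 * i + w * r"
    have k2: "k2 > 0" using False w by (auto simp: k2_def)
    have evk2: "even k2" unfolding k2_def by (rule ev)
    have wk: "[k' = k2] (mod l - 1)"
    proof -
      have "[12 * j + w * r = 0 * j + w * r] (mod l - 1)" "[12 * i + w * r = 0 * i + w * r] (mod l - 1)"
        by (intro cong_add cong_mult cong_refl w(5))+
      then show ?thesis unfolding k'_def k2_def by (metis cong_sym cong_trans mult_0)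
    qed
    have "fps_cong l (H (g i)) (hecke_fps p k2 (g i))"
      unfolding H_def by (rule hecke_fps_weight_cong[OF l(1) lp wk k'0 k2])
    also have "fps_cong l \<dots> (hecke_fps p k2 (gbasis \<alpha> \<beta> k2 i))"
      using fps_cong_trans[OF fps_cong_sym[OF gg[of i j]] gg[of i i]] i
      unfolding k2_def g_def k'_def by (intro hecke_fps_cong) simp
    finally have "fps_cong l (H (g i)) (hecke_fps p k2 (gbasis \<alpha> \<beta> k2 i))" .
    moreover have "low_degree l y n (hecke_fps p k2 (gbasis \<alpha> \<beta> k2 i))"
    proof -
      have wn2: "w * (Suc s * i + r) = k2"
        by (simp only: k2_def weight_mult)
      have "cfps (gbasis \<alpha> \<beta> k2 i) \<in> mod_forms k2"
        by (rule gbasis_mod_form[OF ws evk2]) (simp add: k2_def mdim)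
      then have "cfps (hecke_fps p k2 (gbasis \<alpha> \<beta> k2 i)) \<in> mod_forms (w * (Suc s * i + r))"
        unfolding cfps_hecke_fps wn2 by (rule hecke_fps_mod_form[OF _ evk2 k2 p(1)])
      then have "low_degree l y (Suc (Suc s * i + r)) (hecke_fps p k2 (gbasis \<alpha> \<beta> k2 i))" by (rule mod_form_low)
      moreover have "Suc s * i < Suc s * j" using i by (intro mult_strict_left_mono) auto
      ultimately show ?thesis by (elim low_degree_mono) (simp add: n_def)
    qed
    ultimately show ?thesis by (rule low_degree_cong)
  qed
  have Htop: "low_degree l y n (H (g j) - fps_const (m j * \<kappa> ^ j) * y ^ n)"
    unfolding H_def m by (rule comb[of g "\<kappa> ^ j" m, OF glow gtop])
  have Hy: "H (y ^ n) = (\<Sum>i<Suc j. fps_const (d i) * H (g i))"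
    unfolding d H_def hecke_fps_sum hecke_fps_linear ..
  have "low_degree l y n (H (y ^ n) - fps_const (d j * (m j * \<kappa> ^ j)) * y ^ n)"
    unfolding Hy by (rule comb[of "\<lambda>i. H (g i)" "m j * \<kappa> ^ j" d, OF Hlow Htop])
  moreover have "low_degree l y n (H (y ^ n) - fps_const c * y ^ n)"
    unfolding H_def using c j wn k'0 by (intro eig_weight) (auto simp: n_def r_def)
  ultimately have "[d j * (m j * \<kappa> ^ j) = c] (mod int l)" by (rule low_top_cong)
  moreover have "[(d j * \<kappa> ^ j) * m j = 1 * m j] (mod int l)" by (intro cong_mult dk cong_refl)
  ultimately have mc: "[m j = c] (mod int l)"
    by (simp add: mult_ac) (meson cong_sym cong_trans)
  have "fps_cong l (hecke_fps p k (gbasis \<alpha> \<beta> k j)) (hecke_fps p k' (gbasis \<alpha> \<beta> k j))"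
    by (rule hecke_fps_weight_cong[OF l(1) lp kk' k(2) k'0])
  also have "fps_cong l \<dots> (hecke_fps p k' (g j))"
    using gg[of j j] unfolding g_def k'_def by (intro hecke_fps_cong) simp
  also have "\<dots> = (\<Sum>i<Suc j. fps_const (m i) * g i)" by (rule m)
  also have "fps_cong l \<dots> (\<Sum>i<Suc j. fps_const (m i) * gbasis \<alpha> \<beta> k i)"
  proof (intro fps_cong_sum fps_cong_mult fps_cong_refl)
    fix i assume "i \<in> {..<Suc j}"
    then show "fps_cong l (g i) (gbasis \<alpha> \<beta> k i)"
      unfolding g_def k'_def by (intro fps_cong_sym[OF gg]) auto
  qed
  finally show ?thesis using mc by blast
qed

lemma eig_cong: "eig m c \<Longrightarrow> [c = d] (mod int l) \<Longrightarrow> eig m d"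
proof -
  assume c: "eig m c" and cd: "[c = d] (mod int l)"
  have "fps_cong l (hecke_fps p (w * m) (y ^ m) - fps_const d * y ^ m) (hecke_fps p (w * m) (y ^ m) - fps_const c * y ^ m)"
    by (intro fps_cong_diff fps_cong_mult fps_cong_refl fps_cong_const cong_sym[OF cd])
  then show ?thesis using c unfolding eig_def by (rule low_degree_cong)
qed

lemma eig_chain:
  assumes "eig m c" "m > 0" "\<And>i. i < t \<Longrightarrow> \<not> l dvd m + i * s"
  shows "eig (m + t * s) (int p ^ t * c)"
  using assms(3)
proof (induction t)
  case (Suc t)
  then have IH: "eig (m + t * s) (int p ^ t * c)" by simp
  have pos: "m + t * s > 0" using assms(2) by simp
  obtain d where d: "eig (m + t * s + s) d" using eig_exists[of "m + t * s + s"] pos by auto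
  have "[d = int p * (int p ^ t * c)] (mod int l)"
    by (rule eig_theta[OF pos _ IH d]) (use Suc.prems in simp)
  with d have "eig (m + t * s + s) (int p * (int p ^ t * c))" by (rule eig_cong)
  then show ?case by (simp add: add_ac mult_ac)
qed (use assms in simp)

lemma p_power_cong: "[int p ^ (m + (l - 1) * t) = int p ^ m] (mod int l)"
proof -
  have "[(p ^ (l - 1)) ^ t = 1 ^ t] (mod l)" by (intro cong_pow fermat_little l lp)
  then have "[p ^ m * (p ^ (l - 1)) ^ t = p ^ m * 1] (mod l)" by (intro cong_mult cong_refl) simp
  then have "[int (p ^ m * (p ^ (l - 1)) ^ t) = int (p ^ m * 1)] (mod int l)" by (simp only: cong_int_iff)
  then show ?thesis by (simp add: power_add power_mult)
qed

text \<open>Without cusp forms in weights up to 10, T_p y^m is determined by its constant term,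
  hence a multiple of y^m. These are the starting values of the recursions.\<close>

lemma eig_small_weight:
  assumes "m > 0" "w * m \<le> 10"
  shows "eig m (1 + int p ^ (w * m - 1))"
proof -
  have mf: "cfps (hecke_fps p (w * m) (y ^ m)) \<in> mod_forms (w * m)"
    unfolding cfps_hecke_fps using w assms by (intro hecke_fps_mod_form power_mod_form p) auto
  have "cfps (hecke_fps p (w * m) (y ^ m)) = fps_const (of_int (1 + int p ^ (w * m - 1))) * cfps (y ^ m)"
    by (rule mod_forms_eqI[OF mf mod_forms_scale[OF power_mod_form]])
       (use w assms p0 in \<open>simp_all add: cfps_hecke_fps hecke_fps_nth_0 fps_nth_power_0 y0\<close>)
  then have "cfps (hecke_fps p (w * m) (y ^ m)) = cfps (fps_const (1 + int p ^ (w * m - 1)) * y ^ m)"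
    by (simp only: cfps_hom)
  then have "hecke_fps p (w * m) (y ^ m) = fps_const (1 + int p ^ (w * m - 1)) * y ^ m"
    by (simp only: cfps_inject)
  then show ?thesis by (simp add: eig_def)
qed

end

text \<open>Here and in the three definitions below the exponents keep the power of y least: y = E6
  with exponent 0 or 1 for l = 5, y = E4 with exponent \<open>k mod 3\<close> for l = 7.\<close>

definition beta5 :: "nat \<Rightarrow> nat" where "beta5 k = (if 4 dvd k then 0 else 1)"
definition alpha5 :: "nat \<Rightarrow> nat" where "alpha5 k = (k - 6 * beta5 k) div 4"
definition alpha7 :: "nat \<Rightarrow> nat" where "alpha7 k = k mod 3"
definition beta7 :: "nat \<Rightarrow> nat" where "beta7 k = (k - 4 * alpha7 k) div 6"

lemma even_mod_4: "even k \<Longrightarrow> \<not> 4 dvd k \<Longrightarrow> k mod 4 = 2" for k :: nat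
proof -
  assume "even k" "\<not> 4 dvd k"
  then obtain t where t: "k = 2 * t" "odd t" by (auto elim!: evenE simp: dvd_def)
  then obtain u where "t = 2 * u + 1" by (auto elim!: oddE)
  then have "k = 2 + 4 * u" using t by simp
  then have "k mod 4 = 2 mod 4" by (simp only: mod_mult_self2)
  then show ?thesis by simp
qed

lemma weight_split_5: "weight_split alpha5 beta5"
  unfolding weight_split_def
proof (intro allI impI)
  fix k :: nat assume k: "even k" "k \<noteq> 2"
  show "4 * alpha5 k + 6 * beta5 k = k"
  proof (cases "4 dvd k")
    case True
    then show ?thesis by (simp add: alpha5_def beta5_def)
  next
    case False
    have "k = 4 * (k div 4) + 2" using even_mod_4[OF k(1) False] by (metis mult_div_mod_eq)
    then obtain t where t: "k = 4 * t + 2" by blast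
    with k obtain u where "t = Suc u" by (cases t) auto
    with t False show ?thesis by (simp add: alpha5_def beta5_def)
  qed
qed

lemma even_mod_6: "even k \<Longrightarrow> k mod 6 = 4 * (k mod 3) mod 6" for k :: nat
proof -
  assume "even k"
  then obtain t where t: "k = 2 * t" by blast
  define q r where "q = t div 3" and "r = t mod 3"
  have tq: "t = 3 * q + r" "r < 3" by (simp_all add: q_def r_def)
  then have "k = 6 * q + 2 * r" by (simp add: t)
  moreover have "r = 0 \<or> r = 1 \<or> r = 2" using tq(2) by linarith
  moreover have "(6 * q + x) mod 3 = x mod 3" for x :: nat
  proof -
    have "6 * q + x = x + 3 * (2 * q)" by simp
    then show ?thesis by (simp only: mod_mult_self2)
  qed
  ultimately show ?thesis by auto
qed

lemma weight_split_7: "weight_split alpha7 beta7"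
  unfolding weight_split_def
proof (intro allI impI)
  fix k :: nat assume k: "even k" "k \<noteq> 2"
  define r where "r = k mod 3"
  define q where "q = k div 6"
  have kq: "k = 6 * q + 4 * r mod 6"
    using even_mod_6[OF k(1)] by (simp add: q_def r_def flip: even_mod_6[OF k(1)])
  have "r < 3" by (simp add: r_def)
  then consider "r = 0" | "r = 1" | "r = 2" by linarith
  moreover have al: "alpha7 k = r" by (simp add: alpha7_def r_def)
  ultimately show "4 * alpha7 k + 6 * beta7 k = k"
    unfolding beta7_def al
  proof cases
    case 3
    then have "k = 6 * q + 2" using kq by simp
    with k obtain u where "q = Suc u" by (cases q) auto
    with \<open>k = 6 * q + 2\<close> 3 show "4 * r + 6 * ((k - 4 * r) div 6) = k" by simp
  qed (use kq in simp_all)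
qed

lemma mod_form_weight_0: "A \<in> mod_forms 0 \<Longrightarrow> A = fps_const (fps_nth A 0)"
  by (rule mod_forms_eqI[of _ 0]) auto

text \<open>The Rankin-Cohen bracket of E4 and E6 is a cusp form of weight 12, hence a multiple of
  Delta. The factor is the coefficient of q, namely -4 * 504 - 6 * 240 = -3456 = -2 * 1728.\<close>

lemma eisen_bracket: "4 * (eisen4 * theta eisen6) - 6 * (eisen6 * theta eisen4) = - 2 * (eisen4 ^ 3 - eisen6 ^ 2)"
proof -
  define R where "R = 4 * (eisen4 * theta eisen6) - 6 * (eisen6 * theta eisen4)"
  have R: "cfps R \<in> mod_forms (0 + 12)"
    using mod_forms_bracket[OF eisen4_mod_form eisen6_mod_form] by (simp add: R_def theta_def)
  have R0: "fps_nth R 0 = 0" by (simp add: R_def fps_numeral_nth)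
  have R1: "fps_nth R 1 = - 3456"
    by (simp add: R_def fps_numeral_nth eisen4_def eisen6_def)
  obtain C where C: "C \<in> mod_forms 0" "cfps R = C * cfps delta"
    using cusp_form_div_delta[OF R] R0 by auto
  have "of_int (fps_nth R 1) = fps_nth (cfps R) 1" by simp
  also have "\<dots> = fps_nth C 0" unfolding C(2) by simp
  finally have "fps_nth C 0 = - 3456" using R1 by simp
  with mod_form_weight_0[OF C(1)] C(2) have "cfps R = fps_const (- 3456) * cfps delta" by simp
  also have "\<dots> = cfps (fps_const (- 3456) * delta)" by simp
  finally have "R = fps_const (- 3456) * delta" by (simp only: cfps_inject)
  also have "\<dots> = - 2 * (1728 * delta)"
    by (simp add: fps_eq_iff fps_numeral_nth numeral_fps_const)
  finally show ?thesis by (simp only: R_def delta_eq)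
qed

lemma eisen4_cong: "fps_cong 5 eisen4 1" "fps_cong 2 eisen4 1" "fps_cong 3 eisen4 1"
  by (auto simp: fps_cong_def eisen4_def fps_const_dvd_iff)

lemma eisen6_cong: "fps_cong 7 eisen6 1" "fps_cong 2 eisen6 1" "fps_cong 3 eisen6 1"
  by (auto simp: fps_cong_def eisen6_def fps_const_dvd_iff)

lemma fps_cong_mult_const: "[c = d] (mod int l) \<Longrightarrow> fps_cong l (fps_const c * A) (fps_const d * A)"
  by (intro fps_cong_mult fps_cong_const fps_cong_refl)

text \<open>Modulo 5, E4 = 1 and theta E4 = 0, so the bracket reads 4 theta E6 = -2 (1 - E6^2);
  multiplying by 4, which is its own inverse, gives the equation for y = E6. From 2 * 1728 = 1 comes
  Delta = 2 (1 - E6^2), whence \<open>\<kappa>\<close> = -2.\<close>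

lemma hecke_mod_5:
  assumes "prime p" "p \<noteq> 5"
  shows "hecke_mod 5 p 1 6 eisen6 alpha5 beta5 beta5 (- 2)"
proof
  show "prime (5::nat)" by simp
  have th4: "fps_cong 5 (theta eisen4) 0"
    using fps_cong_theta[OF eisen4_cong(1)] by (simp add: theta_simps)
  have "fps_cong 5 (4 * (eisen4 * theta eisen6) - 6 * (eisen6 * theta eisen4)) (4 * (1 * theta eisen6) - 6 * (eisen6 * 0))"
    by (intro fps_cong_diff fps_cong_mult fps_cong_refl eisen4_cong th4)
  then have "fps_cong 5 (4 * theta eisen6) (4 * (eisen4 * theta eisen6) - 6 * (eisen6 * theta eisen4))"
    using fps_cong_sym by simp
  also have "\<dots> = - 2 * (eisen4 ^ 3 - eisen6 ^ 2)" by (rule eisen_bracket)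
  also have "fps_cong 5 \<dots> (- 2 * (1 ^ 3 - eisen6 ^ 2))"
    by (intro fps_cong_diff fps_cong_mult fps_cong_refl fps_cong_power eisen4_cong)
  finally have "fps_cong 5 (4 * theta eisen6) (- 2 * (1 ^ 3 - eisen6 ^ 2))" .
  then have "fps_cong 5 (fps_const 4 * (4 * theta eisen6)) (fps_const 4 * (- 2 * (1 ^ 3 - eisen6 ^ 2)))"
    by (rule fps_cong_mult[OF fps_cong_refl])
  also have "fps_const 4 * (- 2 * (1 ^ 3 - eisen6 ^ 2)) = fps_const 8 * (eisen6 ^ 2 - 1)"
    by (simp add: algebra_simps flip: fps_numeral_fps_const)
  also have "fps_const 4 * (4 * theta eisen6) = fps_const 16 * theta eisen6"
    by (simp flip: fps_numeral_fps_const)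
  finally have 1: "fps_cong 5 (fps_const 16 * theta eisen6) (fps_const 8 * (eisen6 ^ 2 - 1))" .
  have "fps_cong 5 (theta eisen6) (fps_const 16 * theta eisen6)"
    using fps_cong_mult_const[of 1 16 5 "theta eisen6"] by (simp add: cong_def)
  also note 1
  also have "fps_cong 5 (fps_const 8 * (eisen6 ^ 2 - 1)) (fps_const (-2) * (eisen6 ^ 2 - 1))"
    by (rule fps_cong_mult_const) (simp add: cong_def)
  finally show "fps_cong 5 (theta eisen6) (fps_const (- 2) * (eisen6 ^ Suc 1 - 1))" by (simp add: numeral_2_eq_2)
  have "fps_cong 5 delta (fps_const 3456 * delta)"
    using fps_cong_mult_const[of 1 3456 5 delta] by (simp add: cong_def)
  also have "fps_const 3456 * delta = fps_const 2 * (1728 * delta)" by (simp add: numeral_fps_const flip: mult.assoc)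
  also have "\<dots> = fps_const 2 * (eisen4 ^ 3 - eisen6 ^ 2)" by (simp only: delta_eq)
  also have "fps_cong 5 \<dots> (fps_const 2 * (1 ^ 3 - eisen6 ^ 2))"
    by (intro fps_cong_diff fps_cong_mult fps_cong_refl fps_cong_power eisen4_cong)
  also have "fps_const 2 * (1 ^ 3 - eisen6 ^ 2) = fps_const (- 2) * (eisen6 ^ Suc 1 - 1)"
    by (simp add: numeral_2_eq_2 algebra_simps flip: fps_const_neg)
  finally show "fps_cong 5 delta (fps_const (- 2) * (eisen6 ^ Suc 1 - 1))" .
  show "\<not> int 5 dvd fps_nth eisen6 1" by (simp add: eisen6_def)
  show "cfps eisen6 \<in> mod_forms 6" by (rule eisen6_mod_form)
  show "weight_split alpha5 beta5" by (rule weight_split_5)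
  have beta: "beta5 (k - 12 * j) = beta5 k" if "12 * j \<le> k" for k j
  proof -
    have "4 dvd 12 * j" by simp
    then have "4 dvd k - 12 * j \<longleftrightarrow> 4 dvd k" using that by (metis dvd_diffD dvd_diff_nat)
    then show ?thesis by (simp add: beta5_def)
  qed
  show "fps_cong 5 (gbasis alpha5 beta5 k j) (eisen6 ^ beta5 k * delta ^ j)" if "even k" "j < mdim k" for k j
  proof -
    have "fps_cong 5 (gbasis alpha5 beta5 k j) (1 ^ alpha5 (k - 12 * j) * eisen6 ^ beta5 (k - 12 * j) * delta ^ j)"
      unfolding gbasis_def by (intro fps_cong_mult fps_cong_refl fps_cong_power eisen4_cong)
    then show ?thesis using beta that by (simp add: mdim_less_iff)
  qed
  show "beta5 k \<le> 1" for k by (simp add: beta5_def)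
  show "[k = 6 * beta5 k] (mod 5 - 1)" if "even k" for k
    using even_mod_4[OF that] by (auto simp: beta5_def cong_def dvd_eq_mod_eq_0)
  show "beta5 (12 * j + 6 * r) = r" if "r \<le> 1" for j r
  proof -
    have "4 dvd 12 * j" by simp
    then have "4 dvd 12 * j + 6 * r \<longleftrightarrow> 4 dvd 6 * r" by (rule dvd_add_right_iff)
    moreover have "r = 0 \<or> r = 1" using that by linarith
    ultimately show ?thesis by (auto simp: beta5_def)
  qed
  show "12 * j + 6 * beta5 k \<le> k" if "even k" "j < mdim k" for k j
  proof -
    have j: "12 * j \<le> k" "k - 12 * j \<noteq> 2" using that by (simp_all add: mdim_less_iff)
    have "even (k - 12 * j)" using that by simp
    then have "4 * alpha5 (k - 12 * j) + 6 * beta5 (k - 12 * j) = k - 12 * j"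
      using weight_split_5 j unfolding weight_split_def by blast
    then show ?thesis using beta[OF j(1)] j(1) by linarith
  qed
qed (use assms in \<open>simp_all add: cong_def\<close>)

text \<open>Modulo 7, E6 = 1 and theta E6 = 0, so the bracket reads -6 theta E4 = -2 (E4^3 - 1),
  where -6 = 1. From 1728 = -1 comes Delta = -(E4^3 - 1), whence \<open>\<kappa>\<close> =
  -1.\<close>

lemma hecke_mod_7:
  assumes "prime p" "p \<noteq> 7"
  shows "hecke_mod 7 p 2 4 eisen4 alpha7 beta7 alpha7 (- 1)"
proof
  show "prime (7::nat)" by simp
  have th6: "fps_cong 7 (theta eisen6) 0"
    using fps_cong_theta[OF eisen6_cong(1)] by (simp add: theta_simps)
  have "fps_cong 7 (4 * (eisen4 * theta eisen6) - 6 * (eisen6 * theta eisen4)) (4 * (eisen4 * 0) - 6 * (1 * theta eisen4))"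
    by (intro fps_cong_diff fps_cong_mult fps_cong_refl eisen6_cong th6)
  then have "fps_cong 7 (fps_const (-6) * theta eisen4) (4 * (eisen4 * theta eisen6) - 6 * (eisen6 * theta eisen4))"
    using fps_cong_sym by (simp add: numeral_fps_const flip: fps_const_neg)
  also have "\<dots> = - 2 * (eisen4 ^ 3 - eisen6 ^ 2)" by (rule eisen_bracket)
  also have "fps_cong 7 \<dots> (- 2 * (eisen4 ^ 3 - 1 ^ 2))"
    by (intro fps_cong_diff fps_cong_mult fps_cong_refl fps_cong_power eisen6_cong)
  finally have 1: "fps_cong 7 (fps_const (-6) * theta eisen4) (- 2 * (eisen4 ^ 3 - 1 ^ 2))" .
  have "fps_cong 7 (theta eisen4) (fps_const (-6) * theta eisen4)"
    using fps_cong_mult_const[of 1 "-6" 7 "theta eisen4"] by (simp add: cong_def)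
  also note 1
  finally show "fps_cong 7 (theta eisen4) (fps_const (- 2) * (eisen4 ^ Suc 2 - 1))"
    by (simp add: numeral_3_eq_3 numeral_fps_const flip: fps_const_neg)
  have "fps_cong 7 delta (fps_const (- 1728) * delta)"
    using fps_cong_mult_const[of 1 "- 1728" 7 delta] by (simp add: cong_def)
  also have "fps_const (- 1728) * delta = - (1728 * delta)" by (simp add: numeral_fps_const flip: fps_const_neg)
  also have "\<dots> = fps_const (- 1) * (eisen4 ^ 3 - eisen6 ^ 2)" by (simp add: delta_eq flip: fps_const_neg)
  also have "fps_cong 7 \<dots> (fps_const (- 1) * (eisen4 ^ 3 - 1 ^ 2))"
    by (intro fps_cong_diff fps_cong_mult fps_cong_refl fps_cong_power eisen6_cong)
  finally show "fps_cong 7 delta (fps_const (- 1) * (eisen4 ^ Suc 2 - 1))" by (simp add: numeral_3_eq_3)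
  show "\<not> int 7 dvd fps_nth eisen4 1" by (simp add: eisen4_def)
  show "cfps eisen4 \<in> mod_forms 4" by (rule eisen4_mod_form)
  show "weight_split alpha7 beta7" by (rule weight_split_7)
  have alpha: "alpha7 (k - 12 * j) = alpha7 k" if "12 * j \<le> k" for k j
  proof -
    have "k = (k - 12 * j) + 3 * (4 * j)" using that by simp
    then have "k mod 3 = ((k - 12 * j) + 3 * (4 * j)) mod 3" by (rule arg_cong)
    then show ?thesis unfolding alpha7_def by (simp only: mod_mult_self2)
  qed
  show "fps_cong 7 (gbasis alpha7 beta7 k j) (eisen4 ^ alpha7 k * delta ^ j)" if "even k" "j < mdim k" for k j
  proof -
    have "fps_cong 7 (gbasis alpha7 beta7 k j) (eisen4 ^ alpha7 (k - 12 * j) * 1 ^ beta7 (k - 12 * j) * delta ^ j)"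
      unfolding gbasis_def by (intro fps_cong_mult fps_cong_refl fps_cong_power eisen6_cong)
    then show ?thesis using alpha that by (simp add: mdim_less_iff)
  qed
  show "alpha7 k \<le> 2" for k
  proof -
    have "k mod 3 < 3" by simp
    then show ?thesis unfolding alpha7_def by linarith
  qed
  show "[k = 4 * alpha7 k] (mod 7 - 1)" if "even k" for k
    using even_mod_6[OF that] by (simp add: alpha7_def cong_def)
  show "alpha7 (12 * j + 4 * r) = r" if "r \<le> 2" for j r
  proof -
    have "12 * j + 4 * r = r + 3 * (4 * j + r)" by simp
    then have "(12 * j + 4 * r) mod 3 = r mod 3" by (simp only: mod_mult_self2)
    then show ?thesis using that by (simp add: alpha7_def)
  qed
  show "12 * j + 4 * alpha7 k \<le> k" if "even k" "j < mdim k" for k j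
  proof -
    have j: "12 * j \<le> k" "k - 12 * j \<noteq> 2" using that by (simp_all add: mdim_less_iff)
    have "even (k - 12 * j)" using that by simp
    then have "4 * alpha7 (k - 12 * j) + 6 * beta7 (k - 12 * j) = k - 12 * j"
      using weight_split_7 j unfolding weight_split_def by blast
    then show ?thesis using alpha[OF j(1)] j(1) by linarith
  qed
qed (use assms in \<open>simp_all add: cong_def\<close>)

text \<open>As s = 1, a theta step raises m by 1 and multiplies by p, all the way from 5x + 1 to 5x
  + 5. The start of such a block is read off from its end: Frobenius gives the entry at 5 (x + 1) as
  the one at x + 1, and the four steps in between multiply by p^4 = 1. The first block starts with 1
  + p^5 = 1 + p.\<close>

lemma eig_5:
  assumes p: "prime p" "p \<noteq> 5" and m: "m > 0"
  shows "hecke_mod.eig 5 p 6 eisen6 m (int p ^ (m - 1) * (1 + int p))"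
proof -
  interpret hecke_mod 5 p 1 6 eisen6 alpha5 beta5 beta5 "- 2" by (rule hecke_mod_5[OF p])
  have p5: "[int p ^ (n + 4 * t) = int p ^ n] (mod int 5)" for n t
    using p_power_cong[of n t] by simp
  show ?thesis using m
  proof (induction m rule: less_induct)
    case (less m)
    define x r where "x = (m - 1) div 5" and "r = (m - 1) mod 5"
    have r: "r \<le> 4" using mod_less_divisor[of 5 "m - 1"] unfolding r_def by linarith
    have "m - 1 = 5 * x + r" by (simp add: x_def r_def)
    then have m: "m = 5 * x + 1 + r" using less.prems by linarith
    have nd: "\<not> 5 dvd 5 * x + 1 + i * 1" if "i < 4" for i
    proof -
      have "\<not> 5 dvd 1 + i" using that by (intro nat_dvd_not_less) auto
      then show ?thesis using dvd_add_right_iff[of 5 "5 * x" "1 + i"] by simp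
    qed
    have "eig (5 * x + 1) (int p ^ x * (1 + int p))"
    proof (cases "x = 0")
      case True
      have "eig 1 (1 + int p ^ (6 * 1 - 1))" by (rule eig_small_weight) simp_all
      moreover have "[1 + int p ^ (6 * 1 - 1) = 1 + int p] (mod int 5)"
        using cong_add[OF cong_refl p5[of 1 1], of 1] by simp
      ultimately show ?thesis using True eig_cong by simp
    next
      case False
      have "x + 1 < m" using m False by simp
      from less.IH[OF this] have "eig (5 * (x + 1)) (int p ^ x * (1 + int p))"
        using eig_frobenius[of "x + 1"] by simp
      moreover obtain c where c: "eig (5 * x + 1) c" using eig_exists[of "5 * x + 1"] by auto
      have "eig (5 * x + 1 + 4 * 1) (int p ^ 4 * c)"
        by (rule eig_chain[OF c]) (use nd in auto)
      then have "eig (5 * (x + 1)) (int p ^ 4 * c)" by (simp add: add.commute)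
      ultimately have "[int p ^ 4 * c = int p ^ x * (1 + int p)] (mod int 5)"
        by (intro eig_unique)
      moreover have "[int p ^ 4 * c = 1 * c] (mod int 5)"
        using p5[of 0 1] by (intro cong_mult cong_refl) simp
      ultimately have "[c = int p ^ x * (1 + int p)] (mod int 5)"
        by (metis cong_sym cong_trans mult_1)
      with c show ?thesis by (rule eig_cong)
    qed
    then have "eig (5 * x + 1 + r * 1) (int p ^ r * (int p ^ x * (1 + int p)))"
      by (rule eig_chain) (use nd r in auto)
    then have "eig m (int p ^ r * (int p ^ x * (1 + int p)))" using m by simp
    moreover have "[int p ^ (m - 1) * (1 + int p) = int p ^ r * (int p ^ x * (1 + int p))] (mod int 5)"
    proof -
      have "m - 1 = (r + x) + 4 * x" using m by simp
      then have "[int p ^ (m - 1) = int p ^ (r + x)] (mod int 5)" using p5[of "r + x" x] by simp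
      from cong_mult[OF this cong_refl[of "1 + int p"]] show ?thesis by (simp add: power_add mult.assoc)
    qed
    ultimately show ?case using eig_cong cong_sym by blast
  qed
qed

text \<open>Theta steps keep the parity of m because s = 2. The odd sequence starts at E4 with 1 +
  p^3, the even one at E4^2 with 1 + p^7, which is 1 + p modulo 7.\<close>

definition val7 :: "nat \<Rightarrow> nat \<Rightarrow> int" where
  "val7 p m = (if even m then int p ^ ((m - 2) div 2) * (1 + int p) else int p ^ ((m - 1) div 2) * (1 + int p ^ 3))"

text \<open>Six theta steps lead from 7x + 2 to 7 (x + 2), meet no multiple of 7 before the end, and
  multiply by p^6 = 1; so Frobenius identifies the entries at 7x + 2 and x + 2. Odd m up to 7 and
  even m up to 14 are reached directly from 1 and 2.\<close>

lemma eig_7: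
  assumes p: "prime p" "p \<noteq> 7" and m: "m > 0"
  shows "hecke_mod.eig 7 p 4 eisen4 m (val7 p m)"
proof -
  interpret hecke_mod 7 p 2 4 eisen4 alpha7 beta7 alpha7 "- 1" by (rule hecke_mod_7[OF p])
  have p7: "[int p ^ (n + 6 * t) = int p ^ n] (mod int 7)" for n t
    using p_power_cong[of n t] by simp
  have nd: "\<not> 7 dvd 7 * x + 2 + i * 2" if "i < 6" for x i :: nat
  proof -
    have "coprime 7 (2::nat)" by simp
    moreover have "\<not> 7 dvd i + 1" using that by (intro nat_dvd_not_less) auto
    ultimately have "\<not> 7 dvd (i + 1) * 2" using coprime_dvd_mult_left_iff by blast
    then show ?thesis using dvd_add_right_iff[of 7 "7 * x" "(i + 1) * 2"] by (simp add: add.assoc)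
  qed
  show ?thesis using m
  proof (induction m rule: less_induct)
    case (less m)
    consider (odd) t where "m = 1 + t * 2" "t \<le> 3" | (even) t where "m = 2 + t * 2" "t \<le> 6"
      | (large) x i where "m = 7 * x + 2 + i * 2" "x > 0" "i \<le> 6"
    proof (cases "m \<le> 7 \<and> odd m")
      case True
      then obtain t where "m = 2 * t + 1" by (auto elim: oddE)
      with True that(1)[of t] show ?thesis by simp
    next
      case n1: False
      show ?thesis
      proof (cases "m \<le> 14 \<and> even m")
        case True
        then obtain t where "m = 2 * t" by (auto elim: evenE)
        with True less.prems that(2)[of "t - 1"] show ?thesis by (cases t) auto
      next
        case n2: False
        \<comment> \<open>9 = 7 * 1 + 2 and 16 = 7 * 2 + 2 start the first odd and even blocks not
          yet covered. A block 7x + 2, ..., 7x + 14 of one parity spans 14 integers, so the next one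
          has x + 2 for x.\<close>
        define e where "e = (if odd m then 9 else 16 :: nat)"
        have "m \<ge> e" "even (m - e)"
        proof -
          show "m \<ge> e"
          proof (cases "odd m")
            case True
            with n1 have "m \<ge> 8" "m \<noteq> 8" by auto
            with True show ?thesis by (simp add: e_def)
          next
            case False
            with n2 have "m \<ge> 15" "m \<noteq> 15" by auto
            with False show ?thesis by (simp add: e_def)
          qed
          then show "even (m - e)" by (simp add: e_def split: if_splits)
        qed
        from \<open>even (m - e)\<close> obtain y where "m - e = 2 * y" by (rule evenE)
        with \<open>m \<ge> e\<close> have y: "m = e + 2 * y" by linarith
        define q i where "q = y div 7" and "i = y mod 7"
        have "y = 7 * q + i" "i < 7" by (simp_all add: q_def i_def)
        then have "m = 7 * ((if odd m then 1 else 2) + 2 * q) + 2 + i * 2" "i \<le> 6"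
          using y by (simp_all add: e_def split: if_splits)
        then show ?thesis using that(3)[of "(if odd m then 1 else 2) + 2 * q" i] by simp
      qed
    qed
    then show ?case
    proof cases
      case odd
      have "eig 1 (1 + int p ^ (4 * 1 - 1))" by (rule eig_small_weight) simp_all
      then have "eig (1 + t * 2) (int p ^ t * (1 + int p ^ (4 * 1 - 1)))"
      proof (rule eig_chain)
        show "\<not> 7 dvd 1 + i * 2" if "i < t" for i using that odd by (intro nat_dvd_not_less) auto
      qed simp
      then show ?thesis by (simp add: odd val7_def)
    next
      case even
      have "eig 2 (1 + int p ^ (4 * 2 - 1))" by (rule eig_small_weight) simp_all
      then have "eig (2 + t * 2) (int p ^ t * (1 + int p ^ (4 * 2 - 1)))"
        by (rule eig_chain) (use nd[of _ 0] even in auto)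
      moreover have "[int p ^ t * (1 + int p ^ (4 * 2 - 1)) = int p ^ t * (1 + int p)] (mod int 7)"
        using p7[of 1 1] by (intro cong_mult cong_add cong_refl) simp
      ultimately show ?thesis using eig_cong by (simp add: even val7_def)
    next
      case large
      have "x + 2 < m" using large by simp
      from less.IH[OF this] have "eig (7 * (x + 2)) (val7 p (x + 2))"
        using eig_frobenius[of "x + 2"] by simp
      moreover obtain c where c: "eig (7 * x + 2) c" using eig_exists[of "7 * x + 2"] by auto
      have "eig (7 * x + 2 + 6 * 2) (int p ^ 6 * c)"
        by (rule eig_chain[OF c]) (use nd in auto)
      then have "eig (7 * (x + 2)) (int p ^ 6 * c)" by (simp add: add.commute)
      ultimately have "[int p ^ 6 * c = val7 p (x + 2)] (mod int 7)" by (intro eig_unique)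
      moreover have "[int p ^ 6 * c = 1 * c] (mod int 7)"
        using p7[of 0 1] by (intro cong_mult cong_refl) simp
      ultimately have cv: "[c = val7 p (x + 2)] (mod int 7)"
        by (metis cong_sym cong_trans mult_1)
      have "eig (7 * x + 2 + i * 2) (int p ^ i * c)"
        by (rule eig_chain[OF c]) (use nd large in auto)
      then have "eig m (int p ^ i * c)" by (simp add: large)
      moreover have "[int p ^ i * c = val7 p m] (mod int 7)"
      proof -
        have "[int p ^ i * c = int p ^ i * val7 p (x + 2)] (mod int 7)" by (intro cong_mult cong_refl cv)
        also have "[int p ^ i * val7 p (x + 2) = val7 p m] (mod int 7)"
        proof (cases "even x")
          case True
          then obtain u where u: "x = 2 * u" by (auto elim: evenE)
          have "m = 2 + 2 * (i + u + 6 * u)" by (simp add: large u)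
          then have "val7 p m = int p ^ (i + u + 6 * u) * (1 + int p)" by (simp add: val7_def)
          moreover have "int p ^ i * val7 p (x + 2) = int p ^ (i + u) * (1 + int p)"
            by (simp add: val7_def u power_add)
          ultimately show ?thesis using cong_mult[OF cong_sym[OF p7[of "i + u" u]] cong_refl[of "1 + int p"]] by simp
        next
          case False
          then obtain u where u: "x = 2 * u + 1" by (auto elim: oddE)
          \<comment> \<open>For odd x the closed form at m carries an additional p^3, absorbed by
            p^3 (1 + p^3) = 1 + p^3 modulo 7.\<close>
          have "m = 1 + 2 * (i + u + 1 + 3 + 6 * u)" by (simp add: large u)
          then have v: "val7 p m = int p ^ (i + u + 1 + 3 + 6 * u) * (1 + int p ^ 3)" by (simp add: val7_def add_ac)
          have "x + 2 = 1 + 2 * (u + 1)" by (simp add: u)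
          then have "val7 p (x + 2) = int p ^ (u + 1) * (1 + int p ^ 3)" by (simp add: val7_def)
          then have v': "int p ^ i * val7 p (x + 2) = int p ^ (i + u + 1) * (1 + int p ^ 3)"
            by (simp add: power_add)
          have "[val7 p m = int p ^ (i + u + 1 + 3) * (1 + int p ^ 3)] (mod int 7)"
            unfolding v by (intro cong_mult p7 cong_refl)
          also have "int p ^ (i + u + 1 + 3) * (1 + int p ^ 3) = int p ^ (i + u + 1) * (int p ^ 3 + int p ^ (0 + 6 * 1))"
          proof -
            have "int p ^ (0 + 6 * 1) = int p ^ 3 * int p ^ 3" by (simp flip: power_add)
            then show ?thesis by (simp only: power_add[of _ "i + u + 1"] distrib_left mult_1_right mult.assoc)
          qed
          also have "[\<dots> = int p ^ (i + u + 1) * (int p ^ 3 + int p ^ 0)] (mod int 7)"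
            by (intro cong_mult cong_add cong_refl p7)
          finally show ?thesis unfolding v' by (simp add: cong_sym add.commute)
        qed
        finally show ?thesis .
      qed
      ultimately show ?thesis by (rule eig_cong)
    qed
  qed
qed

text \<open>The entry p^(n - 1) (1 + p) at n = 2 j + \<open>beta5 k\<close>, with p and k replaced
  by their residues r and s. Adding 3 instead of subtracting 1 avoids truncated subtraction.\<close>

definition root5 :: "nat \<Rightarrow> nat \<Rightarrow> nat \<Rightarrow> int" where
  "root5 r s j = int r ^ ((2 * j + (if s = 2 then 1 else 0) + 3) mod 4) * (1 + int r)"

text \<open>The entry \<open>val7\<close> at n = 3 j + \<open>alpha7 k\<close>, again through
  residues. The exponents (n - 2) / 2 and (n - 1) / 2 are raised by 6 before reduction, for the same
  reason.\<close>

definition root7 :: "nat \<Rightarrow> nat \<Rightarrow> nat \<Rightarrow> int" where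
  "root7 r s j = (let n = 3 * j + s mod 3 in
     if even n then int r ^ ((n + 10) div 2 mod 6) * (1 + int r) else int r ^ ((n + 11) div 2 mod 6) * (1 + int r ^ 3))"

lemma power_cong_mod:
  assumes "prime l" "\<not> l dvd p"
  shows "[int p ^ n = int (p mod l) ^ (n mod (l - 1))] (mod int l)"
proof -
  have "[p ^ (l - 1) = 1] (mod l)" by (rule fermat_little[OF assms])
  then have "[(p ^ (l - 1)) ^ (n div (l - 1)) = 1 ^ (n div (l - 1))] (mod l)" by (rule cong_pow)
  then have "[p ^ (n mod (l - 1)) * (p ^ (l - 1)) ^ (n div (l - 1)) = (p mod l) ^ (n mod (l - 1)) * 1] (mod l)"
    by (intro cong_mult cong_pow) (simp_all add: cong_def)
  moreover have "p ^ (n mod (l - 1)) * (p ^ (l - 1)) ^ (n div (l - 1)) = p ^ n"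
    by (simp add: power_add[symmetric] power_mult[symmetric])
  ultimately have "[p ^ n = (p mod l) ^ (n mod (l - 1))] (mod l)" by simp
  then have "[int (p ^ n) = int ((p mod l) ^ (n mod (l - 1)))] (mod int l)" by (simp only: cong_int_iff)
  then show ?thesis by simp
qed

lemma hecke_poly_5:
  assumes p: "prime p" "p \<noteq> 5" and k: "even k" "k > 0"
  shows "poly_cong 5 (hecke_poly p k) (\<Prod>j = 1..cusp_dim k. [:- of_int (root5 (p mod 5) (k mod 4) j), 1:])"
proof (rule hecke_poly_triangular[OF weight_split_5 k p(1)])
  fix j :: nat assume j: "j \<ge> 1" "j < mdim k"
  interpret hecke_mod 5 p 1 6 eisen6 alpha5 beta5 beta5 "- 2" by (rule hecke_mod_5[OF p])
  define n where "n = 2 * j + beta5 k"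
  have n: "n > 0" using j by (simp add: n_def)
  have "eig n (int p ^ (n - 1) * (1 + int p))" by (rule eig_5[OF p n])
  moreover have "Suc 1 * j + beta5 k = n" by (simp add: n_def)
  ultimately have e: "eig (Suc 1 * j + beta5 k) (int p ^ (n - 1) * (1 + int p))" by (simp only:)
  obtain m where m: "[m j = int p ^ (n - 1) * (1 + int p)] (mod int 5)"
    "fps_cong 5 (hecke_fps p k (gbasis alpha5 beta5 k j)) (\<Sum>i<Suc j. fps_const (m i) * gbasis alpha5 beta5 k i)"
    using hecke_gbasis_triangular[OF k j(2) _ e] j(1) by auto
  have nd: "\<not> 5 dvd p" using lp .
  have beta: "beta5 k = (if k mod 4 = 2 then 1 else 0)"
    using even_mod_4[OF k(1)] by (auto simp: beta5_def)
  have "(n - 1) mod (5 - 1) = (2 * j + (if k mod 4 = 2 then 1 else 0) + 3) mod 4"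
  proof -
    have "2 * j + (if k mod 4 = 2 then 1 else 0) + 3 = (n - 1) + 4" using n by (simp add: n_def beta)
    then show ?thesis by simp
  qed
  moreover have pr: "prime (5::nat)" by simp
  note pc = power_cong_mod[OF pr nd]
  have p1: "[1 + int p = 1 + int (p mod 5)] (mod int 5)"
    using pc[of 1] by (intro cong_add cong_refl) simp
  ultimately have "[int p ^ (n - 1) * (1 + int p) = root5 (p mod 5) (k mod 4) j] (mod int 5)"
    unfolding root5_def using cong_mult[OF pc[of "n - 1"] p1] by (simp only:)
  then have "[m j = root5 (p mod 5) (k mod 4) j] (mod int 5)" using m(1) cong_trans by blast
  with m(2) show "\<exists>c. [c j = root5 (p mod 5) (k mod 4) j] (mod int 5) \<and>
      fps_cong 5 (hecke_fps p k (gbasis alpha5 beta5 k j)) (\<Sum>i<Suc j. fps_const (c i) * gbasis alpha5 beta5 k i)"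
    by blast
qed

lemma hecke_poly_7:
  assumes p: "prime p" "p \<noteq> 7" and k: "even k" "k > 0"
  shows "poly_cong 7 (hecke_poly p k) (\<Prod>j = 1..cusp_dim k. [:- of_int (root7 (p mod 7) (k mod 6) j), 1:])"
proof (rule hecke_poly_triangular[OF weight_split_7 k p(1)])
  fix j :: nat assume j: "j \<ge> 1" "j < mdim k"
  interpret hecke_mod 7 p 2 4 eisen4 alpha7 beta7 alpha7 "- 1" by (rule hecke_mod_7[OF p])
  define n where "n = 3 * j + alpha7 k"
  have n: "n > 0" using j by (simp add: n_def)
  have "eig n (val7 p n)" by (rule eig_7[OF p n])
  then have e: "eig (Suc 2 * j + alpha7 k) (val7 p n)" by (simp add: n_def)
  obtain m where m: "[m j = val7 p n] (mod int 7)"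
    "fps_cong 7 (hecke_fps p k (gbasis alpha7 beta7 k j)) (\<Sum>i<Suc j. fps_const (m i) * gbasis alpha7 beta7 k i)"
    using hecke_gbasis_triangular[OF k j(2) _ e] j(1) by auto
  have nd: "\<not> 7 dvd p" using lp .
  have pr: "prime (7::nat)" by simp
  have a: "k mod 6 mod 3 = alpha7 k" by (simp add: alpha7_def mod_mod_cancel)
  note pc = power_cong_mod[OF pr nd, simplified]
  have p1: "[1 + int p = 1 + int (p mod 7)] (mod 7)" "[1 + int p ^ 3 = 1 + int (p mod 7) ^ 3] (mod 7)"
    using pc[of 1] pc[of 3] by (auto intro!: cong_add cong_refl)
  have "[val7 p n = root7 (p mod 7) (k mod 6) j] (mod int 7)"
  proof (cases "even n")
    case True
    then obtain u where u: "n = 2 * u" by (auto elim: evenE)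
    with n obtain v where v: "u = Suc v" by (cases u) auto
    have "(n + 10) div 2 mod 6 = (n - 2) div 2 mod 6" by (simp add: u v)
    with True show ?thesis unfolding val7_def root7_def a n_def[symmetric] Let_def
      using cong_mult[OF pc[of "(n - 2) div 2"] p1(1)] by simp
  next
    case False
    then obtain u where u: "n = 2 * u + 1" by (auto elim: oddE)
    have "(n + 11) div 2 mod 6 = (n - 1) div 2 mod 6" by (simp add: u)
    with False show ?thesis unfolding val7_def root7_def a n_def[symmetric] Let_def
      using cong_mult[OF pc[of "(n - 1) div 2"] p1(2)] by simp
  qed
  then have "[m j = root7 (p mod 7) (k mod 6) j] (mod int 7)" using m(1) cong_trans by blast
  with m(2) show "\<exists>c. [c j = root7 (p mod 7) (k mod 6) j] (mod int 7) \<and>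
      fps_cong 7 (hecke_fps p k (gbasis alpha7 beta7 k j)) (\<Sum>i<Suc j. fps_const (c i) * gbasis alpha7 beta7 k i)"
    by blast
qed

section \<open>Elliptic points: Hecke operators modulo 2 and 3\<close>

text \<open>Newton's identities as generating functions: the logarithmic derivative of the product
  is minus the series of power sums.\<close>

lemma newton_fps:
  fixes w :: "'r \<Rightarrow> complex"
  assumes "finite R"
  shows "fps_X * fps_deriv (\<Prod>r\<in>R. 1 - fps_const (w r) * fps_X) =
    - (\<Prod>r\<in>R. 1 - fps_const (w r) * fps_X) * Abs_fps (\<lambda>j. if j = 0 then 0 else \<Sum>r\<in>R. w r ^ j)"
  using assms
proof (induction R)
  case empty
  have "Abs_fps (\<lambda>j. if j = 0 then 0 else \<Sum>r\<in>{}. w r ^ j) = 0" by (simp add: fps_eq_iff)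
  then show ?case by simp
next
  case (insert x R)
  let ?P = "\<Prod>r\<in>R. 1 - fps_const (w r) * fps_X" and ?a = "1 - fps_const (w x) * fps_X"
  let ?Q = "Abs_fps (\<lambda>j. if j = 0 then 0 else \<Sum>r\<in>R. w r ^ j)"
  let ?G = "Abs_fps (\<lambda>j. if j = 0 then 0 else w x ^ j)"
  have Q: "Abs_fps (\<lambda>j. if j = 0 then 0 else \<Sum>r\<in>insert x R. w r ^ j) = ?Q + ?G"
    using insert by (auto simp: fps_eq_iff)
  have G: "?a * ?G = fps_const (w x) * fps_X"
  proof -
    have "?a * ?G = ?G - fps_const (w x) * (fps_X * ?G)" by (simp add: algebra_simps)
    also have "\<dots> = fps_const (w x) * fps_X"
    proof (rule fps_ext)
      fix n
      show "fps_nth (?G - fps_const (w x) * (fps_X * ?G)) n = fps_nth (fps_const (w x) * fps_X) n"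
        by (cases n; cases "n - 1") simp_all
    qed
    finally show ?thesis .
  qed
  have "fps_X * fps_deriv (?a * ?P) = ?a * (fps_X * fps_deriv ?P) - (fps_const (w x) * fps_X) * ?P"
    by (simp add: algebra_simps)
  also have "?a * (fps_X * fps_deriv ?P) = ?a * (- ?P * ?Q)" by (simp only: insert.IH)
  also have "?a * (- ?P * ?Q) - (fps_const (w x) * fps_X) * ?P = ?a * (- ?P * ?Q) - (?a * ?G) * ?P" by (simp only: G)
  also have "a * (- P * Q) - (a * G) * P = - (a * P) * (Q + G)" for a P Q G :: "complex fps"
    by (simp add: algebra_simps)
  finally show ?case using insert unfolding Q by simp
qed

lemma prod_linear_fps_nth:
  fixes w :: "'r \<Rightarrow> complex"
  assumes "finite R" "n > card R"
  shows "fps_nth (\<Prod>r\<in>R. 1 - fps_const (w r) * fps_X) n = 0"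
  using assms
proof (induction R arbitrary: n)
  case (insert x R)
  have "(1 - fps_const (w x) * fps_X) * A = A - fps_const (w x) * (fps_X * A)" for A
    by (simp add: algebra_simps)
  with insert show ?case by (cases n) simp_all
qed simp

text \<open>
  Newton's identities give \<open>d\<^sup>m m! e\<^sub>m \<equiv> (- d S\<^sub>1)\<^sup>m (mod d)\<close> for the elementary symmetric functions
  \<open>e\<^sub>m\<close> (up to sign), and \<open>e\<^sub>m\<close> vanishes for large \<open>m\<close>.
\<close>
lemma power_sum_integral:
  fixes w :: "'r \<Rightarrow> complex"
  assumes d: "prime d" and R: "finite R"
    and int: "\<And>j. j \<ge> 1 \<Longrightarrow> of_nat d * (\<Sum>r\<in>R. w r ^ j) \<in> \<int>"
  shows "(\<Sum>r\<in>R. w r) \<in> \<int>"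
proof -
  define S where "S = (\<lambda>j. \<Sum>r\<in>R. w r ^ j)"
  define P where "P = (\<Prod>r\<in>R. 1 - fps_const (w r) * fps_X)"
  define e where "e = (\<lambda>m. of_nat d ^ m * fact m * fps_nth P m)"
  define N where "N = (\<lambda>j. \<lfloor>Re (of_nat d * S j)\<rfloor>)"
  have N: "of_nat d * S j = of_int (N j)" if "j \<ge> 1" for j
  proof -
    have "of_nat d * S j \<in> \<int>" using int[OF that] unfolding S_def .
    then obtain z where z: "of_nat d * S j = of_int z" by (rule Ints_cases)
    have "N j = z" unfolding N_def z by simp
    with z show ?thesis by simp
  qed
  have P0: "fps_nth P 0 = 1"
    unfolding P_def using R by (induction R) (simp_all add: fps_mult_nth_0)
  have newton: "of_nat m * fps_nth P m = - (\<Sum>i=1..m. S i * fps_nth P (m - i))" for m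
  proof -
    have "of_nat m * fps_nth P m = fps_nth (fps_X * fps_deriv P) m"
      by (cases m) simp_all
    also have "\<dots> = fps_nth (- P * Abs_fps (\<lambda>j. if j = 0 then 0 else S j)) m"
      by (simp only: P_def S_def newton_fps[OF R])
    also have "\<dots> = - fps_nth (Abs_fps (\<lambda>j. if j = 0 then 0 else S j) * P) m"
      by (simp only: mult_minus_left fps_neg_nth mult.commute)
    also have "fps_nth (Abs_fps (\<lambda>j. if j = 0 then 0 else S j) * P) m =
        (\<Sum>i=0..m. (if i = 0 then 0 else S i) * fps_nth P (m - i))" by (simp add: fps_mult_nth)
    also have "\<dots> = (\<Sum>i=1..m. S i * fps_nth P (m - i))"
      by (rule sum.mono_neutral_cong_right) auto
    finally show ?thesis .
  qed
  \<comment> \<open>Of the factor d^m, one d makes d S_i integral, d^(m - i) goes into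
    \<open>e (m - i)\<close>, and d^(i - 1) is left over. So modulo d only the term i = 1
    survives.\<close>
  have rec: "e m = - (\<Sum>i=1..m. of_nat (d ^ (i - 1) * (fact (m - 1) div fact (m - i))) * of_int (N i) * e (m - i))"
    if m: "m > 0" for m
  proof -
    have "e m = of_nat d ^ m * fact (m - 1) * (of_nat m * fps_nth P m)"
      using fact_reduce[OF m, where 'a = complex] by (simp only: e_def mult_ac)
    also have "\<dots> = - (\<Sum>i=1..m. of_nat d ^ m * fact (m - 1) * (S i * fps_nth P (m - i)))"
      unfolding newton by (simp only: sum_distrib_left mult_minus_right)
    also have "(\<Sum>i=1..m. of_nat d ^ m * fact (m - 1) * (S i * fps_nth P (m - i))) =
        (\<Sum>i=1..m. of_nat (d ^ (i - 1) * (fact (m - 1) div fact (m - i))) * of_int (N i) * e (m - i))"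
    proof (rule sum.cong)
      fix i assume i: "i \<in> {1..m}"
      define q :: nat where "q = fact (m - 1) div fact (m - i)"
      have "(fact (m - i) :: nat) dvd fact (m - 1)" using i by (intro fact_dvd) auto
      then have "(fact (m - 1) :: nat) = q * fact (m - i)" by (simp add: q_def)
      then have "of_nat (fact (m - 1)) = (of_nat (q * fact (m - i)) :: complex)" by (rule arg_cong)
      then have f: "fact (m - 1) = (of_nat q * fact (m - i) :: complex)" by simp
      have dm: "of_nat d ^ m = (of_nat d ^ (i - 1) * of_nat d * of_nat d ^ (m - i) :: complex)"
      proof -
        have "m = (i - 1) + 1 + (m - i)" using i by simp
        then have "of_nat d ^ m = (of_nat d ^ ((i - 1) + 1 + (m - i)) :: complex)" by (rule arg_cong)
        then show ?thesis by (simp only: power_add power_one_right)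
      qed
      have "of_nat d ^ m * fact (m - 1) * (S i * fps_nth P (m - i)) =
         of_nat d ^ (i - 1) * of_nat q * (of_nat d * S i) * (of_nat d ^ (m - i) * fact (m - i) * fps_nth P (m - i))"
        unfolding f dm by (simp only: mult_ac)
      also have "\<dots> = of_nat (d ^ (i - 1) * q) * of_int (N i) * e (m - i)"
        using N[of i] i by (simp add: e_def)
      finally show "of_nat d ^ m * fact (m - 1) * (S i * fps_nth P (m - i)) =
         of_nat (d ^ (i - 1) * (fact (m - 1) div fact (m - i))) * of_int (N i) * e (m - i)" by (simp only: q_def)
    qed simp
    finally show ?thesis .
  qed
  define E where "E = (\<lambda>m. \<lfloor>Re (e m)\<rfloor>)"
  have E: "e m = of_int (E m) \<and> [E m = (- N 1) ^ m] (mod int d)" for m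
  proof (induction m rule: less_induct)
    case (less m)
    show ?case
    proof (cases "m = 0")
      case True
      then have "e m = 1" by (simp add: e_def P0)
      then show ?thesis by (simp add: E_def True)
    next
      case False
      define T where "T = (\<lambda>i. int (d ^ (i - 1) * (fact (m - 1) div fact (m - i))) * N i * E (m - i))"
      have "(\<Sum>i=1..m. of_nat (d ^ (i - 1) * (fact (m - 1) div fact (m - i))) * of_int (N i) * e (m - i)) =
          (\<Sum>i=1..m. of_int (T i))"
      proof (rule sum.cong)
        fix i assume "i \<in> {1..m}"
        then have "e (m - i) = of_int (E (m - i))" using less by simp
        then show "of_nat (d ^ (i - 1) * (fact (m - 1) div fact (m - i))) * of_int (N i) * e (m - i) = of_int (T i)"
          by (simp only: T_def of_int_mult of_int_of_nat_eq)
      qed simp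
      then have "e m = - (\<Sum>i=1..m. of_int (T i))" using rec[of m] False by simp
      then have em: "e m = of_int (- (\<Sum>i=1..m. T i))" by simp
      then have Em: "E m = - (\<Sum>i=1..m. T i)" by (simp add: E_def del: of_int_sum of_int_minus)
      obtain m' where m': "m = Suc m'" using False by (cases m) auto
      have "(\<Sum>i=1..m. T i) = T 1 + (\<Sum>i=2..m. T i)"
        using m' by (simp add: sum.atLeast_Suc_atMost numeral_2_eq_2)
      moreover have "int d dvd (\<Sum>i=2..m. T i)"
      proof (rule dvd_sum)
        fix i assume "i \<in> {2..m}"
        then have "d dvd d ^ (i - 1)" by (intro dvd_power) auto
        then have "int d dvd int (d ^ (i - 1) * (fact (m - 1) div fact (m - i)))"
          by (simp only: int_dvd_int_iff dvd_mult2)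
        then show "int d dvd T i" unfolding T_def by (simp only: dvd_mult2)
      qed
      moreover have "T 1 = N 1 * E m'" by (simp add: T_def m')
      ultimately have "[(\<Sum>i=1..m. T i) = N 1 * E m'] (mod int d)" by (simp add: cong_iff_dvd_diff)
      then have "[E m = - (N 1 * E m')] (mod int d)" unfolding Em by (simp only: cong_minus_minus_iff)
      also have "[- (N 1 * E m') = - (N 1 * (- N 1) ^ m')] (mod int d)"
        unfolding cong_minus_minus_iff using less[of m'] m' by (intro cong_mult cong_refl) simp
      finally have "[E m = (- N 1) ^ m] (mod int d)" by (simp add: m')
      with em Em show ?thesis by simp
    qed
  qed
  have "e (Suc (card R)) = 0" using prod_linear_fps_nth[OF R, of "Suc (card R)"] by (simp add: e_def P_def)
  then have "E (Suc (card R)) = 0" by (simp add: E_def)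
  with E[of "Suc (card R)"] have "[0 = (- N 1) ^ Suc (card R)] (mod int d)" by (simp only:)
  then have "int d dvd (- N 1) ^ Suc (card R)" by (metis cong_0_iff cong_sym)
  then have "int d dvd - N 1" by (rule prime_dvd_power[rotated]) (use d in simp)
  then obtain t where t: "N 1 = int d * t" by auto
  have "of_nat d * S 1 = of_nat d * of_int t" using N[of 1] unfolding t by simp
  moreover have "(of_nat d :: complex) \<noteq> 0" using d prime_gt_0_nat by auto
  ultimately have "S 1 = of_int t" by simp
  then show ?thesis by (simp add: S_def)
qed

text \<open>The hypothesis is stable under replacing each w r by its j-th power.\<close>

lemma power_sum_integral_power:
  fixes w :: "'r \<Rightarrow> complex"
  assumes "prime d" "finite R" "\<And>j. j \<ge> 1 \<Longrightarrow> of_nat d * (\<Sum>r\<in>R. w r ^ j) \<in> \<int>" "j \<ge> 1"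
  shows "(\<Sum>r\<in>R. w r ^ j) \<in> \<int>"
proof (rule power_sum_integral[OF assms(1,2)])
  fix i :: nat assume "i \<ge> 1"
  with assms(4) have "j * i \<ge> 1" by simp
  from assms(3)[OF this] show "of_nat d * (\<Sum>r\<in>R. (w r ^ j) ^ i) \<in> \<int>"
    by (simp only: power_mult)
qed

lemma sum_involution:
  fixes \<sigma> :: "nat \<Rightarrow> nat" and V :: "nat \<Rightarrow> complex"
  assumes B: "finite B" and \<sigma>: "\<And>b. b \<in> B \<Longrightarrow> \<sigma> b \<in> B" "\<And>b. b \<in> B \<Longrightarrow> \<sigma> (\<sigma> b) = b" "\<And>b. b \<in> B \<Longrightarrow> \<sigma> b \<noteq> b"
    and V: "\<And>b. b \<in> B \<Longrightarrow> V (\<sigma> b) = V b"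
  shows "(\<Sum>b\<in>B. V b ^ j) = 2 * (\<Sum>b | b \<in> B \<and> b < \<sigma> b. V b ^ j)"
proof -
  define R where "R = {b. b \<in> B \<and> b < \<sigma> b}"
  have R: "finite R" using B by (simp add: R_def)
  have inj: "inj_on \<sigma> B" by (rule inj_on_inverseI[of _ \<sigma>]) (rule \<sigma>(2))
  have "B = R \<union> \<sigma> ` R"
  proof (intro equalityI subsetI)
    fix b assume b: "b \<in> B"
    show "b \<in> R \<union> \<sigma> ` R"
    proof (cases "b < \<sigma> b")
      case False
      then have "\<sigma> b < \<sigma> (\<sigma> b)" using \<sigma>(2,3)[OF b] by simp
      then have "\<sigma> b \<in> R" using \<sigma>(1)[OF b] by (simp add: R_def)
      then show ?thesis using \<sigma>(2)[OF b] by (metis UnI2 imageI)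
    qed (use b in \<open>simp add: R_def\<close>)
  qed (use \<sigma>(1) in \<open>auto simp: R_def\<close>)
  moreover have "R \<inter> \<sigma> ` R = {}" using \<sigma>(2) by (auto simp: R_def)
  ultimately have "(\<Sum>b\<in>B. V b ^ j) = (\<Sum>b\<in>R. V b ^ j) + (\<Sum>b\<in>\<sigma> ` R. V b ^ j)"
    using R by (simp add: sum.union_disjoint)
  also have "(\<Sum>b\<in>\<sigma> ` R. V b ^ j) = (\<Sum>b\<in>R. V (\<sigma> b) ^ j)"
    by (rule sum.reindex_cong[OF inj_on_subset[OF inj]]) (auto simp: R_def)
  also have "\<dots> = (\<Sum>b\<in>R. V b ^ j)" by (rule sum.cong) (auto simp: R_def V)
  finally show ?thesis by (simp add: R_def)
qed

text \<open>The least element represents an orbit; a point moved by a map of order 3 has an orbit of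
  exactly three.\<close>

lemma sum_order_3:
  fixes \<sigma> :: "nat \<Rightarrow> nat" and V :: "nat \<Rightarrow> complex"
  assumes B: "finite B" and \<sigma>: "\<And>b. b \<in> B \<Longrightarrow> \<sigma> b \<in> B" "\<And>b. b \<in> B \<Longrightarrow> \<sigma> (\<sigma> (\<sigma> b)) = b" "\<And>b. b \<in> B \<Longrightarrow> \<sigma> b \<noteq> b"
    and V: "\<And>b. b \<in> B \<Longrightarrow> V (\<sigma> b) = V b"
  shows "(\<Sum>b\<in>B. V b ^ j) = 3 * (\<Sum>b | b \<in> B \<and> b < \<sigma> b \<and> b < \<sigma> (\<sigma> b). V b ^ j)"
proof -
  define R where "R = {b. b \<in> B \<and> b < \<sigma> b \<and> b < \<sigma> (\<sigma> b)}"
  have R: "finite R" "R \<subseteq> B" using B by (auto simp: R_def)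
  have inj: "inj_on \<sigma> B" by (rule inj_on_inverseI[of _ "\<lambda>b. \<sigma> (\<sigma> b)"]) (rule \<sigma>(2))
  have sR: "\<sigma> ` R \<subseteq> B" "\<sigma> ` \<sigma> ` R \<subseteq> B" using R(2) \<sigma>(1) by auto
  have "B \<subseteq> R \<union> (\<sigma> ` R \<union> \<sigma> ` \<sigma> ` R)"
  proof
    fix b assume b: "b \<in> B"
    define c e where "c = \<sigma> b" and "e = \<sigma> c"
    have ce: "c \<in> B" "e \<in> B" "\<sigma> e = b" "b \<noteq> c" "c \<noteq> e" "e \<noteq> b"
      using \<sigma>(1)[OF b] \<sigma>(1)[OF \<sigma>(1)[OF b]] \<sigma>(2)[OF b] \<sigma>(3)[OF b] \<sigma>(3)[OF \<sigma>(1)[OF b]]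
        \<sigma>(3)[OF \<sigma>(1)[OF \<sigma>(1)[OF b]]] by (auto simp: c_def e_def)
    have s: "\<sigma> b = c" "\<sigma> c = e" by (simp_all add: c_def e_def)
    consider "b < c" "b < e" | "c < b" "c < e" | "e < b" "e < c" using ce by linarith
    then show "b \<in> R \<union> (\<sigma> ` R \<union> \<sigma> ` \<sigma> ` R)"
    proof cases
      case 1 then show ?thesis using b by (simp add: R_def s)
    next
      case 2
      then have "c \<in> R" using ce by (simp add: R_def s)
      then have "\<sigma> (\<sigma> c) \<in> \<sigma> ` \<sigma> ` R" by blast
      then show ?thesis by (simp add: s ce)
    next
      case 3
      then have "e \<in> R" using ce by (simp add: R_def s)
      then have "\<sigma> e \<in> \<sigma> ` R" by blast
      then show ?thesis by (simp add: ce)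
    qed
  qed
  then have "B = R \<union> (\<sigma> ` R \<union> \<sigma> ` \<sigma> ` R)" using R sR by blast
  moreover have "\<sigma> ` R \<inter> \<sigma> ` \<sigma> ` R = {}" "R \<inter> (\<sigma> ` R \<union> \<sigma> ` \<sigma> ` R) = {}"
  proof -
    have 1: "\<sigma> b \<notin> R" if "b \<in> R" for b using that \<sigma>(2)[of b] by (auto simp: R_def)
    have 2: "\<sigma> (\<sigma> b) \<notin> R" if "b \<in> R" for b using that \<sigma>(2)[of b] by (auto simp: R_def)
    show "R \<inter> (\<sigma> ` R \<union> \<sigma> ` \<sigma> ` R) = {}" using 1 2 by blast
    have "R \<inter> \<sigma> ` R = {}" using 1 by blast
    moreover have "\<sigma> ` R \<inter> \<sigma> ` \<sigma> ` R = \<sigma> ` (R \<inter> \<sigma> ` R)"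
      by (rule inj_on_image_Int[OF inj R(2) sR(1), symmetric])
    ultimately show "\<sigma> ` R \<inter> \<sigma> ` \<sigma> ` R = {}" by simp
  qed
  ultimately have "(\<Sum>b\<in>B. V b ^ j) = (\<Sum>b\<in>R. V b ^ j) + ((\<Sum>b\<in>\<sigma> ` R. V b ^ j) + (\<Sum>b\<in>\<sigma> ` \<sigma> ` R. V b ^ j))"
    using R by (simp add: sum.union_disjoint)
  also have "(\<Sum>b\<in>\<sigma> ` X. V b ^ j) = (\<Sum>b\<in>X. V b ^ j)" if "X \<subseteq> B" for X
  proof -
    have "(\<Sum>b\<in>\<sigma> ` X. V b ^ j) = (\<Sum>b\<in>X. V (\<sigma> b) ^ j)"
      by (rule sum.reindex_cong[OF inj_on_subset[OF inj that]]) auto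
    also have "\<dots> = (\<Sum>b\<in>X. V b ^ j)" by (rule sum.cong) (use that V in auto)
    finally show ?thesis .
  qed
  note this[OF sR(1)]
  also have "(\<Sum>b\<in>\<sigma> ` R. V b ^ j) = (\<Sum>b\<in>R. V b ^ j)"
  proof -
    have "(\<Sum>b\<in>\<sigma> ` R. V b ^ j) = (\<Sum>b\<in>R. V (\<sigma> b) ^ j)"
      by (rule sum.reindex_cong[OF inj_on_subset[OF inj R(2)]]) auto
    also have "\<dots> = (\<Sum>b\<in>R. V b ^ j)" by (rule sum.cong) (use R V in auto)
    finally show ?thesis .
  qed
  finally show ?thesis by (simp add: R_def)
qed

text \<open>The coefficients are real. This makes Delta real at the elliptic points and gives
  conjugate values at the two stable lattices.\<close>

lemma qfun_reflect:
  assumes "Im z > 0" "conv_disc (cfps A)"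
  shows "qfun (cfps A) (- cnj z) = cnj (qfun (cfps A) z)"
proof -
  have n: "nome (- cnj z) = cnj (nome z)"
    by (simp add: nome_def exp_cnj)
  have z': "Im (- cnj z) > 0" using assms by simp
  have "(\<lambda>n. fps_nth (cfps A) n * nome (- cnj z) ^ n) sums qfun (cfps A) (- cnj z)"
    by (rule qfun_sums[OF assms(2) z'])
  moreover have "(\<lambda>n. cnj (fps_nth (cfps A) n * nome z ^ n)) sums cnj (qfun (cfps A) z)"
    using qfun_sums[OF assms(2,1)] by (simp only: sums_cnj)
  then have "(\<lambda>n. fps_nth (cfps A) n * nome (- cnj z) ^ n) sums cnj (qfun (cfps A) z)"
    by (simp add: n)
  ultimately show ?thesis by (rule sums_unique2)
qed

abbreviation "qdelta \<equiv> qfun (cfps delta)"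

lemma gbasis_top_12: "\<alpha> 0 = 0 \<Longrightarrow> \<beta> 0 = 0 \<Longrightarrow> gbasis \<alpha> \<beta> (12 * j) j = delta ^ j"
  by (simp add: gbasis_def)

lemma weight_split_0: "weight_split \<alpha> \<beta> \<Longrightarrow> \<alpha> 0 = 0 \<and> \<beta> 0 = 0"
  unfolding weight_split_def by (drule spec[of _ 0]) simp

lemma hecke_delta_power_expansion:
  assumes ws: "weight_split \<alpha> \<beta>" and p: "prime p" and j: "j \<ge> 1"
  shows "\<exists>m. hecke_fps p (12 * j) (delta ^ j) = (\<Sum>i<Suc j. fps_const (m i) * gbasis \<alpha> \<beta> (12 * j) i)"
proof -
  have md: "mdim (12 * j) = Suc j" by (simp add: mdim_def)
  have "cfps (delta ^ j) \<in> mod_forms (12 * j)"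
    using mod_forms_power[OF delta_mod_form, of j] by (simp add: mult.commute)
  then have "cfps (hecke_fps p (12 * j) (delta ^ j)) \<in> mod_forms (12 * j)"
    unfolding cfps_hecke_fps by (rule hecke_fps_mod_form) (use p j in auto)
  from int_mod_form_expansion[OF ws _ this] show ?thesis unfolding md by (metis dvd_mult2 even_numeral)
qed

text \<open>
  At a zero \<open>\<tau>\<close> of all the lower basis elements the top coefficient of \<open>T\<^sub>p \<Delta>\<^sup>j\<close> is a power sum
  of values of \<open>\<Delta>\<close> at the lattices of index \<open>p\<close>.
\<close>
lemma hecke_delta_value:
  assumes ws: "weight_split \<alpha> \<beta>" and p: "prime p" and j: "j \<ge> 1" and \<tau>: "Im \<tau> > 0"
    and zero: "\<And>i. i < j \<Longrightarrow> qfun (cfps (gbasis \<alpha> \<beta> (12 * j) i)) \<tau> = 0"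
    and m: "hecke_fps p (12 * j) (delta ^ j) = (\<Sum>i<Suc j. fps_const (m i) * gbasis \<alpha> \<beta> (12 * j) i)"
  shows "of_nat p * of_int (m j) = (of_nat p ^ 12 * qdelta (of_nat p * \<tau>) / qdelta \<tau>) ^ j +
     (\<Sum>b<p. (qdelta ((\<tau> + of_nat b) / of_nat p) / qdelta \<tau>) ^ j)"
proof -
  have p0: "p > 0" using p prime_gt_0_nat by blast
  have md: "mdim (12 * j) = Suc j" by (simp add: mdim_def)
  have cg: "conv_disc (cfps (gbasis \<alpha> \<beta> (12 * j) i))" if "i < Suc j" for i
    using gbasis_mod_form[OF ws, of "12 * j" i] that md by auto
  have top: "gbasis \<alpha> \<beta> (12 * j) j = delta ^ j" using weight_split_0[OF ws] by (intro gbasis_top_12) auto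
  have cd: "conv_disc (cfps (delta ^ j))" by simp
  have nz: "qdelta \<tau> \<noteq> 0" by (rule delta_nonzero[OF \<tau>])
  have "qfun (cfps (hecke_fps p (12 * j) (delta ^ j))) \<tau> =
      (\<Sum>i<Suc j. of_int (m i) * qfun (cfps (gbasis \<alpha> \<beta> (12 * j) i)) \<tau>)"
    unfolding m cfps_sum using cg \<tau>
    by (subst qfun_sum) (auto simp: qfun_mult intro!: sum.cong conv_disc_mult simp del: sum.lessThan_Suc)
  also have "\<dots> = of_int (m j) * qdelta \<tau> ^ j"
    using zero \<tau> by (simp add: top qfun_power)
  finally have "hecke_val p (12 * j) (cfps (delta ^ j)) \<tau> = of_int (m j) * qdelta \<tau> ^ j"
    unfolding cfps_hecke_fps using qfun_hecke_fps[OF cd p0 \<tau>] by simp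
  then have "of_int (m j) * qdelta \<tau> ^ j = of_nat p ^ (12 * j - 1) * qdelta (of_nat p * \<tau>) ^ j +
      (\<Sum>b<p. qdelta ((\<tau> + of_nat b) / of_nat p) ^ j) / of_nat p"
    unfolding hecke_val_def using \<tau> p0 by (simp add: qfun_power)
  then have "of_nat p * (of_int (m j) * qdelta \<tau> ^ j) = of_nat p * of_nat p ^ (12 * j - 1) * qdelta (of_nat p * \<tau>) ^ j +
      (\<Sum>b<p. qdelta ((\<tau> + of_nat b) / of_nat p) ^ j)"
    using p0 by (simp add: distrib_left mult.assoc)
  also have "of_nat p * of_nat p ^ (12 * j - 1) = ((of_nat p ^ 12) ^ j :: complex)"
    using j by (simp add: power_mult[symmetric] power_Suc[symmetric] del: power_Suc)
  finally have "of_nat p * of_int (m j) = ((of_nat p ^ 12) ^ j * qdelta (of_nat p * \<tau>) ^ j +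
      (\<Sum>b<p. qdelta ((\<tau> + of_nat b) / of_nat p) ^ j)) / qdelta \<tau> ^ j"
    using nz by (simp add: eq_divide_eq mult.assoc)
  then show ?thesis
    by (simp add: add_divide_distrib power_divide power_mult_distrib sum_divide_distrib)
qed

section \<open>The elliptic points i and rho\<close>

lemma eisen6_zero: "qfun (cfps eisen6) \<i> = 0"
proof -
  have "qfun (cfps eisen6) (- (1 / \<i>)) = \<i> ^ 6 * qfun (cfps eisen6) \<i>"
    by (rule mod_forms_S[OF eisen6_mod_form]) simp
  moreover have "- (1 / \<i>) = \<i>" by simp
  moreover have "\<i> ^ 6 = -1" by (simp add: numeral_eq_Suc)
  ultimately show ?thesis by simp
qed

definition rho :: complex where "rho = Complex (- 1 / 2) (sqrt 3 / 2)"

lemma Im_rho: "Im rho = sqrt 3 / 2" "Im rho > 0" and Re_rho: "Re rho = - 1 / 2"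
  by (simp_all add: rho_def)

lemma rho_square: "rho\<^sup>2 = - rho - 1"
  by (simp add: rho_def complex_eq_iff power2_eq_square)

lemma rho_nonzero: "rho \<noteq> 0"
  using Im_rho by auto

lemma rho_inverse: "1 / rho = - rho - 1"
proof -
  have "1 = rho * (- rho - 1)"
  proof -
    have "rho * (- rho - 1) = - rho\<^sup>2 - rho" by (simp add: power2_eq_square algebra_simps)
    then show ?thesis by (simp add: rho_square)
  qed
  then show ?thesis using rho_nonzero by (simp add: divide_eq_eq mult.commute)
qed

lemma rho_power_3: "rho ^ 3 = 1"
proof -
  have "rho ^ 3 = rho * rho\<^sup>2" by (simp add: power3_eq_cube power2_eq_square)
  also have "\<dots> = - rho\<^sup>2 - rho" by (simp add: rho_square algebra_simps power2_eq_square[symmetric])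
  also have "\<dots> = 1" by (simp add: rho_square)
  finally show ?thesis .
qed

lemma rho_power_12: "rho ^ 12 = 1"
  using power_mult[of rho 3 4] by (simp add: rho_power_3)

lemma rho_cnj: "- cnj rho = rho + 1"
  by (simp add: rho_def complex_eq_iff)

lemma eisen4_zero: "qfun (cfps eisen4) rho = 0"
proof -
  have "qfun (cfps eisen4) (- (1 / rho)) = rho ^ 4 * qfun (cfps eisen4) rho"
    by (rule mod_forms_S[OF eisen4_mod_form Im_rho(2)])
  moreover have "- (1 / rho) = rho + of_int 1" by (simp add: rho_inverse)
  moreover have "rho ^ 4 = rho" using power_add[of rho 3 1] by (simp add: rho_power_3)
  ultimately have "qfun (cfps eisen4) rho = rho * qfun (cfps eisen4) rho" by (simp only: qfun_plus_of_int)
  moreover have "rho \<noteq> 1" using Im_rho by auto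
  ultimately show ?thesis by simp
qed

text \<open>In weights divisible by 12 this split uses E6 alone, which vanishes at
  \<open>\<i>\<close>; the split of \<open>alpha5\<close> and \<open>beta5\<close> uses E4 alone,
  which vanishes at \<open>rho\<close>. So each point has its split.\<close>

lemma gbasis_zero_i:
  assumes "i < j"
  shows "qfun (cfps (gbasis alpha7 beta7 (12 * j) i)) \<i> = 0"
proof -
  obtain s where s: "12 * j - 12 * i = 12 * Suc s" using assms by (metis diff_mult_distrib2 Suc_diff_Suc)
  have "alpha7 (12 * Suc s) = 0" by (simp add: alpha7_def mod_mult_left_eq[symmetric])
  then have "beta7 (12 * Suc s) = 2 * Suc s" by (simp add: beta7_def)
  then have "cfps (gbasis alpha7 beta7 (12 * j) i) = cfps eisen6 * (cfps (eisen4 ^ alpha7 (12 * Suc s) * eisen6 ^ (2 * s + 1) * delta ^ i))"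
    unfolding gbasis_def s by (simp add: mult_ac)
  then show ?thesis by (simp add: qfun_mult eisen6_zero)
qed

lemma gbasis_zero_rho:
  assumes "i < j"
  shows "qfun (cfps (gbasis alpha5 beta5 (12 * j) i)) rho = 0"
proof -
  obtain s where s: "12 * j - 12 * i = 12 * Suc s" using assms by (metis diff_mult_distrib2 Suc_diff_Suc)
  have "4 dvd 12 * Suc s" by (rule dvd_mult2) simp
  then have "beta5 (12 * Suc s) = 0" by (simp only: beta5_def if_True)
  then have "alpha5 (12 * Suc s) = 3 * Suc s" by (simp add: alpha5_def)
  then have "cfps (gbasis alpha5 beta5 (12 * j) i) = cfps eisen4 * (cfps (eisen4 ^ (3 * s + 2) * eisen6 ^ beta5 (12 * Suc s) * delta ^ i))"
    unfolding gbasis_def s by (simp add: mult_ac numeral_3_eq_3)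
  then show ?thesis by (simp add: qfun_mult eisen4_zero Im_rho)
qed

lemma qdelta_S: "Im z > 0 \<Longrightarrow> qdelta (- (1 / z)) = z ^ 12 * qdelta z"
  by (rule mod_forms_S[OF delta_mod_form])

lemma qdelta_coset:
  assumes "prime p" "Im z > 0" "int p dvd b * b' + 1"
  shows "qdelta ((of_int b - 1 / z) / of_nat p) = z ^ 12 * qdelta ((z + of_int b') / of_nat p)"
  using mod_forms_coset_S[OF delta_mod_form _ _ assms(2,3)] assms(1) prime_gt_0_nat by simp

text \<open>A lattice of index \<open>p\<close> that is stable under multiplication by \<open>i\<close> has an index vector of norm \<open>p\<close>.\<close>
lemma fixed_lattice_i:
  assumes p: "prime p" and dvd: "int p dvd b * b + 1"
  shows "\<exists>x y :: int. qdelta ((\<i> + of_int b) / of_nat p) / qdelta \<i> = (of_int x + of_int y * \<i>) ^ 12"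
proof -
  have p0: "p > 0" using p prime_gt_0_nat by blast
  define z where "z = (\<i> + of_int b) / of_nat p"
  have z: "Im z = 1 / real p" "Im z > 0" using p0 by (simp_all add: z_def)
  obtain a b0 c d :: int and w where w: "a * d - b0 * c = 1"
    "w = (of_int a * z + of_int b0) / (of_int c * z + of_int d)"
    "norm w \<ge> 1" "\<bar>Re w\<bar> \<le> 1 / 2" "Im w \<ge> sqrt 3 / 2"
    using fundamental_domain_rep[OF z(2)] by metis
  define e f where "e = c * b + int p * d" and "f = a * b + int p * b0"
  \<comment> \<open>U = p (c z + d) is a Gaussian integer, and its norm is p k because b^2 = -1
    modulo p. Then Im w = 1 / k, and the least height \<open>sqrt 3 / 2\<close> of the fundamental
    domain leaves only k = 1.\<close>
  define U where "U = of_int e + of_int c * \<i>"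
  have zp: "of_nat p * z = \<i> + of_int b" using p0 by (simp add: z_def)
  have U: "of_nat p * (of_int c * z + of_int d) = U"
  proof -
    have "of_nat p * (of_int c * z + of_int d) = of_int c * (of_nat p * z) + of_nat p * of_int d"
      by (simp add: algebra_simps)
    then show ?thesis unfolding zp by (simp add: U_def e_def algebra_simps)
  qed
  have F: "of_nat p * (of_int a * z + of_int b0) = of_int f + of_int a * \<i>"
  proof -
    have "of_nat p * (of_int a * z + of_int b0) = of_int a * (of_nat p * z) + of_nat p * of_int b0"
      by (simp add: algebra_simps)
    then show ?thesis unfolding zp by (simp add: f_def algebra_simps)
  qed
  have Unz: "U \<noteq> 0" using Im_mobius(1)[OF w(1) z(2)] p0 unfolding U[symmetric] by simp
  have nU: "(norm U)\<^sup>2 = of_int (e\<^sup>2 + c\<^sup>2)" by (simp add: U_def cmod_power2)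
  have "e\<^sup>2 + c\<^sup>2 = c\<^sup>2 * (b * b + 1) + int p * (2 * c * b * d + int p * d\<^sup>2)"
    by (simp add: e_def power2_eq_square algebra_simps)
  then have "int p dvd e\<^sup>2 + c\<^sup>2" using dvd by simp
  then obtain k where k: "e\<^sup>2 + c\<^sup>2 = int p * k" by blast
  have npos: "(norm U)\<^sup>2 > 0" using Unz by simp
  have "Im w = Im z / (norm (of_int c * z + of_int d))\<^sup>2"
    unfolding w(2) by (rule Im_mobius(2)[OF w(1) z(2)])
  also have "norm (of_int c * z + of_int d) = norm U / real p"
    unfolding U[symmetric] using p0 by (simp add: norm_mult)
  finally have Imw: "Im w = real p / (norm U)\<^sup>2" using z p0 by (simp add: power_divide field_simps power2_eq_square)
  have k1: "k = 1"
  proof -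
    have nk: "(norm U)\<^sup>2 = real p * of_int k" using nU k by simp
    then have "real_of_int k > 0" using npos p0 by (simp add: zero_less_mult_iff)
    then have "k > 0" by simp
    have "Im w = 1 / of_int k" using Imw nk p0 by simp
    moreover have "sqrt 3 / 2 > 1 / 2" by (simp add: real_less_rsqrt)
    ultimately have "1 / of_int k > (1 / 2 :: real)" using w(5) by linarith
    then have "real_of_int k < 2" using \<open>k > 0\<close> by (simp add: field_simps)
    with \<open>k > 0\<close> show ?thesis by linarith
  qed
  have nUp: "(norm U)\<^sup>2 = real p" using nU k k1 by simp
  have UU: "U * cnj U = of_nat p" using nUp by (metis complex_norm_square of_real_of_nat_eq)
  have "w = (of_int f + of_int a * \<i>) / U"
    unfolding w(2) U[symmetric] F[symmetric] using p0 by simp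
  also have "\<dots> = (of_int f + of_int a * \<i>) * cnj U / (U * cnj U)" using Unz by simp
  finally have w': "w = (of_int f + of_int a * \<i>) * cnj U / of_nat p" by (simp only: UU)
  \<comment> \<open>The numerator of Re w is divisible by p too, so Re w is an integer of modulus at
    most 1/2, that is 0; hence w = i.\<close>
  have "f * e + a * c = a * c * (b * b + 1) + int p * (a * b * d + b0 * c * b + int p * b0 * d)"
    by (simp add: e_def f_def algebra_simps)
  then have "int p dvd f * e + a * c" using dvd by simp
  then obtain n where n: "f * e + a * c = int p * n" by blast
  have "Re w = of_int (f * e + a * c) / real p"
    unfolding w' using Re_divide_of_real[of "(of_int f + of_int a * \<i>) * cnj U" "real p"] by (simp add: U_def)
  then have "Re w = of_int n" using n p0 by simp
  with w(4) have "Re w = 0" by simp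
  moreover have "Im w = 1" using Imw nUp p0 by simp
  ultimately have wi: "w = \<i>" by (simp add: complex_eq_iff)
  have "qdelta \<i> = (U / of_nat p) ^ 12 * qdelta z"
    using mod_forms_mobius[OF delta_mod_form _ w(1) z(2)] p0
    unfolding w(2)[symmetric] wi U[symmetric] by simp
  then have "qdelta z * (U ^ 12) = qdelta \<i> * (U * cnj U) ^ 12"
    using p0 by (simp add: UU power_divide field_simps)
  then have "qdelta z / qdelta \<i> = cnj U ^ 12"
    using Unz delta_nonzero[of \<i>] by (simp add: power_mult_distrib field_simps)
  moreover have "cnj U = of_int e + of_int (- c) * \<i>" by (simp add: U_def)
  ultimately show ?thesis unfolding z_def by (intro exI[of _ e] exI[of _ "- c"]) (simp only:)
qed

text \<open>As for the Gaussian integers, U = p (c z + d) has norm p k, and k = 1 because w lies in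
  the fundamental domain. Then w has the least possible height and is a corner, \<open>rho\<close>
  or \<open>rho + 1\<close>, where Delta takes the same value. The norm equation is recorded because
  it fixes p and c + e modulo 3 up to sign.\<close>

lemma fixed_lattice_rho:
  assumes p: "prime p" and dvd: "int p dvd b * (b - 1) + 1"
  shows "\<exists>c e :: int. c\<^sup>2 - c * e + e\<^sup>2 = int p \<and>
    qdelta ((rho + of_int b) / of_nat p) / qdelta rho = cnj (of_int c * rho + of_int e) ^ 12"
proof -
  have p0: "p > 0" using p prime_gt_0_nat by blast
  define z where "z = (rho + of_int b) / of_nat p"
  have z: "Im z = (sqrt 3 / 2) / real p" "Im z > 0" using p0 by (simp_all add: z_def Im_rho(1))
  obtain a b0 c d :: int and w where w: "a * d - b0 * c = 1"
    "w = (of_int a * z + of_int b0) / (of_int c * z + of_int d)"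
    "norm w \<ge> 1" "\<bar>Re w\<bar> \<le> 1 / 2" "Im w \<ge> sqrt 3 / 2"
    using fundamental_domain_rep[OF z(2)] by metis
  define e where "e = c * b + int p * d"
  define U where "U = of_int c * rho + of_int e"
  have zp: "of_nat p * z = rho + of_int b" using p0 by (simp add: z_def)
  have U: "of_nat p * (of_int c * z + of_int d) = U"
  proof -
    have "of_nat p * (of_int c * z + of_int d) = of_int c * (of_nat p * z) + of_nat p * of_int d"
      by (simp add: algebra_simps)
    then show ?thesis unfolding zp by (simp add: U_def e_def algebra_simps)
  qed
  have Unz: "U \<noteq> 0" using Im_mobius(1)[OF w(1) z(2)] p0 unfolding U[symmetric] by simp
  have nU: "(norm U)\<^sup>2 = of_int (c\<^sup>2 - c * e + e\<^sup>2)"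
  proof -
    have ri: "Re U = of_int e - of_int c / 2" "Im U = of_int c * (sqrt 3 / 2)"
      by (simp_all add: U_def Im_rho Re_rho)
    show ?thesis unfolding cmod_power2 ri by (simp add: power2_eq_square field_simps)
  qed
  have "c\<^sup>2 - c * e + e\<^sup>2 = c\<^sup>2 * (b * (b - 1) + 1) + int p * (2 * c * b * d - c * d + int p * d\<^sup>2)"
    by (simp add: e_def power2_eq_square algebra_simps)
  then have "int p dvd c\<^sup>2 - c * e + e\<^sup>2" using dvd by simp
  then obtain k where k: "c\<^sup>2 - c * e + e\<^sup>2 = int p * k" by blast
  have npos: "(norm U)\<^sup>2 > 0" using Unz by simp
  have "Im w = Im z / (norm (of_int c * z + of_int d))\<^sup>2"
    unfolding w(2) by (rule Im_mobius(2)[OF w(1) z(2)])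
  also have "norm (of_int c * z + of_int d) = norm U / real p"
    unfolding U[symmetric] using p0 by (simp add: norm_mult)
  finally have Imw: "Im w = (sqrt 3 / 2) * (real p / (norm U)\<^sup>2)"
    using z p0 by (simp add: power_divide field_simps power2_eq_square)
  have k1: "k = 1"
  proof -
    have nk: "(norm U)\<^sup>2 = real p * of_int k" using nU k by simp
    then have "real_of_int k > 0" using npos p0 by (simp add: zero_less_mult_iff)
    then have "k > 0" by simp
    have "Im w = (sqrt 3 / 2) * (1 / of_int k)" using Imw nk p0 by simp
    then have "(sqrt 3 / 2) * 1 \<le> (sqrt 3 / 2) * (1 / real_of_int k)" using w(5) by simp
    then have "1 \<le> 1 / real_of_int k" by (rule mult_left_le_imp_le) simp
    then have "real_of_int k \<le> 1" using \<open>k > 0\<close> by (simp add: field_simps)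
    with \<open>k > 0\<close> show ?thesis by linarith
  qed
  have nUp: "(norm U)\<^sup>2 = real p" using nU k k1 by simp
  have UU: "U * cnj U = of_nat p" using nUp by (metis complex_norm_square of_real_of_nat_eq)
  have Imw1: "Im w = sqrt 3 / 2" using Imw nUp p0 by simp
  have "(Re w)\<^sup>2 + (Im w)\<^sup>2 \<ge> 1" using w(3) power_mono[of 1 "norm w" 2] by (simp add: cmod_power2)
  then have "(1 / 2)\<^sup>2 \<le> (Re w)\<^sup>2" by (simp add: Imw1 power_divide)
  then have "\<bar>Re w\<bar> \<ge> 1 / 2" using abs_le_square_iff[of "1/2" "Re w"] by simp
  with w(4) have "Re w = - 1 / 2 \<or> Re w = 1 / 2" by linarith
  then have "w = rho \<or> w = rho + of_int 1" using Imw1 by (auto simp: complex_eq_iff Im_rho Re_rho)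
  then have qw: "qdelta w = qdelta rho" by (metis qfun_plus_of_int)
  have "qdelta rho = (U / of_nat p) ^ 12 * qdelta z"
    using mod_forms_mobius[OF delta_mod_form _ w(1) z(2)] p0
    unfolding w(2)[symmetric] qw U[symmetric] by simp
  then have "qdelta z * (U ^ 12) = qdelta rho * (U * cnj U) ^ 12"
    using p0 by (simp add: UU power_divide field_simps)
  then have "qdelta z / qdelta rho = cnj U ^ 12"
    using Unz delta_nonzero[OF Im_rho(2)] by (simp add: power_mult_distrib field_simps)
  then show ?thesis using k k1 unfolding z_def U_def by auto
qed

text \<open>As E4 = E6 = 1 modulo l, basis element j is Delta^j in every weight, and
  \<open>wt\<close> lets T_p be computed in weight 12 j, where Delta^j is the last basis element and
  the expansion stops at it.\<close>

lemma hecke_poly_of_delta_powers: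
  assumes ws: "weight_split \<alpha> \<beta>" and l: "prime l" "\<not> l dvd p"
    and E: "fps_cong l eisen4 1" "fps_cong l eisen6 1"
    and p: "prime p" and k: "even k" "k > 0" and wt: "\<And>j. [k = 12 * j] (mod l - 1)"
    and m: "\<And>j m. j \<ge> 1 \<Longrightarrow>
      hecke_fps p (12 * j) (delta ^ j) = (\<Sum>i<Suc j. fps_const (m i) * gbasis \<alpha> \<beta> (12 * j) i) \<Longrightarrow>
      [m j = e] (mod int l)"
  shows "poly_cong l (hecke_poly p k) (\<Prod>j = 1..cusp_dim k. [:- of_int e, 1:])"
proof (rule hecke_poly_triangular[OF ws k p])
  have gb: "fps_cong l (gbasis \<alpha> \<beta> n i) (delta ^ i)" for n i
    using fps_cong_mult[OF fps_cong_mult[OF fps_cong_power[OF E(1)] fps_cong_power[OF E(2)]] fps_cong_refl]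
    unfolding gbasis_def by (simp only: power_one mult_1_left)
  fix j :: nat assume j: "j \<ge> 1" "j < mdim k"
  obtain c where c: "hecke_fps p (12 * j) (delta ^ j) = (\<Sum>i<Suc j. fps_const (c i) * gbasis \<alpha> \<beta> (12 * j) i)"
    using hecke_delta_power_expansion[OF ws p j(1)] by blast
  have "fps_cong l (hecke_fps p k (gbasis \<alpha> \<beta> k j)) (hecke_fps p k (delta ^ j))"
    by (rule hecke_fps_cong) (rule gb)
  also have "fps_cong l \<dots> (hecke_fps p (12 * j) (delta ^ j))"
    by (rule hecke_fps_weight_cong[OF l wt k(2)]) (use j in simp)
  also have "hecke_fps p (12 * j) (delta ^ j) = (\<Sum>i<Suc j. fps_const (c i) * gbasis \<alpha> \<beta> (12 * j) i)" by (rule c)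
  also have "fps_cong l \<dots> (\<Sum>i<Suc j. fps_const (c i) * gbasis \<alpha> \<beta> k i)"
    by (rule fps_cong_sum, rule fps_cong_mult[OF fps_cong_refl], rule fps_cong_trans[OF gb fps_cong_sym[OF gb]])
  finally show "\<exists>c. [c j = e] (mod int l) \<and>
      fps_cong l (hecke_fps p k (gbasis \<alpha> \<beta> k j)) (\<Sum>i<Suc j. fps_const (c i) * gbasis \<alpha> \<beta> k i)"
    using m[OF j(1) c] by blast
qed

text \<open>Separates the roots of a quadratic modulo p, with c the sum of the roots: 0 for b^2 + 1
  and 1 for b (b - 1) + 1.\<close>

lemma dvd_difference_times_sum:
  assumes p: "prime p" and dvd: "int p dvd (int b - int b') * (int b + int b' - int c)"
    and b: "b < p" "b' < p" "c < b + b'"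
  shows "b = b' \<or> b + b' = p + c"
proof -
  have "prime (int p)" using p by simp
  then consider "int p dvd int b - int b'" | "int p dvd int b + int b' - int c"
    using dvd prime_dvd_mult_iff by blast
  then show ?thesis
  proof cases
    case 1
    have "int b - int b' = 0"
    proof (rule ccontr)
      assume "int b - int b' \<noteq> 0"
      from dvd_imp_le_int[OF this 1] show False using b by linarith
    qed
    then show ?thesis by simp
  next
    case 2
    then obtain q where q: "int b + int b' - int c = int p * q" by blast
    have "0 < int p * q" "int p * q < int p * 2" using q b by linarith+
    then have "q > 0" "q < 2" using prime_gt_0_nat[OF p]
      by (simp_all add: zero_less_mult_iff)
    then have "q = 1" by simp
    then show ?thesis using q by simp
  qed
qed

lemma gauss_int_power: "\<exists>u v :: int. (of_int x + of_int y * \<i>) ^ n = of_int u + of_int v * \<i>"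
proof (induction n)
  case 0
  then show ?case by (intro exI[of _ 1] exI[of _ 0]) simp
next
  case (Suc n)
  then obtain u v :: int where "(of_int x + of_int y * \<i>) ^ n = of_int u + of_int v * \<i>" by blast
  then have "(of_int x + of_int y * \<i>) ^ Suc n = of_int (x * u - y * v) + of_int (x * v + y * u) * \<i>"
    by (simp add: complex_eq_iff)
  then show ?case by blast
qed

text \<open>The lattices of index p carry the labels infinity, 0, 1, ..., p - 1, and multiplication
  by i acts as b -> -1/b. Label 0 represents the orbit of infinity and 0, \<open>R\<close> the other
  pairs, and \<open>F\<close> holds the fixed labels: none, or two with conjugate values in the
  Gaussian integers, whose sum is even.\<close>

lemma hecke_delta_even:
  assumes p: "prime p" "p \<noteq> 2" and j: "j \<ge> 1"
    and m: "hecke_fps p (12 * j) (delta ^ j) = (\<Sum>i<Suc j. fps_const (m i) * gbasis alpha7 beta7 (12 * j) i)"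
  shows "even (m j)"
proof -
  have p0: "p > 0" using p prime_gt_0_nat by blast
  have p_odd: "odd p" using p primes_dvd_imp_eq[of 2 p] by auto
  have nz: "qdelta \<i> \<noteq> 0" by (rule delta_nonzero) simp
  define V where "V = (\<lambda>b. qdelta ((\<i> + of_nat b) / of_nat p) / qdelta \<i>)"
  have Vinf: "of_nat p ^ 12 * qdelta (of_nat p * \<i>) / qdelta \<i> = V 0"
  proof -
    have "- (1 / (of_nat p * \<i>)) = (\<i> + of_nat 0) / of_nat p" using p0 by (simp add: field_simps)
    moreover have "(of_nat p * \<i>) ^ 12 = of_nat p ^ 12" by (simp add: power_mult_distrib)
    ultimately show ?thesis using qdelta_S[of "of_nat p * \<i>"] p0 by (simp add: V_def)
  qed
  have i12: "\<i> ^ 12 = 1" by simp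
  have Vsig: "V b = V (neg_inv p b)" if b: "b \<in> {1..<p}" for b
  proof -
    have "int p dvd int (b * neg_inv p b + 1)" using neg_inv(2)[OF p(1) b] by (simp only: int_dvd_int_iff)
    then have "int p dvd int b * int (neg_inv p b) + 1" by (simp add: add.commute)
    from qdelta_coset[OF p(1) _ this, of \<i>]
    have "qdelta ((of_nat b - 1 / \<i>) / of_nat p) = qdelta ((\<i> + of_nat (neg_inv p b)) / of_nat p)" by (simp add: i12)
    moreover have "of_nat b - 1 / \<i> = \<i> + of_nat b" by simp
    ultimately show ?thesis by (simp only: V_def)
  qed
  define F B where "F = {b \<in> {1..<p}. p dvd b * b + 1}" and "B = {b \<in> {1..<p}. \<not> p dvd b * b + 1}"
  have FB: "finite F" "finite B" "F \<inter> B = {}" "{1..<p} = F \<union> B" by (auto simp: F_def B_def)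
  define R where "R = {b. b \<in> B \<and> b < neg_inv p b}"
  have R: "finite R" "0 \<notin> R" using FB(2) by (auto simp: R_def B_def)
  have nB: "neg_inv p b \<in> B" "neg_inv p (neg_inv p b) = b" "neg_inv p b \<noteq> b" "V (neg_inv p b) = V b" if b: "b \<in> B" for b
  proof -
    have b': "b \<in> {1..<p}" and nd: "\<not> p dvd b * b + 1" using b by (auto simp: B_def)
    show "neg_inv p (neg_inv p b) = b" by (rule neg_inv_neg_inv[OF p(1) b'])
    show ne: "neg_inv p b \<noteq> b" using neg_inv(2)[OF p(1) b'] nd by metis
    have nb: "neg_inv p b \<in> {1..<p}" by (rule neg_inv(1)[OF p(1) b'])
    show "neg_inv p b \<in> B"
    proof (rule ccontr)
      assume "neg_inv p b \<notin> B"
      then have "p dvd neg_inv p b * neg_inv p b + 1" using nb by (simp add: B_def)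
      moreover have "p dvd neg_inv p b * b + 1" using neg_inv(2)[OF p(1) b'] by (simp only: mult.commute)
      ultimately have "neg_inv p b = b" using nb b' by (intro neg_inv_unique[OF p(1), of _ _ "neg_inv p b"]) auto
      with ne show False by simp
    qed
    show "V (neg_inv p b) = V b" by (rule Vsig[OF b', symmetric])
  qed
  have VB: "(\<Sum>b\<in>B. V b ^ i) = 2 * (\<Sum>b\<in>R. V b ^ i)" for i
    unfolding R_def by (rule sum_involution) (use FB nB in auto)
  have VF: "\<exists>t :: int. (\<Sum>b\<in>F. V b ^ i) = of_int (2 * t)" for i
  proof (cases "F = {}")
    case True
    then show ?thesis by (intro exI[of _ 0]) simp
  next
    case False
    then obtain b where b: "b \<in> {1..<p}" "p dvd b * b + 1" by (auto simp: F_def)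
    have bp: "int (p - b) = int p - int b" using b by (simp add: of_nat_diff)
    have b2: "int p dvd int b * int b + 1"
    proof -
      have "int p dvd int (b * b + 1)" using b(2) by (simp only: int_dvd_int_iff)
      then show ?thesis by (simp add: add.commute)
    qed
    have "int p dvd int ((p - b) * (p - b) + 1)"
    proof -
      have eq: "int ((p - b) * (p - b) + 1) = int p * (int p - 2 * int b) + (int b * int b + 1)"
        unfolding of_nat_add of_nat_mult bp by (simp add: algebra_simps)
      show ?thesis unfolding eq by (rule dvd_add[OF dvd_triv_left b2])
    qed
    then have bF: "p dvd (p - b) * (p - b) + 1" by (simp only: int_dvd_int_iff)
    have "F = {b, p - b}"
    proof (intro equalityI subsetI)
      fix b' assume "b' \<in> F"
      then have b': "b' \<in> {1..<p}" "p dvd b' * b' + 1" by (auto simp: F_def)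
      have "int p dvd int (b' * b' + 1)" using b'(2) by (simp only: int_dvd_int_iff)
      then have "int p dvd (int b * int b + 1) - int (b' * b' + 1)" by (rule dvd_diff[OF b2])
      also have "(int b * int b + 1) - int (b' * b' + 1) = (int b - int b') * (int b + int b' - int 0)"
        by (simp add: algebra_simps)
      finally have "b = b' \<or> b + b' = p + 0" by (rule dvd_difference_times_sum[OF p(1)]) (use b b' in auto)
      then show "b' \<in> {b, p - b}" by auto
    qed (use b bF in \<open>auto simp: F_def\<close>)
    moreover have "b \<noteq> p - b"
    proof
      assume "b = p - b"
      then have "p = 2 * b" using b by simp
      with p_odd show False by simp
    qed
    ultimately have s: "(\<Sum>b\<in>F. V b ^ i) = V b ^ i + V (p - b) ^ i" by simp
    have Vc: "V (p - b) = cnj (V b)"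
    proof -
      have "(\<i> + of_nat (p - b)) / of_nat p = - cnj ((\<i> + of_nat b) / of_nat p) + of_int 1"
        using b p0 by (simp add: of_nat_diff field_simps)
      then have "qdelta ((\<i> + of_nat (p - b)) / of_nat p) = qdelta (- cnj ((\<i> + of_nat b) / of_nat p))"
        by (simp only: qfun_plus_of_int)
      also have "\<dots> = cnj (qdelta ((\<i> + of_nat b) / of_nat p))"
        by (rule qfun_reflect) (use p0 in simp_all)
      finally have 1: "qdelta ((\<i> + of_nat (p - b)) / of_nat p) = cnj (qdelta ((\<i> + of_nat b) / of_nat p))" .
      have "qdelta (- cnj \<i>) = cnj (qdelta \<i>)" by (rule qfun_reflect) simp_all
      then have "cnj (qdelta \<i>) = qdelta \<i>" by simp
      with 1 show ?thesis by (simp add: V_def)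
    qed
    obtain x y :: int where "V b = (of_int x + of_int y * \<i>) ^ 12"
      using fixed_lattice_i[OF p(1) b2] unfolding V_def of_int_of_nat_eq by blast
    then have "V b ^ i = (of_int x + of_int y * \<i>) ^ (12 * i)" by (simp only: power_mult)
    then obtain u v :: int where uv: "V b ^ i = of_int u + of_int v * \<i>" using gauss_int_power[of x y "12 * i"] by auto
    have "V (p - b) ^ i = cnj (V b ^ i)" by (simp only: Vc complex_cnj_power)
    then have "(\<Sum>b\<in>F. V b ^ i) = of_int (2 * u)" unfolding s uv by simp
    then show ?thesis by blast
  qed
  have val: "\<exists>t. of_nat p * of_int (m i) = of_nat 2 * (\<Sum>b\<in>insert 0 R. V b ^ i) + of_int (2 * t)"
    if i: "i \<ge> 1" and m: "hecke_fps p (12 * i) (delta ^ i) = (\<Sum>n<Suc i. fps_const (m n) * gbasis alpha7 beta7 (12 * i) n)" for i m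
  proof -
    obtain t :: int where t: "(\<Sum>b\<in>F. V b ^ i) = of_int (2 * t)" using VF by blast
    have "of_nat p * of_int (m i) = V 0 ^ i + (\<Sum>b<p. V b ^ i)"
      using hecke_delta_value[OF weight_split_7 p(1) i _ gbasis_zero_i m] unfolding Vinf V_def by simp
    also have "{..<p} = insert 0 {1..<p}" using p0 by auto
    also have "(\<Sum>b\<in>insert 0 {1..<p}. V b ^ i) = V 0 ^ i + (\<Sum>b\<in>{1..<p}. V b ^ i)" by simp
    also have "(\<Sum>b\<in>{1..<p}. V b ^ i) = (\<Sum>b\<in>F. V b ^ i) + (\<Sum>b\<in>B. V b ^ i)"
      unfolding FB(4) by (rule sum.union_disjoint[OF FB(1,2,3)])
    finally have "of_nat p * of_int (m i) = of_nat 2 * (\<Sum>b\<in>insert 0 R. V b ^ i) + of_int (2 * t)"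
      using R by (simp add: VB t)
    then show ?thesis by blast
  qed
  have int: "of_nat 2 * (\<Sum>b\<in>insert 0 R. V b ^ i) \<in> \<int>" if i: "i \<ge> 1" for i
  proof -
    obtain m where "hecke_fps p (12 * i) (delta ^ i) = (\<Sum>n<Suc i. fps_const (m n) * gbasis alpha7 beta7 (12 * i) n)"
      using hecke_delta_power_expansion[OF weight_split_7 p(1) i] by blast
    from val[OF i this] obtain t where
      "of_nat p * of_int (m i) = of_nat 2 * (\<Sum>b\<in>insert 0 R. V b ^ i) + of_int (2 * t)" by blast
    then have "of_nat 2 * (\<Sum>b\<in>insert 0 R. V b ^ i) = of_int (int p * m i - 2 * t)" by (simp add: algebra_simps)
    then show ?thesis by (simp only: Ints_of_int)
  qed
  have "(\<Sum>b\<in>insert 0 R. V b ^ j) \<in> \<int>"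
    by (rule power_sum_integral_power[OF two_is_prime_nat _ int j]) (use R in simp_all)
  then obtain s where s: "(\<Sum>b\<in>insert 0 R. V b ^ j) = of_int s" by (rule Ints_cases)
  obtain t where "of_nat p * of_int (m j) = of_nat 2 * (\<Sum>b\<in>insert 0 R. V b ^ j) + of_int (2 * t)"
    using val[OF j m] by blast
  then have "complex_of_int (int p * m j) = of_int (2 * s + 2 * t)" unfolding s by simp
  then have "int p * m j = 2 * s + 2 * t" by (simp only: of_int_eq_iff)
  then have "even (int p * m j)" by simp
  then show ?thesis using p_odd by simp
qed

lemma hecke_poly_2:
  assumes "prime p" "p \<noteq> 2" "even k" "k > 0"
  shows "poly_cong 2 (hecke_poly p k) (\<Prod>j = 1..cusp_dim k. [:- of_int 0, 1:])"
proof (rule hecke_poly_of_delta_powers[OF weight_split_7 two_is_prime_nat _ eisen4_cong(2) eisen6_cong(2) assms(1,3,4)])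
  show "\<not> 2 dvd p" using assms primes_dvd_imp_eq[of 2 p] by auto
  show "[m j = 0] (mod int 2)" if "j \<ge> 1"
    "hecke_fps p (12 * j) (delta ^ j) = (\<Sum>i<Suc j. fps_const (m i) * gbasis alpha7 beta7 (12 * j) i)" for j m
    using hecke_delta_even[OF assms(1,2) that] by (simp add: cong_0_iff)
qed simp

text \<open>Since \<open>\<rho> \<equiv> 1\<close> modulo \<open>\<surd>-3\<close>, powers of \<open>e + c \<rho>\<close> are controlled modulo 3 by those of \<open>e + c\<close>.\<close>
lemma eisenstein_int_power:
  "\<exists>x y :: int. (of_int c * rho + of_int e) ^ n = of_int x + of_int y * rho \<and> [x + y = (c + e) ^ n] (mod 3)"
proof (induction n)
  case 0
  then show ?case by (intro exI[of _ 1] exI[of _ 0]) simp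
next
  case (Suc n)
  then obtain x y :: int where xy: "(of_int c * rho + of_int e) ^ n = of_int x + of_int y * rho"
    "[x + y = (c + e) ^ n] (mod 3)" by blast
  have "(of_int c * rho + of_int e) ^ Suc n = (of_int c * rho + of_int e) * (of_int x + of_int y * rho)"
    by (simp only: power_Suc xy)
  also have "\<dots> = of_int (x * e) + of_int (x * c + y * e) * rho + of_int (y * c) * rho\<^sup>2"
    by (simp add: algebra_simps power2_eq_square)
  also have "\<dots> = of_int (x * e - y * c) + of_int (x * c + y * e - y * c) * rho"
    by (simp add: rho_square algebra_simps)
  finally have 1: "(of_int c * rho + of_int e) ^ Suc n = of_int (x * e - y * c) + of_int (x * c + y * e - y * c) * rho" .
  have "(x * e - y * c) + (x * c + y * e - y * c) - (c + e) * (x + y) = 3 * (- (y * c))"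
    by (simp add: algebra_simps)
  then have "[(x * e - y * c) + (x * c + y * e - y * c) = (c + e) * (x + y)] (mod 3)"
    unfolding cong_iff_dvd_diff by (simp only: dvd_triv_left)
  also have "[(c + e) * (x + y) = (c + e) * (c + e) ^ n] (mod 3)" by (intro cong_mult cong_refl xy)
  finally have "[(x * e - y * c) + (x * c + y * e - y * c) = (c + e) ^ Suc n] (mod 3)" by simp
  with 1 show ?case by blast
qed

text \<open>c^2 - c e + e^2 = (c + e)^2 - 3 c e, and a square prime to 3 is 1 modulo 3.\<close>

lemma norm_form_cong_3:
  fixes c e :: int
  assumes "c\<^sup>2 - c * e + e\<^sup>2 = int p" "\<not> 3 dvd p"
  shows "[int p = 1] (mod 3)" "[(c + e) ^ (12 * j) = 1] (mod 3)"
proof -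
  have "int p - (c + e)\<^sup>2 = 3 * (- (c * e))" unfolding assms(1)[symmetric] by (simp add: power2_eq_square algebra_simps)
  then have p: "[int p = (c + e)\<^sup>2] (mod 3)" unfolding cong_iff_dvd_diff by (simp only: dvd_triv_left)
  have nd: "\<not> 3 dvd int p" using assms(2) by presburger
  have "(c + e) mod 3 = 0 \<or> (c + e) mod 3 = 1 \<or> (c + e) mod 3 = 2" by presburger
  then have "[c + e = 0] (mod 3) \<or> [c + e = 1] (mod 3) \<or> [c + e = 2] (mod 3)" by (auto simp: cong_def)
  then have sq: "[(c + e)\<^sup>2 = 1] (mod 3)"
  proof (elim disjE)
    assume "[c + e = 0] (mod 3)"
    then have "[(c + e)\<^sup>2 = 0\<^sup>2] (mod 3)" by (rule cong_pow)
    with p have "[int p = 0\<^sup>2] (mod 3)" by (rule cong_trans)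
    with nd show ?thesis by (simp add: cong_0_iff)
  next
    assume "[c + e = 1] (mod 3)"
    from cong_pow[OF this, of 2] show ?thesis by simp
  next
    assume "[c + e = 2] (mod 3)"
    then have "[(c + e)\<^sup>2 = 2\<^sup>2] (mod 3)" by (rule cong_pow)
    also have "[2\<^sup>2 = (1 :: int)] (mod 3)" by (simp add: cong_def)
    finally show ?thesis .
  qed
  show "[int p = 1] (mod 3)" by (rule cong_trans[OF p sq])
  have "[((c + e)\<^sup>2) ^ (6 * j) = 1 ^ (6 * j)] (mod 3)" by (rule cong_pow[OF sq])
  moreover have "((c + e)\<^sup>2) ^ (6 * j) = (c + e) ^ (12 * j)" by (simp add: power_mult[symmetric])
  ultimately show "[(c + e) ^ (12 * j) = 1] (mod 3)" by simp
qed

lemma neg_inv_shift: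
  fixes b b' :: nat
  assumes "b \<ge> 1"
  shows "int p dvd (int b - 1) * int b' + 1 \<longleftrightarrow> p dvd (b - 1) * b' + 1"
proof -
  have "int ((b - 1) * b' + 1) = (int b - 1) * int b' + 1" using assms by (simp add: of_nat_diff)
  then show ?thesis by (metis int_dvd_int_iff)
qed

text \<open>
  Multiplication by \<open>\<rho>\<close> permutes the lattices of index \<open>p\<close> in \<open>\<int> + \<int>\<rho>\<close>; on the finite labels
  this is \<open>b \<mapsto> neg_inv p (b - 1)\<close>, with the labels \<open>\<infinity>, 0, 1\<close> forming one orbit.
\<close>
lemma neg_inv_order_3:
  assumes p: "prime p" and b: "b \<in> {2..<p}"
  defines "\<sigma> \<equiv> \<lambda>b. neg_inv p (b - 1)"
  shows "\<sigma> b \<in> {2..<p}" "int p dvd (int b - 1) * int (\<sigma> b) + 1" "\<sigma> (\<sigma> (\<sigma> b)) = b"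
proof -
  have mem: "\<sigma> b \<in> {2..<p}" and dvd: "int p dvd (int b - 1) * int (\<sigma> b) + 1" if b: "b \<in> {2..<p}" for b
  proof -
    have b1: "b - 1 \<in> {1..<p}" using b by auto
    have d: "p dvd (b - 1) * \<sigma> b + 1" unfolding \<sigma>_def by (rule neg_inv(2)[OF p b1])
    show "int p dvd (int b - 1) * int (\<sigma> b) + 1" using d b by (subst neg_inv_shift) auto
    have "\<sigma> b \<in> {1..<p}" unfolding \<sigma>_def by (rule neg_inv(1)[OF p b1])
    moreover have "\<sigma> b \<noteq> 1"
    proof
      assume "\<sigma> b = 1"
      then have "p dvd b" using d b by simp
      then show False using b by (auto dest: dvd_imp_le)
    qed
    ultimately show "\<sigma> b \<in> {2..<p}" by auto
  qed
  show "\<sigma> b \<in> {2..<p}" "int p dvd (int b - 1) * int (\<sigma> b) + 1" by (rule mem[OF b], rule dvd[OF b])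
  define b1 b2 where "b1 = \<sigma> b" and "b2 = \<sigma> b1"
  have b1: "b1 \<in> {2..<p}" unfolding b1_def by (rule mem[OF b])
  have b2: "b2 \<in> {2..<p}" unfolding b2_def by (rule mem[OF b1])
  have d: "int p dvd (int b - 1) * int b1 + 1" "int p dvd (int b1 - 1) * int b2 + 1" "int p dvd (int b2 - 1) * int (\<sigma> b2) + 1"
    unfolding b1_def[symmetric] b2_def[symmetric] using dvd[OF b] dvd[OF b1] dvd[OF b2] by (simp_all only: b1_def b2_def)
  \<comment> \<open>This combination of the first two relations factors, and the factor b1 - 1 is
    prime to p; what remains is the relation characterising the image of b2.\<close>
  have "int p dvd int b * ((int b1 - 1) * int b2 + 1) - ((int b - 1) * int b1 + 1)"
    by (rule dvd_diff[OF dvd_mult[OF d(2)] d(1)])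
  also have "int b * ((int b1 - 1) * int b2 + 1) - ((int b - 1) * int b1 + 1) = (int b1 - 1) * ((int b2 - 1) * int b + 1)"
    by (simp add: algebra_simps)
  finally have "int p dvd int b1 - 1 \<or> int p dvd (int b2 - 1) * int b + 1"
    using p by (subst prime_dvd_mult_iff[symmetric]) simp_all
  moreover have "\<not> int p dvd int b1 - 1" using b1 by (auto dest!: zdvd_imp_le)
  ultimately have "int p dvd (int b2 - 1) * int b + 1" by simp
  then have "p dvd (b2 - 1) * b + 1" using b2 by (subst (asm) neg_inv_shift) auto
  moreover have "p dvd (b2 - 1) * \<sigma> b2 + 1" using d(3) b2 by (subst (asm) neg_inv_shift) auto
  ultimately have "\<sigma> b2 = b" using b mem[OF b2] by (intro neg_inv_unique[OF p, of _ _ "b2 - 1"]) auto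
  then show "\<sigma> (\<sigma> (\<sigma> b)) = b" by (simp only: b1_def b2_def)
qed

text \<open>The argument at i with orbits of length 3 under multiplication by rho; label 0 now
  represents infinity, 0 and 1. The fixed labels contribute p (1 + p) modulo 3 whether there are any
  or not, and finally p is cancelled.\<close>

lemma hecke_delta_mod_3:
  assumes p: "prime p" "p \<noteq> 3" and j: "j \<ge> 1"
    and m: "hecke_fps p (12 * j) (delta ^ j) = (\<Sum>i<Suc j. fps_const (m i) * gbasis alpha5 beta5 (12 * j) i)"
  shows "[m j = 1 + int p] (mod 3)"
proof -
  have p0: "p > 0" using p prime_gt_0_nat by blast
  have p2: "p \<ge> 2" using p prime_ge_2_nat by blast
  have pr3: "prime (3 :: nat)" by simp
  have p3: "\<not> 3 dvd p" using p primes_dvd_imp_eq[of 3 p] pr3 by auto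
  have nz: "qdelta rho \<noteq> 0" by (rule delta_nonzero[OF Im_rho(2)])
  define V where "V = (\<lambda>b. qdelta ((rho + of_nat b) / of_nat p) / qdelta rho)"
  have Vinf: "of_nat p ^ 12 * qdelta (of_nat p * rho) / qdelta rho = V 1"
  proof -
    have "- (1 / (of_nat p * rho)) = - (1 / rho) / of_nat p" by (simp add: field_simps)
    also have "\<dots> = (rho + of_nat 1) / of_nat p" by (simp add: rho_inverse)
    finally have 1: "- (1 / (of_nat p * rho)) = (rho + of_nat 1) / of_nat p" .
    have 2: "(of_nat p * rho) ^ 12 = of_nat p ^ 12" by (simp only: power_mult_distrib rho_power_12 mult_1_right)
    have "Im (of_nat p * rho) > 0" using p0 Im_rho(2) by simp
    from qdelta_S[OF this] show ?thesis unfolding 1 2 by (simp only: V_def)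
  qed
  have coset: "V b = V b'" if "int p dvd (int b - 1) * int b' + 1" for b b'
  proof -
    have "qdelta ((of_int (int b - 1) - 1 / rho) / of_nat p) = qdelta ((rho + of_int (int b')) / of_nat p)"
      using qdelta_coset[OF p(1) Im_rho(2) that] by (simp only: rho_power_12 mult_1_left)
    moreover have "of_int (int b - 1) - 1 / rho = rho + of_nat b" by (simp add: rho_inverse)
    moreover have "rho + of_int (int b') = rho + of_nat b'" by simp
    ultimately show ?thesis by (simp only: V_def)
  qed
  have V01: "V 0 = V 1" by (rule coset) simp
  define \<sigma> where "\<sigma> = (\<lambda>b. neg_inv p (b - 1))"
  have sig: "\<sigma> b \<in> {2..<p}" "int p dvd (int b - 1) * int (\<sigma> b) + 1" "\<sigma> (\<sigma> (\<sigma> b)) = b" if "b \<in> {2..<p}" for b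
    unfolding \<sigma>_def using neg_inv_order_3[OF p(1) that] by simp_all
  define F B where "F = {b \<in> {2..<p}. int p dvd (int b - 1) * int b + 1}"
    and "B = {b \<in> {2..<p}. \<not> int p dvd (int b - 1) * int b + 1}"
  have FB: "finite F" "finite B" "F \<inter> B = {}" "{2..<p} = F \<union> B" by (auto simp: F_def B_def)
  define R where "R = {b. b \<in> B \<and> b < \<sigma> b \<and> b < \<sigma> (\<sigma> b)}"
  have R: "finite R" "0 \<notin> R" using FB(2) by (auto simp: R_def B_def)
  have sB: "\<sigma> b \<in> B" "\<sigma> (\<sigma> (\<sigma> b)) = b" "\<sigma> b \<noteq> b" "V (\<sigma> b) = V b" if b: "b \<in> B" for b
  proof -
    have b': "b \<in> {2..<p}" and nd: "\<not> int p dvd (int b - 1) * int b + 1" using b by (auto simp: B_def)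
    show s3: "\<sigma> (\<sigma> (\<sigma> b)) = b" by (rule sig(3)[OF b'])
    show ne: "\<sigma> b \<noteq> b" using sig(2)[OF b'] nd by metis
    show "V (\<sigma> b) = V b" by (rule coset[OF sig(2)[OF b'], symmetric])
    have b1: "\<sigma> b \<in> {2..<p}" by (rule sig(1)[OF b'])
    show "\<sigma> b \<in> B"
    proof (rule ccontr)
      assume "\<sigma> b \<notin> B"
      then have "int p dvd (int (\<sigma> b) - 1) * int (\<sigma> b) + 1" using b1 by (simp add: B_def)
      then have "p dvd (\<sigma> b - 1) * \<sigma> b + 1" using b1 by (subst (asm) neg_inv_shift) auto
      moreover have "p dvd (\<sigma> b - 1) * \<sigma> (\<sigma> b) + 1" using sig(2)[OF b1] b1 by (subst (asm) neg_inv_shift) auto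
      ultimately have eq: "\<sigma> b = \<sigma> (\<sigma> b)" using b1 sig(1)[OF b1]
        by (intro neg_inv_unique[OF p(1), of _ _ "\<sigma> b - 1"]) auto
      have "\<sigma> (\<sigma> (\<sigma> b)) = \<sigma> b" by (simp only: eq[symmetric])
      with s3 ne show False by simp
    qed
  qed
  have VB: "(\<Sum>b\<in>B. V b ^ i) = 3 * (\<Sum>b\<in>R. V b ^ i)" for i
    unfolding R_def by (rule sum_order_3[OF FB(2)]) (rule sB; assumption)+
  have VF: "\<exists>t :: int. (\<Sum>b\<in>F. V b ^ i) = of_int t \<and> [t = int p * (1 + int p)] (mod 3)" for i
  proof (cases "F = {}")
    case True
    \<comment> \<open>Exponent 0 counts the labels: p - 2 is three times the number of orbits, so p
      = 2 modulo 3 and p (1 + p) vanishes like the empty sum.\<close>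
    then have "complex_of_nat (card B) = 3 * of_nat (card R)" using VB[of 0] by simp
    then have "complex_of_nat (card B) = of_nat (3 * card R)" by simp
    then have "card B = 3 * card R" by (simp only: of_nat_eq_iff)
    moreover have "card B = p - 2" using True FB(4) by (metis card_atLeastLessThan sup_bot_left)
    ultimately have "p + 1 = 3 * (card R + 1)" using p2 by simp
    then have "int (p + 1) = int (3 * (card R + 1))" by (rule arg_cong)
    then have "1 + int p = 3 * (int (card R) + 1)" by simp
    then have "3 dvd int p * (1 + int p)" by simp
    then have "[0 = int p * (1 + int p)] (mod 3)" by (metis cong_0_iff cong_sym)
    then show ?thesis using True by (intro exI[of _ 0]) simp
  next
    case False
    then obtain b where b: "b \<in> {2..<p}" "int p dvd (int b - 1) * int b + 1" by (auto simp: F_def)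
    have bp: "int (p + 1 - b) = int p + 1 - int b" using b by (simp add: of_nat_diff)
    have bF: "int p dvd (int (p + 1 - b) - 1) * int (p + 1 - b) + 1"
    proof -
      have eq: "(int (p + 1 - b) - 1) * int (p + 1 - b) + 1 = int p * (int p + 1 - 2 * int b) + ((int b - 1) * int b + 1)"
        unfolding bp by (simp add: algebra_simps)
      show ?thesis unfolding eq by (rule dvd_add[OF dvd_triv_left b(2)])
    qed
    have "F = {b, p + 1 - b}"
    proof (intro equalityI subsetI)
      fix b' assume "b' \<in> F"
      then have b': "b' \<in> {2..<p}" "int p dvd (int b' - 1) * int b' + 1" by (auto simp: F_def)
      have "int p dvd ((int b - 1) * int b + 1) - ((int b' - 1) * int b' + 1)" by (rule dvd_diff[OF b(2) b'(2)])
      also have "((int b - 1) * int b + 1) - ((int b' - 1) * int b' + 1) = (int b - int b') * (int b + int b' - int 1)"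
        by (simp add: algebra_simps)
      finally have "b = b' \<or> b + b' = p + 1" by (rule dvd_difference_times_sum[OF p(1)]) (use b b' in auto)
      then show "b' \<in> {b, p + 1 - b}" by auto
    next
      fix b' assume "b' \<in> {b, p + 1 - b}"
      then consider "b' = b" | "b' = p + 1 - b" by blast
      then show "b' \<in> F"
      proof cases
        case 1 then show ?thesis using b by (simp add: F_def)
      next
        case 2 then show ?thesis using b(1) bF unfolding F_def by auto
      qed
    qed
    moreover have "b \<noteq> p + 1 - b"
    proof
      assume "b = p + 1 - b"
      then have "p + 1 = 2 * b" using b by simp
      then have ip: "int p = 2 * int b - 1" by linarith
      \<comment> \<open>The discriminant of b^2 - b + 1 is -3: a double root would make p = 2 b - 1
        divide 3.\<close>
      have three: "4 * ((int b - 1) * int b + 1) - int p * int p = 3" unfolding ip by (simp add: algebra_simps)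
      have "int p dvd 4 * ((int b - 1) * int b + 1) - int p * int p"
        by (rule dvd_diff[OF dvd_mult[OF b(2)] dvd_triv_left])
      then have "int p dvd int 3" unfolding three of_nat_numeral .
      then have "p dvd 3" by (simp only: int_dvd_int_iff)
      then show False using p primes_dvd_imp_eq[OF p(1) pr3] by simp
    qed
    ultimately have s: "(\<Sum>b\<in>F. V b ^ i) = V b ^ i + V (p + 1 - b) ^ i" by simp
    have Vc: "V (p + 1 - b) = cnj (V b)"
    proof -
      have "- cnj (rho + of_nat b) = rho + 1 - of_nat b" using rho_cnj by simp
      moreover have "- cnj ((rho + of_nat b) / of_nat p) = - cnj (rho + of_nat b) / of_nat p"
        by (simp only: complex_cnj_divide complex_cnj_of_nat minus_divide_left)
      ultimately have 0: "- cnj ((rho + of_nat b) / of_nat p) = (rho + 1 - of_nat b) / of_nat p" by (simp only:)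
      have "complex_of_nat (p + 1 - b) = of_nat p + 1 - of_nat b" using b by (simp add: of_nat_diff)
      then have "(rho + of_nat (p + 1 - b)) / of_nat p = - cnj ((rho + of_nat b) / of_nat p) + of_int 1"
        unfolding 0 using p0 by (simp add: field_simps)
      then have "qdelta ((rho + of_nat (p + 1 - b)) / of_nat p) = qdelta (- cnj ((rho + of_nat b) / of_nat p))"
        by (simp only: qfun_plus_of_int)
      also have "\<dots> = cnj (qdelta ((rho + of_nat b) / of_nat p))"
        by (rule qfun_reflect) (use p0 Im_rho(2) in simp_all)
      finally have 1: "qdelta ((rho + of_nat (p + 1 - b)) / of_nat p) = cnj (qdelta ((rho + of_nat b) / of_nat p))" .
      have "qdelta (- cnj rho) = cnj (qdelta rho)" by (rule qfun_reflect[OF Im_rho(2)]) simp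
      moreover have "- cnj rho = rho + of_int 1" using rho_cnj by simp
      ultimately have "cnj (qdelta rho) = qdelta rho" by (simp only: qfun_plus_of_int)
      then show ?thesis unfolding V_def 1 by simp
    qed
    have "int p dvd int b * (int b - 1) + 1" using b(2) by (simp only: mult.commute)
    from fixed_lattice_rho[OF p(1) this] obtain c e :: int where ce: "c\<^sup>2 - c * e + e\<^sup>2 = int p"
      "V b = cnj (of_int c * rho + of_int e) ^ 12" unfolding V_def of_int_of_nat_eq by blast
    obtain x y :: int where xy: "(of_int c * rho + of_int e) ^ (12 * i) = of_int x + of_int y * rho"
      "[x + y = (c + e) ^ (12 * i)] (mod 3)" using eisenstein_int_power[of c e "12 * i"] by blast
    have Vb: "V b ^ i = cnj (of_int x + of_int y * rho)"
      unfolding ce(2) xy(1)[symmetric] by (simp only: power_mult complex_cnj_power)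
    have Vb': "V (p + 1 - b) ^ i = cnj (V b ^ i)" by (simp only: Vc complex_cnj_power)
    \<comment> \<open>The sum of the two conjugates is the trace of x + y rho. Modulo 3 it is 2 (x +
      y) = 2, and so is p (1 + p), since p is a norm.\<close>
    have "(\<Sum>b\<in>F. V b ^ i) = of_int (2 * x - y)" unfolding s Vb' Vb by (simp add: complex_eq_iff Re_rho)
    moreover have "[2 * x - y = int p * (1 + int p)] (mod 3)"
    proof -
      have "2 * x - y - 2 * (x + y) = 3 * (- y)" by simp
      then have "[2 * x - y = 2 * (x + y)] (mod 3)" unfolding cong_iff_dvd_diff by (simp only: dvd_triv_left)
      also have "[2 * (x + y) = 2 * 1] (mod 3)"
        using cong_trans[OF xy(2) norm_form_cong_3(2)[OF ce(1) p3]] by (intro cong_mult cong_refl)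
      also have "[2 * 1 = int p * (1 + int p)] (mod 3)"
      proof -
        note p1 = norm_form_cong_3(1)[OF ce(1) p3]
        have "[int p * (1 + int p) = 1 * (1 + 1)] (mod 3)" by (rule cong_mult[OF p1 cong_add[OF cong_refl p1]])
        then show ?thesis by (simp add: cong_sym)
      qed
      finally show ?thesis .
    qed
    ultimately show ?thesis by blast
  qed
  have val: "\<exists>t. of_nat p * of_int (m i) = of_nat 3 * (\<Sum>b\<in>insert 0 R. V b ^ i) + of_int t \<and> [t = int p * (1 + int p)] (mod 3)"
    if i: "i \<ge> 1" and m: "hecke_fps p (12 * i) (delta ^ i) = (\<Sum>n<Suc i. fps_const (m n) * gbasis alpha5 beta5 (12 * i) n)" for i m
  proof -
    obtain t :: int where t: "(\<Sum>b\<in>F. V b ^ i) = of_int t" "[t = int p * (1 + int p)] (mod 3)" using VF by blast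
    have "of_nat p * of_int (m i) = V 1 ^ i + (\<Sum>b<p. V b ^ i)"
      using hecke_delta_value[OF weight_split_5 p(1) i Im_rho(2) gbasis_zero_rho m] unfolding Vinf V_def by simp
    also have "{..<p} = insert 0 (insert 1 {2..<p})" using p2 by auto
    also have "(\<Sum>b\<in>insert 0 (insert 1 {2..<p}). V b ^ i) = V 0 ^ i + (V 1 ^ i + (\<Sum>b\<in>{2..<p}. V b ^ i))" by simp
    also have "(\<Sum>b\<in>{2..<p}. V b ^ i) = (\<Sum>b\<in>F. V b ^ i) + (\<Sum>b\<in>B. V b ^ i)"
      unfolding FB(4) by (rule sum.union_disjoint[OF FB(1,2,3)])
    finally have "of_nat p * of_int (m i) = of_nat 3 * (\<Sum>b\<in>insert 0 R. V b ^ i) + of_int t"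
      using R by (simp add: VB t(1) V01)
    with t(2) show ?thesis by blast
  qed
  have int: "of_nat 3 * (\<Sum>b\<in>insert 0 R. V b ^ i) \<in> \<int>" if i: "i \<ge> 1" for i
  proof -
    obtain m where "hecke_fps p (12 * i) (delta ^ i) = (\<Sum>n<Suc i. fps_const (m n) * gbasis alpha5 beta5 (12 * i) n)"
      using hecke_delta_power_expansion[OF weight_split_5 p(1) i] by blast
    from val[OF i this] obtain t where
      "of_nat p * of_int (m i) = of_nat 3 * (\<Sum>b\<in>insert 0 R. V b ^ i) + of_int t" by blast
    then have "of_nat 3 * (\<Sum>b\<in>insert 0 R. V b ^ i) = of_int (int p * m i - t)" by (simp add: algebra_simps)
    then show ?thesis by (simp only: Ints_of_int)
  qed
  have "(\<Sum>b\<in>insert 0 R. V b ^ j) \<in> \<int>"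
    by (rule power_sum_integral_power[OF pr3 _ int j]) (use R in simp_all)
  then obtain s where s: "(\<Sum>b\<in>insert 0 R. V b ^ j) = of_int s" by (rule Ints_cases)
  obtain t where t: "of_nat p * of_int (m j) = of_nat 3 * (\<Sum>b\<in>insert 0 R. V b ^ j) + of_int t"
    "[t = int p * (1 + int p)] (mod 3)" using val[OF j m] by blast
  then have "complex_of_int (int p * m j) = of_int (3 * s + t)" unfolding s by simp
  then have eq: "int p * m j = 3 * s + t" by (simp only: of_int_eq_iff)
  have "[3 * s + t = t] (mod 3)" by (simp add: cong_def)
  from cong_trans[OF this t(2)] have "[int p * m j = int p * (1 + int p)] (mod 3)" unfolding eq .
  moreover have "coprime (int p) 3"
  proof -
    have "coprime 3 p" by (rule prime_imp_coprime[OF pr3 p3])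
    then have "coprime (int 3) (int p)" by (simp only: coprime_int_iff)
    then show ?thesis by (simp add: coprime_commute)
  qed
  ultimately show ?thesis by (simp only: cong_mult_lcancel)
qed

lemma hecke_poly_3:
  assumes "prime p" "p \<noteq> 3" "even k" "k > 0"
  shows "poly_cong 3 (hecke_poly p k) (\<Prod>j = 1..cusp_dim k. [:- of_int ((1 + int p) mod 3), 1:])"
proof (rule hecke_poly_of_delta_powers[OF weight_split_5 _ _ eisen4_cong(3) eisen6_cong(3) assms(1,3,4)])
  show pr: "prime (3 :: nat)" by simp
  show "\<not> 3 dvd p" using assms primes_dvd_imp_eq[OF pr] by auto
  show "[m j = (1 + int p) mod 3] (mod int 3)" if "j \<ge> 1"
    "hecke_fps p (12 * j) (delta ^ j) = (\<Sum>i<Suc j. fps_const (m i) * gbasis alpha5 beta5 (12 * j) i)" for j m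
    using hecke_delta_mod_3[OF assms(1,2) that] by (simp add: cong_def)
  show "[k = 12 * j] (mod 3 - 1)" for j using assms(3) by (auto simp: cong_def elim!: evenE)
qed

section \<open>Periods\<close>

lemma poly_cong_sym: "poly_cong l P Q \<Longrightarrow> poly_cong l Q P"
  unfolding poly_cong_def
proof (intro allI)
  fix i assume *: "\<forall>i. coeff P i \<in> \<int> \<and> coeff Q i \<in> \<int> \<and> (\<exists>c::int. coeff P i - coeff Q i = of_nat l * of_int c)"
  then obtain c :: int where "coeff P i - coeff Q i = of_nat l * of_int c" by blast
  then have "coeff Q i - coeff P i = of_nat l * of_int (- c)" by (simp add: algebra_simps)
  with * show "coeff Q i \<in> \<int> \<and> coeff P i \<in> \<int> \<and> (\<exists>c::int. coeff Q i - coeff P i = of_nat l * of_int c)" by blast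
qed

lemma poly_cong_trans: "poly_cong l P Q \<Longrightarrow> poly_cong l Q R \<Longrightarrow> poly_cong l P R"
  unfolding poly_cong_def
proof (intro allI)
  fix i
  assume 1: "\<forall>i. coeff P i \<in> \<int> \<and> coeff Q i \<in> \<int> \<and> (\<exists>c::int. coeff P i - coeff Q i = of_nat l * of_int c)"
    and 2: "\<forall>i. coeff Q i \<in> \<int> \<and> coeff R i \<in> \<int> \<and> (\<exists>c::int. coeff Q i - coeff R i = of_nat l * of_int c)"
  from 1 2 obtain c d :: int where "coeff P i - coeff Q i = of_nat l * of_int c" "coeff Q i - coeff R i = of_nat l * of_int d" by blast
  then have "coeff P i - coeff R i = of_nat l * of_int (c + d)" by (simp add: algebra_simps)
  with 1 2 show "coeff P i \<in> \<int> \<and> coeff R i \<in> \<int> \<and> (\<exists>c::int. coeff P i - coeff R i = of_nat l * of_int c)" by blast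
qed

definition hecke_root :: "nat \<Rightarrow> nat \<Rightarrow> nat \<Rightarrow> nat \<Rightarrow> int" where
  "hecke_root l r s j = (if l = 2 then 0 else if l = 3 then (1 + int r) mod 3
     else if l = 5 then root5 r s j else root7 r s j)"

text \<open>Raising j by 4 adds 8 to the exponent in \<open>root5\<close>, and 12 to n in
  \<open>root7\<close>, hence 6 to the exponent there.\<close>

lemma hecke_root_periodic: "hecke_root l r s (j + 4) = hecke_root l r s j"
proof -
  have "(2 * (j + 4) + x + 3) mod 4 = (2 * j + x + 3) mod 4" for x
  proof -
    have "2 * (j + 4) + x + 3 = 2 * j + x + 3 + 4 * 2" by simp
    then show ?thesis by (simp only: mod_mult_self2)
  qed
  then have 5: "root5 r s (j + 4) = root5 r s j" by (simp only: root5_def)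
  have "(3 * (j + 4) + x + 10) div 2 mod 6 = (3 * j + x + 10) div 2 mod 6"
    "(3 * (j + 4) + x + 11) div 2 mod 6 = (3 * j + x + 11) div 2 mod 6"
    "even (3 * (j + 4) + x) = even (3 * j + x)" for x
  proof -
    have "(3 * (j + 4) + x + y) div 2 mod 6 = (3 * j + x + y) div 2 mod 6" for y
    proof -
      have "3 * (j + 4) + x + y = 6 * 2 + (3 * j + x + y)" by simp
      then have "(3 * (j + 4) + x + y) div 2 = 6 + (3 * j + x + y) div 2" by (simp only: div_mult_self3)
      then show ?thesis by (simp only: mod_add_self1)
    qed
    then show "(3 * (j + 4) + x + 10) div 2 mod 6 = (3 * j + x + 10) div 2 mod 6"
      "(3 * (j + 4) + x + 11) div 2 mod 6 = (3 * j + x + 11) div 2 mod 6" by blast+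
    show "even (3 * (j + 4) + x) = even (3 * j + x)" by simp
  qed
  then have "root7 r s (j + 4) = root7 r s j" by (simp only: root7_def Let_def)
  with 5 show ?thesis by (simp add: hecke_root_def)
qed

text \<open>The common period 4 is a multiple of the length of every listed tuple, so four values
  decide.\<close>

lemma has_period_modI:
  assumes per: "\<And>j. a (j + 4) = a j" and len: "length cs \<in> {1, 2, 4}"
    and all: "\<forall>j \<in> {1, 2, 3, 4}. a j mod int m = cs ! ((j - 1) mod length cs) mod int m"
  shows "has_period_mod m a cs"
  unfolding has_period_mod_def
proof (intro ballI allI impI)
  fix i j :: nat assume i: "i \<in> {1..length cs}" and j: "j \<ge> 1" and ij: "[j = i] (mod length cs)"
  have shift: "a (n + 4 * t) = a n" for n t
  proof (induction t)
    case (Suc t)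
    have eq: "n + 4 * Suc t = (n + 4 * t) + 4" by simp
    show ?case unfolding eq per by (rule Suc)
  qed simp
  define j' where "j' = (j - 1) mod 4 + 1"
  have "j = j' + 4 * ((j - 1) div 4)" using j unfolding j'_def by simp
  then have aj: "a j = a j'" using shift by metis
  have "(j - 1) mod 4 < 4" by simp
  then have "j' \<in> {1, 2, 3, 4}" unfolding j'_def by auto
  then have "a j' mod int m = cs ! ((j' - 1) mod length cs) mod int m" using all by blast
  also have "(j' - 1) mod length cs = (j - 1) mod length cs"
  proof -
    have "length cs dvd 4" using len by auto
    then show ?thesis by (simp only: j'_def add_diff_cancel_right' mod_mod_cancel)
  qed
  also have "(j - 1) mod length cs = i - 1"
  proof -
    have "[(j - 1) + 1 = (i - 1) + 1] (mod length cs)" using ij i j by simp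
    then have "[j - 1 = i - 1] (mod length cs)" by (simp only: cong_add_rcancel_nat)
    moreover have "i - 1 < length cs" using i by simp linarith
    ultimately show ?thesis by (simp add: cong_def)
  qed
  finally show "[a j = cs ! (i - 1)] (mod int m)" by (simp add: cong_def aj)
qed

lemma hecke_poly_root:
  assumes l: "l \<in> {2, 3, 5, 7}" and p: "prime p" "p \<noteq> l" and k: "even k" "k > 0"
  shows "poly_cong l (hecke_poly p k) (\<Prod>j = 1..cusp_dim k. [:- of_int (hecke_root l (p mod l) (k mod (l - 1)) j), 1:])"
proof -
  consider "l = 2" | "l = 3" | "l = 5" | "l = 7" using l by blast
  then show ?thesis
  proof cases
    case 1
    have r: "hecke_root 2 (p mod 2) s j = 0" for s j by (simp add: hecke_root_def)
    show ?thesis unfolding 1 r by (rule hecke_poly_2[OF p(1) _ k]) (use p(2) 1 in blast)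
  next
    case 2
    have r: "hecke_root 3 (p mod 3) s j = (1 + int p) mod 3" for s j
      by (simp add: hecke_root_def of_nat_mod mod_add_right_eq)
    show ?thesis unfolding 2 r by (rule hecke_poly_3[OF p(1) _ k]) (use p(2) 2 in blast)
  next
    case 3
    have r: "hecke_root 5 = root5" by (simp add: hecke_root_def fun_eq_iff)
    have e: "k mod (5 - 1) = k mod 4" by simp
    show ?thesis unfolding 3 r e by (rule hecke_poly_5[OF p(1) _ k]) (use p(2) 3 in blast)
  next
    case 4
    have r: "hecke_root 7 = root7" by (simp add: hecke_root_def fun_eq_iff)
    have e: "k mod (7 - 1) = k mod 6" by simp
    show ?thesis unfolding 4 r e by (rule hecke_poly_7[OF p(1) _ k]) (use p(2) 4 in blast)
  qed
qed

theorem mainTheorem2: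
  fixes l :: nat
  assumes "l \<in> {2, 3, 5, 7}"
  shows
    "(\<exists>a :: nat \<Rightarrow> nat \<Rightarrow> nat \<Rightarrow> int.
        (\<forall>r s. \<exists>N>0. \<forall>j\<ge>1. a r s (j + N) = a r s j) \<and>
        (\<forall>p k :: nat. prime p \<and> p \<noteq> l \<and> k > 0 \<and> even k \<longrightarrow>
           poly_cong l (hecke_poly p k)
             (\<Prod>j = 1..cusp_dim k. [:- of_int (a (p mod l) (k mod (l - 1)) j), 1:])) \<and>
        (l = 5 \<longrightarrow>
           has_period_mod 5 (a 1 0) [2]    \<and> has_period_mod 5 (a 1 2) [2] \<and>
           has_period_mod 5 (a 2 0) [1, 4] \<and> has_period_mod 5 (a 2 2) [2, 3] \<and>
           has_period_mod 5 (a 3 0) [2, 3] \<and> has_period_mod 5 (a 3 2) [1, 4] \<and>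
           has_period_mod 5 (a 4 0) [0]    \<and> has_period_mod 5 (a 4 2) [0]) \<and>
        (l = 7 \<longrightarrow>
           has_period_mod 7 (a 1 0) [2] \<and>
           has_period_mod 7 (a 1 2) [2] \<and>
           has_period_mod 7 (a 1 4) [2] \<and>
           has_period_mod 7 (a 2 0) [4, 5] \<and>
           has_period_mod 7 (a 2 2) [1, 3] \<and>
           has_period_mod 7 (a 2 4) [6, 2] \<and>
           has_period_mod 7 (a 3 0) [0, 1, 0, 6] \<and>
           has_period_mod 7 (a 3 2) [0, 3, 0, 4] \<and>
           has_period_mod 7 (a 3 4) [5, 0, 2, 0] \<and>
           has_period_mod 7 (a 4 0) [1, 3] \<and>
           has_period_mod 7 (a 4 2) [4, 5] \<and>
           has_period_mod 7 (a 4 4) [6, 2] \<and>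
           has_period_mod 7 (a 5 0) [0, 3, 0, 4] \<and>
           has_period_mod 7 (a 5 2) [0, 1, 0, 6] \<and>
           has_period_mod 7 (a 5 4) [2, 0, 5, 0] \<and>
           has_period_mod 7 (a 6 0) [0] \<and>
           has_period_mod 7 (a 6 2) [0] \<and>
           has_period_mod 7 (a 6 4) [0]))
     \<and> (\<forall>p q k :: nat. prime p \<and> prime q \<and> p \<noteq> l \<and> q \<noteq> l \<and> [p = q] (mod l) \<and> k > 0 \<and> even k \<longrightarrow>
          poly_cong l (hecke_poly p k) (hecke_poly q k))
     \<and> (l = 3 \<longrightarrow>
          (\<forall>p k :: nat. prime p \<and> p \<noteq> 3 \<and> k > 0 \<and> even k \<longrightarrow>
             ([p = 1] (mod 3) \<longrightarrow> poly_cong 3 (hecke_poly p k) ([:- 2, 1:] ^ cusp_dim k)) \<and>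
             ([p = 2] (mod 3) \<longrightarrow> poly_cong 3 (hecke_poly p k) ([:0, 1:] ^ cusp_dim k))))"
proof (intro conjI exI[of _ "hecke_root l"] allI impI)
  fix r s :: nat
  show "\<exists>N>0. \<forall>j\<ge>1. hecke_root l r s (j + N) = hecke_root l r s j"
    by (intro exI[of _ 4] conjI allI impI hecke_root_periodic) simp
next
  fix p k :: nat assume "prime p \<and> p \<noteq> l \<and> k > 0 \<and> even k"
  then show "poly_cong l (hecke_poly p k) (\<Prod>j = 1..cusp_dim k. [:- of_int (hecke_root l (p mod l) (k mod (l - 1)) j), 1:])"
    by (intro hecke_poly_root[OF assms]) auto
next
  fix p q k :: nat assume a: "prime p \<and> prime q \<and> p \<noteq> l \<and> q \<noteq> l \<and> [p = q] (mod l) \<and> k > 0 \<and> even k"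
  then have "p mod l = q mod l" by (simp add: cong_def)
  then show "poly_cong l (hecke_poly p k) (hecke_poly q k)"
    using hecke_poly_root[OF assms, of p k] hecke_poly_root[OF assms, of q k] a
    by (metis poly_cong_sym poly_cong_trans)
next
  fix p k :: nat assume l3: "l = 3" and a: "prime p \<and> p \<noteq> 3 \<and> k > 0 \<and> even k"
  have main: "poly_cong 3 (hecke_poly p k) ([:- of_int ((1 + int p) mod 3), 1:] ^ cusp_dim k)"
    using hecke_poly_3[of p k] a by simp
  show "poly_cong 3 (hecke_poly p k) ([:- 2, 1:] ^ cusp_dim k)" if "[p = 1] (mod 3)"
  proof -
    have "p mod 3 = 1" using that by (simp add: cong_def)
    then have "(1 + int p) mod 3 = 2" by presburger
    with main show ?thesis by simp
  qed
  show "poly_cong 3 (hecke_poly p k) ([:0, 1:] ^ cusp_dim k)" if "[p = 2] (mod 3)"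
  proof -
    have "p mod 3 = 2" using that by (simp add: cong_def)
    then have "(1 + int p) mod 3 = 0" by presburger
    with main show ?thesis by simp
  qed
\<comment> \<open>What is left are the listed periods, each a check of four values.\<close>
qed (rule has_period_modI, rule hecke_root_periodic, simp add: eval_nat_numeral, simp add: hecke_root_def root5_def root7_def flip: numeral_2_eq_2)+

end
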